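(* Let $\mathcal A=\{0,1\}$, let $\mathrm{TM}\subset\mathcal A^{\mathbb N}$ be the subshift associated to the Thue–Morse substitution, and let $V\in\Xi$, where $\Xi$ is the class of potentials on $\mathcal A^{\mathbb N}$ defined in the context (with $\mathbb K=\mathrm{TM}$). Then there exists $\beta_0$ such that for all $\beta>\beta_0$ one has $P(\beta)=0$ and the equilibrium measure is the unique invariant measure supported on $\mathrm{TM}$. Moreover, $\beta_0<16.6$ if $V=V_0$.
   Context: $\sigma$ is the shift on $\mathcal A^{\mathbb N}$, $\sigma(u)_n=u_{n+1}$. The distance is $d(x,y)=2^{-n}$ with $n=\min\{i\ge 0: x_i\neq y_i\}$ for $x\ne y$ (and $d(x,x)=0$), and $d(x,\mathbb K)=\inf_{y\in \mathbb K}d(x,y)$. The Thue–Morse substitution is $\theta:0\mapsto 01,\ 1\mapsto 10$, extended to finite words by concatenation. $\mathrm{TM}$ is the set of $x\in\mathcal A^{\mathbb N}$ such that for all non-negative integers $i,j$ the word $x_i\dots x_{i+j}$ appears in some $\theta^n(a)$ with $n\in\mathbb N$, $a\in\mathcal A$. It is minimal and uniquely ergodic, i.e. it carries a unique $\sigma$-invariant probability measure. For a potential $V:\mathcal A^{\mathbb N}\to\mathbb R$ and $\beta\ge 0$, the pressure is $P(\beta)=\sup\{h_\mu+\beta\int V\,d\mu\}$, where the supremum is over all $\sigma$-invariant probability measures $\mu$ on the full shift $\mathcal A^{\mathbb N}$ and $h_\mu$ is the Kolmogorov entropy. An equilibrium measure (equilibrium state) at $\beta$ is a measure $\mu$ realizing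 this supremum. $\Xi$ is the set of functions $V=-\varphi:\mathcal A^{\mathbb N}\to\mathbb R$ such that: (i) $\varphi(x)=0$ if and only if $x\in\mathbb K$; (ii) $\varphi(x)=\frac{g(x)}{n}+o(\frac1n)$ if $d(x,\mathbb K)=2^{-n}$, where $g$ is a positive continuous function. $V_0=-\varphi_0$, where $\varphi_0(x)=\log\left(1+\frac1{n+1}\right)$ if $d(x,\mathbb K)=2^{-n}$, and $\varphi_0(x)=0$ if $x\in\mathbb K$; $V_0$ belongs to $\Xi$.
   Formalization: φ is assumed continuous and nonnegative, and o(1/n) is uniform in x. Without φ ≥ 0, putting φ = −1 on the cylinder [000] gives P(β) ≥ β; without continuity, φ(0^j1…) = 2^{-j} for j ≥ 3 gives P(β) > 0 for all β. *)

theory Defs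
  imports "HOL-Probability.Probability" "HOL-Library.Sublist"
begin

text \<open>
  The alphabet \<open>{0, 1}\<close> is represented by \<^typ>\<open>bool\<close>, with \<^const>\<open>False\<close> for 0 and \<^const>\<open>True\<close>
  for 1. The topology and the Borel sets of the full shift \<^typ>\<open>nat \<Rightarrow> bool\<close> are those of the
  product topology; lemma \<open>open_iff_seq_dist\<close> below shows that \<open>seq_dist\<close> induces this topology.
\<close>

type_synonym seq = "nat \<Rightarrow> bool"

definition shift :: "seq \<Rightarrow> seq" where
  "shift u = (\<lambda>n. u (Suc n))"

definition seq_dist :: "seq \<Rightarrow> seq \<Rightarrow> real" where
  "seq_dist x y = (if x = y then 0 else (1/2) ^ (LEAST i. x i \<noteq> y i))"

definition dist_to :: "seq \<Rightarrow> seq set \<Rightarrow> real" where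
  "dist_to x K = (INF y\<in>K. seq_dist x y)"


subsection \<open>The Thue--Morse subshift\<close>

fun theta_letter :: "bool \<Rightarrow> bool list" where
  "theta_letter False = [False, True]"
| "theta_letter True = [True, False]"

definition theta :: "bool list \<Rightarrow> bool list" where
  "theta w = concat (map theta_letter w)"

definition TM :: "seq set" where
  "TM = {x. \<forall>i j. \<exists>n a. sublist (map x [i..<Suc (i + j)]) ((theta ^^ n) [a])}"


subsection \<open>Kolmogorov entropy\<close>

definition finite_partition :: "'a measure \<Rightarrow> 'a set set \<Rightarrow> bool" where
  "finite_partition M P \<longleftrightarrow> finite P \<and> P \<subseteq> sets M \<and> partition_on (space M) P"

text \<open>
  In the following two definitions empty or null sets contribute nothing, as \<open>0 * ln 0 = 0\<close>.
  \<open>join T M P n\<close> consists of the atoms of the common refinement of the \<open>T\<^sup>-\<^sup>i P\<close> for \<open>i < n\<close>,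
  possibly together with the empty set.
\<close>

definition partition_entropy :: "'a measure \<Rightarrow> 'a set set \<Rightarrow> real" where
  "partition_entropy M P = - (\<Sum>A\<in>P. measure M A * ln (measure M A))"

definition join :: "('a \<Rightarrow> 'a) \<Rightarrow> 'a measure \<Rightarrow> 'a set set \<Rightarrow> nat \<Rightarrow> 'a set set" where
  "join T M P n = {{x \<in> space M. \<forall>i<n. (T ^^ i) x \<in> a i} | a. \<forall>i<n. a i \<in> P}"

definition entropy_wrt :: "('a \<Rightarrow> 'a) \<Rightarrow> 'a measure \<Rightarrow> 'a set set \<Rightarrow> real" where
  "entropy_wrt T M P = lim (\<lambda>n. partition_entropy M (join T M P n) / real n)"

definition kolmogorov_entropy :: "('a \<Rightarrow> 'a) \<Rightarrow> 'a measure \<Rightarrow> ereal" where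
  "kolmogorov_entropy T M = (SUP P\<in>{P. finite_partition M P}. ereal (entropy_wrt T M P))"


subsection \<open>Pressure and equilibrium measures\<close>

definition invariant_prob :: "seq measure \<Rightarrow> bool" where
  "invariant_prob \<mu> \<longleftrightarrow> sets \<mu> = sets borel \<and> prob_space \<mu> \<and> distr \<mu> borel shift = \<mu>"

definition free_energy :: "(seq \<Rightarrow> real) \<Rightarrow> real \<Rightarrow> seq measure \<Rightarrow> ereal" where
  "free_energy V \<beta> \<mu> = kolmogorov_entropy shift \<mu> + ereal (\<beta> * (\<integral>x. V x \<partial>\<mu>))"

definition pressure :: "(seq \<Rightarrow> real) \<Rightarrow> real \<Rightarrow> ereal" where
  "pressure V \<beta> = (SUP \<mu>\<in>{\<mu>. invariant_prob \<mu>}. free_energy V \<beta> \<mu>)"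

definition equilibrium_measure :: "(seq \<Rightarrow> real) \<Rightarrow> real \<Rightarrow> seq measure \<Rightarrow> bool" where
  "equilibrium_measure V \<beta> \<mu> \<longleftrightarrow> invariant_prob \<mu> \<and> free_energy V \<beta> \<mu> = pressure V \<beta>"

definition supported_on :: "seq measure \<Rightarrow> seq set \<Rightarrow> bool" where
  "supported_on \<mu> K \<longleftrightarrow> emeasure \<mu> K = 1"


subsection \<open>The class of potentials\<close>

text \<open>
  Potentials are continuous and \<open>\<phi> = - V\<close> is nonnegative; neither is implied by the other two
  conditions, since the asymptotics only concern points close to \<open>K\<close>. The \<open>o(1/n)\<close> is uniform
  in the points at distance \<open>2\<^sup>-\<^sup>n\<close> from \<open>K\<close>.
\<close>

definition Xi :: "seq set \<Rightarrow> (seq \<Rightarrow> real) set" where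
  "Xi K = {V. \<exists>\<phi>. V = (\<lambda>x. - \<phi> x) \<and> continuous_on UNIV \<phi> \<and> (\<forall>x. \<phi> x \<ge> 0) \<and>
     (\<forall>x. \<phi> x = 0 \<longleftrightarrow> x \<in> K) \<and>
     (\<exists>g. continuous_on UNIV g \<and> (\<forall>x. g x > 0) \<and>
        (\<forall>\<epsilon>>0. \<exists>N\<ge>1. \<forall>n\<ge>N. \<forall>x. dist_to x K = (1/2) ^ n \<longrightarrow>
           \<bar>\<phi> x - g x / real n\<bar> \<le> \<epsilon> * (1 / real n)))}"

definition phi0 :: "seq set \<Rightarrow> seq \<Rightarrow> real" where
  "phi0 K x = (if x \<in> K then 0
     else ln (1 + 1 / (real (THE n. dist_to x K = (1/2) ^ n) + 1)))"

definition V0 :: "seq set \<Rightarrow> seq \<Rightarrow> real" where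
  "V0 K x = - phi0 K x"


subsection \<open>The metric and the product topology\<close>

lemma seq_dist_less_iff: "seq_dist x y < (1/2) ^ n \<longleftrightarrow> (\<forall>i\<le>n. x i = y i)"
proof (cases "x = y")
  case False
  then obtain k where "x k \<noteq> y k" by auto
  then have L: "x (LEAST i. x i \<noteq> y i) \<noteq> y (LEAST i. x i \<noteq> y i)"
    by (rule LeastI)
  have "seq_dist x y < (1/2) ^ n \<longleftrightarrow> n < (LEAST i. x i \<noteq> y i)"
    using False by (simp add: seq_dist_def power_strict_decreasing_iff)
  also have "\<dots> \<longleftrightarrow> (\<forall>i\<le>n. x i = y i)"
  proof
    assume "n < (LEAST i. x i \<noteq> y i)"
    then show "\<forall>i\<le>n. x i = y i"
      using not_less_Least[of _ "\<lambda>i. x i \<noteq> y i"] le_less_trans by blast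
  next
    assume "\<forall>i\<le>n. x i = y i"
    then show "n < (LEAST i. x i \<noteq> y i)"
      using L not_le by blast
  qed
  finally show ?thesis .
qed (simp add: seq_dist_def)

lemma open_cylinder: "open {y :: seq. \<forall>i\<le>n. x i = y i}"
proof -
  have "{y :: seq. \<forall>i\<le>n. x i = y i} = (\<Inter>i\<le>n. (\<lambda>y. y i) -` {x i})"
    by auto
  moreover have "open ((\<lambda>y :: seq. y i) -` {x i})" for i
    by (intro open_vimage discrete_topology_class.open_discrete) simp
  ultimately show ?thesis
    by (simp add: open_INT)
qed

lemma open_iff_seq_dist:
  "open (S :: seq set) \<longleftrightarrow> (\<forall>x\<in>S. \<exists>e>0. \<forall>y. seq_dist x y < e \<longrightarrow> y \<in> S)"
proof
  assume "open S"
  show "\<forall>x\<in>S. \<exists>e>0. \<forall>y. seq_dist x y < e \<longrightarrow> y \<in> S"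
  proof
    fix x assume "x \<in> S"
    obtain X where X: "x \<in> Pi\<^sub>E UNIV X" "finite {i. X i \<noteq> UNIV}" "Pi\<^sub>E UNIV X \<subseteq> S"
      using product_topology_open_contains_basis[of "\<lambda>_. euclidean" UNIV S x] \<open>open S\<close> \<open>x \<in> S\<close>
      unfolding open_fun_def by auto
    obtain n where n: "\<And>i. X i \<noteq> UNIV \<Longrightarrow> i \<le> n"
      using X(2) by (meson finite_nat_set_iff_bounded_le mem_Collect_eq)
    have "y \<in> S" if "seq_dist x y < (1/2) ^ n" for y
    proof -
      have "y i \<in> X i" for i
      proof (cases "X i = UNIV")
        case False
        then have "x i = y i"
          using that n[of i] unfolding seq_dist_less_iff by blast
        then show ?thesis
          using PiE_mem[OF X(1), of i] by simp
      qed simp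
      then show ?thesis using X(3) by auto
    qed
    then show "\<exists>e>0. \<forall>y. seq_dist x y < e \<longrightarrow> y \<in> S"
      by (intro exI[of _ "(1/2) ^ n"]) auto
  qed
next
  assume R: "\<forall>x\<in>S. \<exists>e>0. \<forall>y. seq_dist x y < e \<longrightarrow> y \<in> S"
  show "open S"
  proof (subst open_subopen, rule ballI)
    fix x assume "x \<in> S"
    then obtain e where e: "e > 0" "\<And>y. seq_dist x y < e \<Longrightarrow> y \<in> S" using R by blast
    obtain n where "(1/2 :: real) ^ n < e"
      using real_arch_pow_inv[OF e(1), of "1/2"] by auto
    then have "{y. \<forall>i\<le>n. x i = y i} \<subseteq> S"
      using e(2) seq_dist_less_iff[of x _ n] by (auto intro: less_trans)
    then show "\<exists>T. open T \<and> x \<in> T \<and> T \<subseteq> S"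
      using open_cylinder[of n x] by blast
  qed
qed

end

theory Submission
  imports Defs
begin

text \<open>
  Let \<open>\<phi>\<^sub>0 = - V\<^sub>0\<close>. Every \<open>V \<in> \<Xi>\<close> satisfies \<open>- V \<ge> c \<phi>\<^sub>0\<close> for some \<open>c > 0\<close> by compactness, so it is
  enough to show \<open>h\<^sub>\<mu> \<le> 16 \<integral> \<phi>\<^sub>0 d\<mu>\<close> for all invariant \<open>\<mu>\<close> and to take \<open>\<beta>\<^sub>0 = 16 / c\<close>; for larger \<open>\<beta>\<close> the
  free energy of \<open>\<mu>\<close> is negative unless \<open>\<integral> \<phi>\<^sub>0 d\<mu> = 0\<close>, that is, unless \<open>\<mu>\<close> lives on \<open>TM\<close>.

  By Gibbs' inequality, the bound on the entropy follows if \<open>Z\<^sub>n = (\<Sum>\<bar>y\<bar>=n. exp (- 16 S\<^sub>n \<phi>\<^sub>0 (y)))\<close> grows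
  polynomially. Cut \<open>y\<close> greedily into maximal factors \<open>U\<close> of the Thue--Morse language. While the right
  end of the maximal factor stays put, the sum of \<open>\<phi>\<^sub>0\<close> telescopes, so a factor \<open>U\<close> overlapping the next
  one in \<open>w'\<close> contributes \<open>((\<bar>w'\<bar> + 2) / (\<bar>U\<bar> + 2))^16\<close>. An overlap \<open>w\<close> extends within the
  language to \<open>c w\<close> and to \<open>w a\<close> but not to \<open>c w a\<close>, and by desubstitution it is then a letter or
  \<open>\<theta>^k (010)\<close> or \<open>\<theta>^k (101)\<close>. Conjugating with \<open>(\<bar>w\<bar> + 2)^8\<close>, the sum over all \<open>U\<close> that start
  with \<open>w a\<close> becomes at most 1: if \<open>U\<close> starts with \<open>\<theta>^j (..)\<close> and ends with \<open>\<theta>^i (..)\<close> then \<open>U\<close>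
  is itself a \<open>\<theta>^(min i j)\<close>-image, so that only the difference of \<open>i\<close> and \<open>j\<close> matters.

  The invariant measure on \<open>TM\<close> is determined by the frequencies of words, which exist uniformly because
  the numbers of occurrences of a word in \<open>\<theta>^n (0)\<close> and \<open>\<theta>^n (1)\<close> differ by a bounded amount.
\<close>

section \<open>The Thue--Morse language\<close>

text \<open>Why 16 and 8: a block \<open>U\<close> entered through the overlap \<open>w\<close> and
  left through \<open>w'\<close> has, after the conjugation, the weight ((|w| + 2) (|w'| + 2) / (|U|
  + 2)^2)^8, which is symmetric in the two overlaps. The language has at most 8 n words of length n,
  so the blocks with |U| + 2 > T contribute a sum of order T^-14, and only a few short lengths have
  to be counted by hand. The obstacle is that both overlaps can be about as long as the block, so
  that length alone yields no decay when the levels of the overlaps range over all scales. Removing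
  the common power of \<open>theta\<close> reduces to the case where one level is 0 and yields a
  bound 0.2 / 2^r for levels at distance r. The row sums obtained are 0.11 + 2 * 0.24 = 0.59 for a
  letter and 0.24 + 3 * 0.2 = 0.84 for a longer overlap. Both are below 1, hence the total weight
  has no exponential growth. The entropy is a supremum over all finite Borel partitions, whereas the
  weights see only words. Each partition is therefore predicted from finitely many letters up to a
  small error, and the price of the error enters Gibbs' inequality as an arbitrarily small rate per
  step.\<close>

definition lang :: "bool list set" where
  "lang = {w. \<exists>n a. sublist w ((theta ^^ n) [a])}"

lemma theta_letter_eq: "theta_letter a = [a, \<not> a]"
  by (cases a) auto

lemma theta_Nil [simp]: "theta [] = []"
  by (simp add: theta_def)

lemma theta_Cons [simp]: "theta (a # w) = a # (\<not> a) # theta w"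
  by (simp add: theta_def theta_letter_eq)

lemma theta_append [simp]: "theta (u @ v) = theta u @ theta v"
  by (simp add: theta_def)

lemma length_theta [simp]: "length (theta w) = 2 * length w"
  by (induction w) auto

lemma theta_pow_append [simp]: "(theta ^^ n) (u @ v) = (theta ^^ n) u @ (theta ^^ n) v"
  by (induction n) auto

lemma theta_pow_Nil [simp]: "(theta ^^ n) [] = []"
  by (induction n) auto

lemma length_theta_pow [simp]: "length ((theta ^^ n) w) = 2 ^ n * length w"
  by (induction n) auto

lemma take_theta_pow: "take (2 ^ n * k) ((theta ^^ n) w) = (theta ^^ n) (take k w)"
proof -
  have "(theta ^^ n) w = (theta ^^ n) (take k w) @ (theta ^^ n) (drop k w)"
    by (metis append_take_drop_id theta_pow_append)
  then show ?thesis
    by (cases "k \<le> length w") (auto simp: min_def)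
qed

lemma drop_theta_pow: "drop (2 ^ n * k) ((theta ^^ n) w) = (theta ^^ n) (drop k w)"
proof -
  have "(theta ^^ n) w = (theta ^^ n) (take k w) @ (theta ^^ n) (drop k w)"
    by (metis append_take_drop_id theta_pow_append)
  then show ?thesis
    by (cases "k \<le> length w") (auto simp: min_def)
qed

lemma take_theta: "take (2 * k) (theta w) = theta (take k w)"
  using take_theta_pow[of 1 k w] by simp

lemma drop_theta: "drop (2 * k) (theta w) = theta (drop k w)"
  using drop_theta_pow[of 1 k w] by simp

lemma nth_theta:
  assumes "i < length w"
  shows "theta w ! (2 * i) = w ! i" "theta w ! Suc (2 * i) = (\<not> w ! i)"
  using assms by (induction w arbitrary: i) (auto simp: nth_Cons split: nat.splits)

lemma inj_theta: "inj theta"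
proof
  show "theta u = theta v \<Longrightarrow> u = v" for u v
  proof (induction u arbitrary: v)
    case Nil
    then show ?case using length_theta[of v] by auto
  next
    case (Cons a u)
    then show ?case by (cases v) auto
  qed
qed

lemma inj_theta_pow: "inj (theta ^^ n)"
proof (induction n)
  case (Suc n)
  then show ?case using inj_compose[OF inj_theta Suc] by (simp add: comp_def)
qed simp

lemma sublist_theta: "sublist u v \<Longrightarrow> sublist (theta u) (theta v)"
  by (metis sublist_def theta_append)

lemma lang_sublist: "v \<in> lang \<Longrightarrow> sublist u v \<Longrightarrow> u \<in> lang"
  unfolding lang_def using sublist_order.order_trans by blast

lemma lang_append:
  assumes "p @ w @ s \<in> lang" shows "w \<in> lang"
  using lang_sublist[OF assms] by auto

lemma lang_appendD1: "u @ v \<in> lang \<Longrightarrow> u \<in> lang"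
  using lang_append[of "[]" u v] by simp

lemma lang_appendD2: "u @ v \<in> lang \<Longrightarrow> v \<in> lang"
  using lang_append[of u v "[]"] by simp

lemma lang_take: "w \<in> lang \<Longrightarrow> take n w \<in> lang"
  by (erule lang_sublist) auto

lemma lang_drop: "w \<in> lang \<Longrightarrow> drop n w \<in> lang"
  by (erule lang_sublist) auto

lemma lang_theta: "w \<in> lang \<Longrightarrow> theta w \<in> lang"
proof -
  assume "w \<in> lang"
  then obtain n a where "sublist w ((theta ^^ n) [a])" unfolding lang_def by blast
  then have "sublist (theta w) ((theta ^^ Suc n) [a])" using sublist_theta by simp
  then show "theta w \<in> lang" unfolding lang_def by blast
qed

lemma lang_theta_pow: "w \<in> lang \<Longrightarrow> (theta ^^ n) w \<in> lang"
  by (induction n) (auto intro: lang_theta)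

lemma lang_theta_powI: "(theta ^^ n) [a] \<in> lang"
  unfolding lang_def by blast

text \<open>Membership of the short words below is settled by evaluating this single word of 64
  letters.\<close>

lemma lang_small: "sublist w ((theta ^^ 6) [False]) \<Longrightarrow> w \<in> lang"
  unfolding lang_def by blast

lemma lang_length2: "[a, b] \<in> lang"
  by (rule lang_small) (cases a; cases b; simp add: eval_nat_numeral sublist_Cons_right)

lemma lang_length1: "[a] \<in> lang"
  using lang_appendD1[of "[a]" "[a]"] lang_length2 by simp

lemma Nil_lang [simp]: "[] \<in> lang"
  using lang_take[OF lang_length1, of 0] by simp

text \<open>Some \<open>[x, a, a]\<close> is in the language. Its image under
  \<open>theta ^^ n\<close> has the image of \<open>a\<close> that contains \<open>w\<close> in the
  middle, with nonempty words on both sides.\<close>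

lemma lang_extend:
  assumes "w \<in> lang"
  obtains b c where "b # w @ [c] \<in> lang"
proof -
  obtain n a where "sublist w ((theta ^^ n) [a])"
    using assms unfolding lang_def by blast
  then obtain p s where ps: "(theta ^^ n) [a] = p @ w @ s"
    by (auto simp: sublist_def)
  have "[\<not> a, a, a, \<not> a] \<in> lang"
    by (rule lang_small) (cases a; simp add: eval_nat_numeral sublist_Cons_right)
  then have "[a, a, a] \<in> lang \<or> [\<not> a, a, a] \<in> lang"
    using lang_appendD1[of "[\<not> a, a, a]" "[\<not> a]"] by simp
  then obtain x where "[x, a, a] \<in> lang" by blast
  then have "(theta ^^ n) ([x] @ [a] @ [a]) \<in> lang"
    using lang_theta_pow by simp
  then have L: "((theta ^^ n) [x] @ p) @ w @ (s @ (theta ^^ n) [a]) \<in> lang"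
    by (simp only: theta_pow_append ps append.assoc)
  have ne: "(theta ^^ n) [y] \<noteq> []" for y
    using length_theta_pow[of n "[y]"] by (metis length_Cons list.size(3) mult_is_0 nat.distinct(1) power_not_zero zero_neq_numeral)
  obtain P b where P: "(theta ^^ n) [x] @ p = P @ [b]"
    using ne[of x] by (metis append_is_Nil_conv rev_exhaust)
  obtain c S where S: "s @ (theta ^^ n) [a] = c # S"
    using ne[of a] by (metis append_is_Nil_conv list.exhaust)
  have "P @ (b # w @ [c]) @ S \<in> lang"
    using L unfolding P S by simp
  then show ?thesis
    using that lang_append by blast
qed

section \<open>Desubstitution and synchronization\<close>

lemma desubst:
  assumes "w \<in> lang"
  obtains V p s where "V \<in> lang" "theta V = p @ w @ s"
proof -
  obtain n a where na: "sublist w ((theta ^^ n) [a])"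
    using assms unfolding lang_def by blast
  then have "sublist w (theta ((theta ^^ (n - 1)) [a]))"
  proof (cases n)
    case 0
    then have "sublist w [a]" using na by simp
    moreover have "sublist [a] (theta [a])" by (simp add: sublist_Cons_right)
    ultimately have "sublist w (theta [a])" by (rule sublist_order.order_trans)
    then show ?thesis using 0 by simp
  qed auto
  then show ?thesis
    using that lang_theta_powI by (metis sublist_def)
qed

lemma desubst_pow:
  assumes "w \<in> lang"
  obtains V p s where "V \<in> lang" "(theta ^^ k) V = p @ w @ s"
  using assms
proof (induction k arbitrary: w thesis)
  case 0
  then show ?case by (metis append_Nil append_Nil2 funpow_0)
next
  case (Suc k)
  obtain U p s where U: "U \<in> lang" "theta U = p @ w @ s"
    using desubst Suc.prems(2) by blast
  obtain V p' s' where V: "V \<in> lang" "(theta ^^ k) V = p' @ U @ s'"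
    using Suc.IH U(1) by blast
  have "(theta ^^ Suc k) V = (theta p' @ p) @ w @ (s @ theta s')"
    using U V by simp
  then show ?case using Suc.prems(1) V(1) by blast
qed

lemma desubst_pow_trim:
  assumes "u \<in> lang"
  obtains V p s where "V \<in> lang" "(theta ^^ n) V = p @ u @ s" "length p < 2 ^ n" "length s < 2 ^ n"
proof -
  obtain V p s where VL: "V \<in> lang" and V: "(theta ^^ n) V = p @ u @ s" using desubst_pow[OF assms] by metis
  define k where "k = length p div 2 ^ n"
  define p' where "p' = drop (2 ^ n * k) p"
  have k: "2 ^ n * k \<le> length p" by (simp add: k_def)
  have p': "length p' < 2 ^ n" by (simp add: p'_def k_def minus_mult_div_eq_mod)
  have 1: "(theta ^^ n) (drop k V) = p' @ u @ s"
    using V k by (simp add: drop_theta_pow[symmetric] p'_def)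
  define l where "l = length p' + length u"
  \<comment> \<open>This is \<open>l\<close> / 2^n rounded up: the least number of letters whose
    image covers \<open>p' @ u\<close>.\<close>
  define m where "m = (l + (2 ^ n - 1)) div 2 ^ n"
  define s' where "s' = take (2 ^ n * m - l) s"
  have pos: "(2::nat) ^ n > 0" by simp
  have "2 ^ n * m \<le> l + (2 ^ n - 1)" unfolding m_def by (rule times_div_less_eq_dividend)
  then have m2: "2 ^ n * m - l < 2 ^ n" using pos by linarith
  have "l + (2 ^ n - 1) < 2 ^ n * m + 2 ^ n"
    unfolding m_def using pos by (metis add.commute dividend_less_times_div mult_Suc_right mult.commute dividend_less_div_times)
  then have m1: "l \<le> 2 ^ n * m" using pos by linarith
  have "(theta ^^ n) (take m (drop k V)) = p' @ u @ s'"
    using m1 by (auto simp: take_theta_pow[symmetric] 1 s'_def l_def)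
  moreover have "length s' < 2 ^ n" using m2 by (simp add: s'_def)
  ultimately show ?thesis using that p' VL lang_take lang_drop by blast
qed

lemma desubst_trim:
  assumes "w \<in> lang"
  obtains V p s where "V \<in> lang" "theta V = p @ w @ s" "length p \<le> 1" "length s \<le> 1"
  using desubst_pow_trim[OF assms, of 1] by (auto simp: less_Suc_eq_le numeral_2_eq_2)

text \<open>The image of a letter consists of two different letters, so two equal neighbours belong
  to different images. One such pair fixes where \<open>w\<close> is cut into images.\<close>

lemma parse_sync:
  assumes "theta V = p @ w @ s" "Suc i < length w" "w ! i = w ! Suc i"
  shows "odd (length p + i)"
proof
  assume "even (length p + i)"
  then obtain j where j: "length p + i = 2 * j" by blast
  have len: "2 * length V = length p + length w + length s"
    using arg_cong[OF assms(1), of length] by simp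
  have "j < length V" using len j assms(2) by linarith
  from nth_theta[OF this] have "theta V ! (length p + i) \<noteq> theta V ! Suc (length p + i)"
    using j by simp
  moreover have "theta V ! (length p + i) = w ! i"
    using assms(2) by (simp add: assms(1) nth_append)
  moreover have "theta V ! Suc (length p + i) = w ! Suc i"
    using assms(2) nth_append[of p "w @ s" "length p + Suc i"] by (simp add: assms(1) nth_append)
  ultimately show False using assms(3) by simp
qed

section \<open>Forbidden words and the overlaps at which a word leaves the language\<close>

lemma cube_notin_lang: "[a, a, a] \<notin> lang"
proof
  assume "[a, a, a] \<in> lang"
  then obtain V p s where "theta V = p @ [a, a, a] @ s" using desubst by blast
  from parse_sync[OF this, of 0] parse_sync[OF this, of 1] show False by auto
qed

text \<open>Either way of cutting this alternating word into images of letters lifts it to a cube of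
  one letter.\<close>

lemma overlap_notin_lang: "[a, \<not> a, a, \<not> a, a] \<notin> lang"
proof
  assume "[a, \<not> a, a, \<not> a, a] \<in> lang"
  then obtain V p s where V: "V \<in> lang" "theta V = p @ [a, \<not> a, a, \<not> a, a] @ s"
    "length p \<le> 1" "length s \<le> 1"
    using desubst_trim by blast
  have "2 * length V = length p + 5 + length s"
    using arg_cong[OF V(2), of length] by simp
  then have lV: "length V = 3" using V(3,4) by linarith
  then obtain x y z where xyz: "V = [x, y, z]"
    by (auto simp: length_Suc_conv eval_nat_numeral)
  have "x = y \<and> y = z"
    using V(2,3) by (cases p) (auto simp: xyz)
  then show False using V(1) cube_notin_lang by (simp add: xyz)
qed

text \<open>The equal pair forces \<open>c # w\<close> and \<open>w @ [a]\<close> to be cut in the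
  same places of \<open>w\<close>. If \<open>w\<close> started inside an image, its first letter
  would determine \<open>c\<close>, and a preimage of \<open>w @ [a]\<close> would cover
  \<open>c # w @ [a]\<close>. If \<open>w\<close> ended inside an image, its last letter would
  determine \<open>a\<close>, and a preimage of \<open>c # w\<close> would cover it. So
  \<open>w\<close> is a union of whole images, and the failure to extend passes to the
  preimage.\<close>

lemma exit_desubst:
  assumes cw: "c # w \<in> lang" and wa: "w @ [a] \<in> lang" and bad: "c # w @ [a] \<notin> lang"
    and i: "Suc i < length w" "w ! i = w ! Suc i"
  obtains w0 e where "w = theta w0" "e # w0 \<in> lang" "w0 @ [a] \<in> lang" "e # w0 @ [a] \<notin> lang"
proof -
  obtain V1 p1 s1 where V1: "V1 \<in> lang" "theta V1 = p1 @ (c # w) @ s1" "length p1 \<le> 1" "length s1 \<le> 1"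
    using desubst_trim[OF cw] .
  obtain V2 p2 s2 where V2: "V2 \<in> lang" "theta V2 = p2 @ (w @ [a]) @ s2" "length p2 \<le> 1" "length s2 \<le> 1"
    using desubst_trim[OF wa] .
  have o1: "odd (length p1 + Suc i)"
    using parse_sync[OF V1(2), of "Suc i"] i by simp
  have o2: "odd (length p2 + i)"
    using parse_sync[OF V2(2), of i] i by (simp add: nth_append)
  obtain h w' where w': "w = h # w'" using i by (cases w) auto
  show ?thesis
  proof (cases p1)
    case Nil
    then have "length p2 = 1" using o1 o2 V2(3) by (cases "length p2") auto
    then obtain d where d: "p2 = [d]" by (auto simp: length_Suc_conv)
    have "h = (\<not> c)" using V1(2) unfolding Nil w' by (cases V1) auto
    moreover have "h = (\<not> d)" using V2(2) unfolding d w' by (cases V2) auto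
    ultimately have "[] @ (c # w @ [a]) @ s2 = theta V2" using V2(2) d by simp
    then have "c # w @ [a] \<in> lang"
      using lang_theta[OF V2(1)] lang_append by metis
    then show ?thesis using bad by simp
  next
    case (Cons f p1')
    then have p1: "p1 = [f]" using V1(3) by simp
    have p2: "p2 = []" using o1 o2 V2(3) p1 by (cases p2) auto
    obtain V1' where V1': "V1 = f # V1'" "c = (\<not> f)" "theta V1' = w @ s1"
      using V1(2) unfolding p1 by (cases V1) auto
    have T2: "theta V2 = w @ a # s2" using V2(2) p2 by simp
    have lens: "2 * length V1' = length w + length s1" "2 * length V2 = length w + 1 + length s2"
      using arg_cong[OF V1'(3), of length] arg_cong[OF T2, of length] by simp_all
    show ?thesis
    proof (cases "even (length w)")
      case False
      then obtain m where m: "length w = Suc (2 * m)" by (metis oddE Suc_eq_plus1)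
      have "length s1 \<noteq> 0" using lens m by presburger
      then have "length s1 = 1" using V1(4) by linarith
      then obtain g where g: "s1 = [g]" by (auto simp: length_Suc_conv)
      have "m < length V1'" "m < length V2" using lens m by linarith+
      from nth_theta[OF this(1)] nth_theta[OF this(2)]
      have "g = (\<not> w ! (2 * m))" "a = (\<not> w ! (2 * m))"
        unfolding V1'(3) T2 g using m by (simp_all add: nth_append)
      then have "theta V1 = [f] @ (c # w @ [a]) @ []" using V1(2) p1 g by simp
      then have "c # w @ [a] \<in> lang"
        using lang_theta[OF V1(1)] lang_append by metis
      then show ?thesis using bad by simp
    next
      case True
      then obtain m where m: "length w = 2 * m" by blast
      define w0 where "w0 = take m V1'"
      have w: "w = theta w0"
        using V1'(3) m by (simp add: w0_def take_theta[symmetric])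
      have "theta (take m V2) = w"
        using T2 m by (simp add: take_theta[symmetric])
      then have w0': "take m V2 = w0" using w inj_theta by (metis injD)
      have mm: "m < length V2" using lens m by linarith
      have "a = V2 ! m" using nth_theta(1)[OF mm] m by (simp add: T2 nth_append)
      then have "w0 @ [a] = take (Suc m) V2" using mm w0' by (simp add: take_Suc_conv_app_nth)
      then have A: "w0 @ [a] \<in> lang" using V2(1) lang_take by simp
      have "f # w0 = take (Suc m) V1" by (simp add: V1' w0_def)
      then have B: "f # w0 \<in> lang" using V1(1) lang_take by simp
      have "f # w0 @ [a] \<notin> lang"
      proof
        assume "f # w0 @ [a] \<in> lang"
        from lang_theta[OF this] have "[f] @ (c # w @ [a]) @ [\<not> a] \<in> lang"
          by (simp add: w V1'(2))
        then show False using bad lang_append by blast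
      qed
      then show ?thesis using that w A B by blast
    qed
  qed
qed

text \<open>The name abbreviates bispecial; \<open>k\<close> is called the level of these words
  below, and their length is 3 * 2^k.\<close>

definition bisp :: "nat \<Rightarrow> bool list set" where
  "bisp k = (theta ^^ k) ` {[False, True, False], [True, False, True]}"

lemma bisp_Suc: "bisp (Suc k) = theta ` bisp k"
  by (simp add: bisp_def)

lemma bisp_0: "u \<in> bisp 0 \<longleftrightarrow> (\<exists>a. u = [a, \<not> a, a])"
  by (auto simp: bisp_def ex_bool_eq)

lemma length_bisp: "w \<in> bisp k \<Longrightarrow> length w = 3 * 2 ^ k"
  by (auto simp: bisp_def)

text \<open>A finite check: an alternating word of length at least 5 contains a forbidden overlap,
  so \<open>w\<close> has at most 4 letters.\<close>

lemma alternating_exit: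
  assumes cw: "c # w \<in> lang" and wa: "w @ [a] \<in> lang" and bad: "c # w @ [a] \<notin> lang"
    and alt: "\<And>i. Suc i < length w \<Longrightarrow> w ! i \<noteq> w ! Suc i"
  shows "w = [a] \<and> c = a \<or> w \<in> bisp 0"
proof (cases w)
  case Nil
  then show ?thesis using bad lang_length2 by simp
next
  case (Cons x0 w1)
  note w1 = this
  show ?thesis
  proof (cases w1)
    case Nil
    then show ?thesis
      using bad w1 by (cases c; cases x0; cases a)
        (auto intro!: lang_small simp: eval_nat_numeral sublist_Cons_right)
  next
    case (Cons x1 w2)
    have x1: "x1 = (\<not> x0)" using alt[of 0] w1 Cons by simp
    note w2 = Cons
    show ?thesis
    proof (cases w2)
      case Nil
      have "c # w @ [a] \<in> lang" unfolding w1 w2 Nil x1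
        by (rule lang_small) (cases c; cases x0; cases a; simp add: eval_nat_numeral sublist_Cons_right)
      then show ?thesis using bad by simp
    next
      case (Cons x2 w3)
      have x2: "x2 = x0" using alt[of 1] w1 w2 Cons x1 by simp
      note w3 = Cons
      show ?thesis
      proof (cases w3)
        case Nil
        then show ?thesis using w1 w2 w3 x1 x2 by (auto simp: bisp_0)
      next
        case (Cons x3 w4)
        have x3: "x3 = (\<not> x0)" using alt[of 2] w1 w2 w3 Cons x1 x2 by simp
        note w4 = Cons
        show ?thesis
        proof (cases w4)
          case Nil
          \<comment> \<open>Overlap-freeness leaves one choice for \<open>c\<close> and one for
            \<open>a\<close>, and the resulting word of length 6 is in the language.\<close>
          have w: "w = [x0, \<not> x0, x0, \<not> x0]" using w1 w2 w3 w4 Nil x1 x2 x3 by simp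
          have "c = x0" using overlap_notin_lang[of c] cw w by (cases "c = x0") auto
          moreover have "a = (\<not> x0)" using overlap_notin_lang[of x0] wa w by (cases "a = x0") auto
          ultimately have "c # w @ [a] \<in> lang" unfolding w
            by (intro lang_small) (cases x0; simp add: eval_nat_numeral sublist_Cons_right)
          then show ?thesis using bad by simp
        next
          case (Cons x4 w5)
          have "x4 = x0" using alt[of 3] w1 w2 w3 w4 Cons x1 x2 x3 by simp
          then have "w = [x0, \<not> x0, x0, \<not> x0, x0] @ w5"
            using w1 w2 w3 w4 Cons x1 x2 x3 by simp
          then have "[x0, \<not> x0, x0, \<not> x0, x0] \<in> lang"
            using wa lang_appendD1 by metis
          then show ?thesis using overlap_notin_lang by simp
        qed
      qed
    qed
  qed
qed

lemma exit_cases: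
  assumes "c # w \<in> lang" "w @ [a] \<in> lang" "c # w @ [a] \<notin> lang"
  shows "w = [a] \<and> c = a \<or> (\<exists>k. w \<in> bisp k)"
  using assms
proof (induction "length w" arbitrary: c w rule: less_induct)
  case less
  show ?case
  proof (cases "\<exists>i. Suc i < length w \<and> w ! i = w ! Suc i")
    case False
    then show ?thesis using alternating_exit[OF less.prems] by blast
  next
    case True
    then obtain i where i: "Suc i < length w" "w ! i = w ! Suc i" by blast
    obtain w0 e where w0: "w = theta w0" "e # w0 \<in> lang" "w0 @ [a] \<in> lang" "e # w0 @ [a] \<notin> lang"
      using exit_desubst[OF less.prems i] by blast
    have "length w0 < length w" using i(1) w0(1) by (cases w0) auto
    from less.hyps[OF this w0(2-4)] consider "w0 = [a]" | k where "w0 \<in> bisp k" by blast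
    then show ?thesis
    proof cases
      case 1
      \<comment> \<open>Levels never start from a single letter: its image has no equal neighbours,
        contrary to the choice of \<open>i\<close>.\<close>
      then have "i = 0" "w = [a, \<not> a]" using i w0(1) by auto
      then show ?thesis using i by simp
    next
      case 2
      then have "w \<in> bisp (Suc k)" using w0(1) by (simp add: bisp_Suc)
      then show ?thesis by blast
    qed
  qed
qed

lemma bisp_hd: assumes "w \<in> bisp k" obtains x r where "w = x # (\<not> x) # r"
proof (cases k)
  case 0
  then show ?thesis using assms that by (auto simp: bisp_0)
next
  case (Suc j)
  then obtain v where v: "w = theta v" "v \<in> bisp j" using assms by (auto simp: bisp_Suc)
  have "v \<noteq> []" using length_bisp[OF v(2)] by auto
  then show ?thesis using that v(1) by (cases v) auto
qed

text \<open>A word starting with x, not x has an image starting with x, not x, not x, x, which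
  contains an equal pair. Such a pair near the left end and one at the start of the suffix
  synchronize both ends, so that \<open>U\<close> is a full image with no partial letters.\<close>

lemma factor_desubst:
  assumes U: "U \<in> lang" and pre: "U = theta v @ a # t" and suf: "U = t' @ theta v'"
    and v: "v = x # (\<not> x) # r" and v': "v' = x' # (\<not> x') # r'"
  obtains V where "V \<in> lang" "U = theta V" "prefix (v @ [a]) V" "suffix v' V"
proof -
  obtain V p s where V: "V \<in> lang" "theta V = p @ U @ s" "length p \<le> 1" "length s \<le> 1"
    using desubst_trim[OF U] .
  have "odd (length p + 1)"
    using parse_sync[OF V(2), of 1] by (simp add: pre v)
  then have p: "p = []" using V(3) by (cases p) auto
  have "odd (length p + (length t' + 1))"
    using parse_sync[OF V(2), of "length t' + 1"] by (simp add: suf v' nth_append)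
  then have t': "even (length t')" by (simp add: p)
  have "2 * length V = length t' + 2 * length v' + length s"
    using arg_cong[OF V(2), of length] by (simp add: p suf)
  then have "even (length s)" using t' by presburger
  then have "s = []" using V(4) by (cases s) auto
  then have UV: "U = theta V" using V(2) p by simp
  have "take (2 * length v) (theta V) = theta v" unfolding UV[symmetric] pre by simp
  then have "take (length v) V = v" by (metis take_theta injD[OF inj_theta])
  moreover have lv: "length v < length V"
    using arg_cong[OF UV, of length] unfolding pre by simp
  moreover have "V ! length v = a"
    using nth_theta(1)[OF lv] by (simp add: UV[symmetric] pre nth_append)
  ultimately have "take (Suc (length v)) V = v @ [a]" by (simp add: take_Suc_conv_app_nth)
  then have P: "prefix (v @ [a]) V" by (metis take_is_prefix)
  obtain m where m: "length t' = 2 * m" using t' by blast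
  have "drop (2 * m) (theta V) = theta v'" unfolding UV[symmetric] suf using m by simp
  then have "drop m V = v'" by (metis drop_theta injD[OF inj_theta])
  then have S: "suffix v' V" by (metis suffix_drop)
  show ?thesis using that V(1) UV P S .
qed

lemma factor_desubst_pow:
  assumes "U \<in> lang" "prefix (w @ [a]) U" "suffix w' U" "w \<in> bisp (m + j)" "w' \<in> bisp (m + i)"
  obtains V v v' where "V \<in> lang" "U = (theta ^^ m) V" "w = (theta ^^ m) v"
    "prefix (v @ [a]) V" "suffix v' V" "v \<in> bisp j" "v' \<in> bisp i"
  using assms
proof (induction m arbitrary: U w w' thesis)
  case 0
  then show ?case by simp
next
  case (Suc m)
  obtain v where v: "w = theta v" "v \<in> bisp (m + j)" using Suc.prems by (auto simp: bisp_Suc)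
  obtain v' where v': "w' = theta v'" "v' \<in> bisp (m + i)" using Suc.prems by (auto simp: bisp_Suc)
  obtain t where t: "U = theta v @ a # t" using Suc.prems(3) v(1) by (auto simp: prefix_def)
  obtain t' where t': "U = t' @ theta v'" using Suc.prems(4) v'(1) by (auto simp: suffix_def)
  obtain V where V: "V \<in> lang" "U = theta V" "prefix (v @ [a]) V" "suffix v' V"
    using factor_desubst[OF Suc.prems(2) t t'] bisp_hd[OF v(2)] bisp_hd[OF v'(2)] by metis
  obtain V0 v0 v0' where V0: "V0 \<in> lang" "V = (theta ^^ m) V0" "v = (theta ^^ m) v0"
    "prefix (v0 @ [a]) V0" "suffix v0' V0" "v0 \<in> bisp j" "v0' \<in> bisp i"
    using Suc.IH[OF _ V(1,3,4) v(2) v'(2)] by blast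
  show ?case
    by (rule Suc.prems(1)[OF V0(1) _ _ V0(4-7)]) (simp_all add: V v V0)
qed

section \<open>Linear complexity of the language\<close>

lemma finite_words: "finite {u :: bool list. length u = n}"
  using finite_lists_length_eq[of "UNIV :: bool set" n] by simp

lemma card_words: "card {u :: bool list. length u = n} = 2 ^ n"
  using card_lists_length_eq[of "UNIV :: bool set" n] by simp

lemma lang_factor_pow:
  assumes "u \<in> lang" "length u \<le> 2 ^ k"
  obtains V d where "length V = 2" "d < 2 ^ k" "u = take (length u) (drop d ((theta ^^ k) V))"
proof -
  obtain V p s where V: "V \<in> lang" "(theta ^^ k) V = p @ u @ s"
    using desubst_pow[OF assms(1)] .
  define j d where "j = length p div 2 ^ k" and "d = length p mod 2 ^ k"
  have p: "length p = 2 ^ k * j + d" by (simp add: j_def d_def)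
  have d: "d < 2 ^ k" by (simp add: d_def)
  \<comment> \<open>The padding makes \<open>take 2 V'\<close> have two letters even when
    \<open>u\<close> sits at the end of the image. \<open>V'\<close> may leave the language, which
    is harmless for counting.\<close>
  define V' where "V' = drop j V @ [False, False]"
  have "(theta ^^ k) V' = drop (2 ^ k * j) p @ u @ s @ (theta ^^ k) [False, False]"
    using p by (simp add: V'_def drop_theta_pow[symmetric] V(2) del: theta_pow_append
        add: theta_pow_append[of k "drop j V" "[False, False]"])
  then have *: "drop d ((theta ^^ k) V') = u @ s @ (theta ^^ k) [False, False]"
    using p by simp
  have "take (length u) (drop d ((theta ^^ k) (take 2 V'))) = take (length u) (drop d ((theta ^^ k) V'))"
    using d assms(2) by (simp add: take_theta_pow[symmetric] drop_take min_def)
  then have "u = take (length u) (drop d ((theta ^^ k) (take 2 V')))" using * by simp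
  moreover have "length (take 2 V') = 2" by (simp add: V'_def)
  ultimately show ?thesis using that d by blast
qed

lemma exists_pow_between: assumes "n \<ge> 1" shows "\<exists>k. n \<le> 2 ^ k \<and> (2::nat) ^ k < 2 * n"
proof -
  define k where "k = (LEAST k. n \<le> 2 ^ k)"
  have ex: "n \<le> 2 ^ n" by (simp add: less_imp_le)
  then have 1: "n \<le> 2 ^ k" unfolding k_def by (rule LeastI)
  have "2 ^ k < 2 * n"
  proof (cases k)
    case (Suc m)
    then have "\<not> n \<le> 2 ^ m" using not_less_Least[of m "\<lambda>k. n \<le> 2 ^ k"] k_def by auto
    then show ?thesis using Suc by simp
  qed (use assms in simp)
  then show ?thesis using 1 by blast
qed

text \<open>With 2^k between n and 2 n, a word of length n is given by an offset below 2^k and one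
  of 4 pairs of letters, and 4 * 2^k is at most 8 n.\<close>

lemma card_lang_le:
  assumes "n \<ge> 1" shows "card {u \<in> lang. length u = n} \<le> 8 * n"
proof -
  obtain k where k: "n \<le> 2 ^ k" "2 ^ k < 2 * n" using exists_pow_between[OF assms] by blast
  let ?W = "{V :: bool list. length V = 2}"
  have "{u \<in> lang. length u = n} \<subseteq> (\<lambda>(d, V). take n (drop d ((theta ^^ k) V))) ` ({..<2 ^ k} \<times> ?W)"
  proof
    fix u assume "u \<in> {u \<in> lang. length u = n}"
    then have u: "u \<in> lang" "length u = n" by auto
    then obtain V d where "length V = 2" "d < 2 ^ k" "u = take n (drop d ((theta ^^ k) V))"
      using lang_factor_pow[of u k] k(1) by metis
    then show "u \<in> (\<lambda>(d, V). take n (drop d ((theta ^^ k) V))) ` ({..<2 ^ k} \<times> ?W)" by force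
  qed
  then have "card {u \<in> lang. length u = n} \<le> card ({..<2 ^ k :: nat} \<times> ?W)"
    using surj_card_le[OF finite_cartesian_product[OF finite_lessThan finite_words]] by blast
  also have "\<dots> = 2 ^ k * 4" by (simp add: card_cartesian_product card_words)
  also have "\<dots> \<le> 8 * n" using k(2) by linarith
  finally show ?thesis .
qed

section \<open>Weights of words and their decomposition into blocks\<close>

definition lang_prefix_len :: "bool list \<Rightarrow> nat" where
  "lang_prefix_len y = Max {m. m \<le> length y \<and> take m y \<in> lang}"

lemma take_lang_iff: "m \<le> length y \<Longrightarrow> take m y \<in> lang \<longleftrightarrow> m \<le> lang_prefix_len y"
  and lang_prefix_len_le: "lang_prefix_len y \<le> length y"
proof -
  let ?S = "{m. m \<le> length y \<and> take m y \<in> lang}"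
  have fin: "finite ?S" by (rule finite_subset[of _ "{..length y}"]) auto
  have "lang_prefix_len y \<in> ?S"
    unfolding lang_prefix_len_def using fin by (intro Max_in) (auto intro: exI[of _ 0])
  then show "lang_prefix_len y \<le> length y" by simp
  show "take m y \<in> lang \<longleftrightarrow> m \<le> lang_prefix_len y" if "m \<le> length y"
  proof
    assume "take m y \<in> lang"
    then show "m \<le> lang_prefix_len y" unfolding lang_prefix_len_def using fin that by (intro Max_ge) auto
  next
    assume "m \<le> lang_prefix_len y"
    then have "take m y = take m (take (lang_prefix_len y) y)" by (simp add: min_def)
    moreover have "take (lang_prefix_len y) y \<in> lang" using \<open>lang_prefix_len y \<in> ?S\<close> by simp
    ultimately show "take m y \<in> lang" using lang_take by metis
  qed
qed

lemma lang_prefix_len_eq_length: "lang_prefix_len y = length y \<longleftrightarrow> y \<in> lang"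
  using take_lang_iff[of "length y" y] lang_prefix_len_le[of y] by auto

lemma lang_prefix_len_append:
  assumes "u \<in> lang" "u @ [a] \<notin> lang"
  shows "lang_prefix_len (u @ a # z) = length u"
  using assms take_lang_iff[of "length u" "u @ a # z"] take_lang_iff[of "Suc (length u)" "u @ a # z"]
  by simp

lemma exit_split:
  assumes "y \<notin> lang"
  obtains U a z where "y = U @ a # z" "U \<in> lang" "U @ [a] \<notin> lang" "length U = lang_prefix_len y"
proof -
  have l: "lang_prefix_len y < length y"
    using assms lang_prefix_len_le[of y] lang_prefix_len_eq_length[of y] by linarith
  have "y = take (lang_prefix_len y) y @ y ! lang_prefix_len y # drop (Suc (lang_prefix_len y)) y"
    using l by (simp add: id_take_nth_drop)
  moreover have "take (lang_prefix_len y) y \<in> lang"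
    using take_lang_iff[of "lang_prefix_len y" y] l by simp
  moreover have "take (lang_prefix_len y) y @ [y ! lang_prefix_len y] \<notin> lang"
    using take_lang_iff[of "Suc (lang_prefix_len y)" y] l by (simp add: take_Suc_conv_app_nth)
  ultimately show ?thesis using that l by simp
qed

text \<open>
  \<open>weight y\<close> is an upper bound for \<open>exp (16 * S\<^sub>n V\<^sub>0)\<close> on the cylinder of \<open>y\<close>; positions whose
  \<open>V\<^sub>0\<close> is not determined by \<open>y\<close> contribute the factor 1.
\<close>

fun weight :: "bool list \<Rightarrow> real" where
  "weight [] = 1"
| "weight (a # y) = (if a # y \<in> lang then 1 else ((real (lang_prefix_len (a # y)) + 1) / (real (lang_prefix_len (a # y)) + 2)) ^ 16)
     * weight y"

lemma weight_pos: "weight y > 0"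
  by (induction y) auto

lemma weight_le_1: "weight y \<le> 1"
proof (induction y)
  case (Cons a y)
  have "((real (lang_prefix_len (a # y)) + 1) / (real (lang_prefix_len (a # y)) + 2)) ^ 16 \<le> 1"
    by (rule power_le_one) auto
  then show ?case using Cons weight_pos[of y]
    by (auto intro: mult_le_one less_imp_le)
qed simp

text \<open>The hypotheses keep the longest prefix in the language ending just before
  \<open>a\<close> while the letters of \<open>p\<close> are removed. Its length L thus drops by one
  each time, and the factors (L + 1) / (L + 2) cancel in succession.\<close>

lemma weight_telescope:
  assumes "p @ w \<in> lang" "\<And>c q. suffix (c # q) p \<Longrightarrow> c # q @ w @ [a] \<notin> lang"
  shows "weight (p @ w @ a # z) = ((real (length w) + 2) / (real (length p + length w) + 2)) ^ 16
    * weight (w @ a # z)"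
  using assms
proof (induction p)
  case (Cons c q)
  have "suffix (c' # q') (c # q)" if "suffix (c' # q') q" for c' q'
    using that by (simp add: suffix_Cons)
  then have IH: "weight (q @ w @ a # z) = ((real (length w) + 2) / (real (length q + length w) + 2)) ^ 16
    * weight (w @ a # z)"
    using Cons.IH Cons.prems lang_appendD2[of "[c]" "q @ w"] by simp
  have bad: "c # q @ w @ [a] \<notin> lang" using Cons.prems(2)[of c q] by simp
  then have "c # q @ w @ a # z \<notin> lang"
    using lang_appendD1[of "c # q @ w @ [a]" z] by auto
  moreover have "lang_prefix_len (c # q @ w @ a # z) = Suc (length q + length w)"
    using lang_prefix_len_append[of "c # q @ w" a z] Cons.prems(1) bad by simp
  ultimately have "weight (c # q @ w @ a # z) =
      ((real (length q + length w) + 2) / (real (length q + length w) + 3)) ^ 16 *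
      (((real (length w) + 2) / (real (length q + length w) + 2)) ^ 16 * weight (w @ a # z))"
    using IH by (simp add: add_ac)
  also have "\<dots> = ((real (length w) + 2) / (real (length q + length w) + 3)) ^ 16 * weight (w @ a # z)"
    by (simp add: power_divide)
  finally show ?case by (simp add: add_ac)
qed simp

section \<open>Greedy decomposition into maximal factors\<close>

definition exit :: "bool \<Rightarrow> bool list \<Rightarrow> bool \<Rightarrow> bool" where
  "exit c w a \<longleftrightarrow> c # w \<in> lang \<and> w @ [a] \<in> lang \<and> c # w @ [a] \<notin> lang"

text \<open>The longest suffix of \<open>U\<close> that \<open>a\<close> prolongs inside the
  language. In \<open>exit c w a\<close>, the letter \<open>c\<close> before \<open>w\<close>
  witnesses this maximality.\<close>

definition overlap :: "bool list \<Rightarrow> bool \<Rightarrow> bool list" where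
  "overlap U a = drop (LEAST k. drop k U @ [a] \<in> lang) U"

lemma overlap:
  assumes "U \<in> lang" "U @ [a] \<notin> lang"
  obtains p c where "U = p @ c # overlap U a" "exit c (overlap U a) a"
    "\<And>c' q. suffix (c' # q) (p @ [c]) \<Longrightarrow> c' # q @ overlap U a @ [a] \<notin> lang"
proof -
  define k where "k = (LEAST k. drop k U @ [a] \<in> lang)"
  have "drop (length U) U @ [a] \<in> lang" using lang_length1 by simp
  then have k: "drop k U @ [a] \<in> lang" "k \<le> length U"
    unfolding k_def by (rule LeastI, rule Least_le)
  have least: "drop j U @ [a] \<notin> lang" if "j < k" for j
    using that not_less_Least unfolding k_def by blast
  have w: "overlap U a = drop k U" by (simp add: overlap_def k_def)
  have "k \<noteq> 0" using k assms(2) by (cases "k = 0") auto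
  then obtain m where m: "k = Suc m" by (cases k) auto
  have mU: "m < length U" using m k(2) by simp
  have Um: "drop m U = U ! m # drop k U" using mU m by (simp add: Cons_nth_drop_Suc)
  have 1: "U = take m U @ U ! m # overlap U a"
    using Um w by (metis append_take_drop_id)
  have 2: "exit (U ! m) (overlap U a) a"
    unfolding exit_def w using k(1) least[of m] m Um lang_drop[OF assms(1), of m] by simp
  have "c' # q @ overlap U a @ [a] \<notin> lang" if "suffix (c' # q) (take m U @ [U ! m])" for c' q
  proof -
    obtain p where p: "take m U @ [U ! m] = p @ c' # q" using \<open>suffix _ _\<close> by (auto simp: suffix_def)
    have lang_prefix_len: "length p < k" using arg_cong[OF p, of length] mU m by (simp add: min_def)
    have "U = p @ c' # q @ overlap U a" using 1 p by (metis append.assoc append_Cons append_Nil)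
    then have "drop (length p) U = c' # q @ overlap U a" by (metis append_eq_conv_conj)
    then show ?thesis using least[OF lang_prefix_len] by simp
  qed
  then show ?thesis using that 1 2 by blast
qed

lemma weight_block:
  assumes "U \<in> lang" "U @ [a] \<notin> lang"
  shows "weight (U @ a # z) = ((real (length (overlap U a)) + 2) / (real (length U) + 2)) ^ 16
    * weight (overlap U a @ a # z)"
proof -
  obtain p c where *: "U = p @ c # overlap U a"
    "\<And>c' q. suffix (c' # q) (p @ [c]) \<Longrightarrow> c' # q @ overlap U a @ [a] \<notin> lang"
    using overlap[OF assms] by metis
  have U: "U = (p @ [c]) @ overlap U a" using *(1) by simp
  show ?thesis
    using weight_telescope[of "p @ [c]" "overlap U a" a z] *(2) U assms(1)
    by (metis append.assoc length_append)
qed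

definition bad_letter :: "bool list \<Rightarrow> bool" where
  "bad_letter U = (SOME a. U @ [a] \<notin> lang)"

text \<open>Every word of the language has at least one right extension in it, so at most one letter
  leads out. Hence a block determines its exit letter, and sums over blocks need not range over
  letters as well.\<close>

lemma bad_letter:
  assumes "U \<in> lang" "U @ [a] \<notin> lang" shows "bad_letter U = a"
proof -
  obtain b c where "b # U @ [c] \<in> lang" using lang_extend assms(1) by blast
  then have c: "U @ [c] \<in> lang" using lang_appendD2[of "[b]" "U @ [c]"] by simp
  have "U @ [bad_letter U] \<notin> lang"
    unfolding bad_letter_def using assms(2) by (rule someI)
  then show ?thesis using c assms(2) by (cases "bad_letter U"; cases c; cases a) auto
qed

text \<open>The candidates for the first maximal factor of a word of length \<open>n\<close> that
  starts with \<open>p\<close> and is outside the language.\<close>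

definition blocks :: "nat \<Rightarrow> bool list \<Rightarrow> bool list set" where
  "blocks n p = {U \<in> lang. length U < n \<and> prefix p U \<and> U @ [bad_letter U] \<notin> lang}"

definition wsum :: "nat \<Rightarrow> bool list \<Rightarrow> real" where
  "wsum n p = (\<Sum>y\<in>{y. length y = n \<and> prefix p y}. weight y)"

lemma finite_bounded_words: "finite {U :: bool list. length U < n \<and> P U}"
proof (rule finite_subset)
  show "finite {U :: bool list. set U \<subseteq> UNIV \<and> length U \<le> n}"
    using finite_lists_length_le[of "UNIV :: bool set" n] by simp
qed auto

lemma finite_blocks: "finite (blocks n p)"
  unfolding blocks_def using finite_bounded_words[of n]
  by (rule finite_subset[rotated]) auto

lemma finite_fixed_words: "finite {y :: bool list. length y = n \<and> P y}"
  by (rule finite_subset[OF _ finite_words[of n]]) auto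

lemma sum_Un_le:
  fixes f :: "'a \<Rightarrow> real"
  assumes "finite A" "finite B" "\<And>x. f x \<ge> 0"
  shows "sum f (A \<union> B) \<le> sum f A + sum f B"
  using sum.union_inter[OF assms(1,2), of f] sum_nonneg[of "A \<inter> B" f] assms(3) by simp

lemma sum_UNION_le:
  fixes f :: "'a \<Rightarrow> real"
  assumes "finite I" "\<And>i. i \<in> I \<Longrightarrow> finite (A i)" "\<And>x. f x \<ge> 0"
  shows "sum f (\<Union>i\<in>I. A i) \<le> (\<Sum>i\<in>I. sum f (A i))"
  using assms(1,2)
proof (induction I)
  case (insert i I)
  have "sum f (\<Union>i\<in>insert i I. A i) \<le> sum f (A i) + sum f (\<Union>i\<in>I. A i)"
    using insert assms(3) by (simp add: sum_Un_le)
  then show ?case using insert by fastforce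
qed simp

text \<open>The words inside the language number at most 8 n and have weight at most 1. The others
  are sorted by their first block; telescoping it away leaves a shorter word that starts with the
  overlap and the exit letter.\<close>

lemma wsum_step:
  assumes "p \<in> lang" "n \<ge> 1"
  shows "wsum n p \<le> 8 * n + (\<Sum>U\<in>blocks n p.
    ((real (length (overlap U (bad_letter U))) + 2) / (real (length U) + 2)) ^ 16 *
    wsum (n - length U + length (overlap U (bad_letter U))) (overlap U (bad_letter U) @ [bad_letter U]))"
proof -
  define Y where "Y = {y. length y = n \<and> prefix p y}"
  define B where "B U = (\<lambda>z. U @ bad_letter U # z) ` {z. length z = n - length U - 1}" for U
  have finB: "finite (B U)" for U unfolding B_def using finite_words by blast
  have finL: "finite {u \<in> lang. length u = n}"
    by (rule finite_subset[OF _ finite_words[of n]]) auto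
  have sub: "Y \<subseteq> {u \<in> lang. length u = n} \<union> (\<Union>U\<in>blocks n p. B U)"
  proof
    fix y assume "y \<in> Y"
    then have y: "length y = n" "prefix p y" by (auto simp: Y_def)
    show "y \<in> {u \<in> lang. length u = n} \<union> (\<Union>U\<in>blocks n p. B U)"
    proof (cases "y \<in> lang")
      case False
      then obtain U a z where U: "y = U @ a # z" "U \<in> lang" "U @ [a] \<notin> lang" "length U = lang_prefix_len y"
        using exit_split by blast
      have a: "bad_letter U = a" using bad_letter U by blast
      have "take (length p) y = p" using y(2) by (auto simp: prefix_def)
        then have "length p \<le> length U"
        using take_lang_iff[of "length p" y] assms(1) y(2) U(4) prefix_length_le[of p y] by simp
      moreover have "prefix U y" using U(1) by simp
      ultimately have "prefix p U" using y(2) prefix_length_prefix by metis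
      then have "U \<in> blocks n p" using U a y(1) by (auto simp: blocks_def)
      moreover have "y \<in> B U" using U(1) a y(1) by (auto simp: B_def)
      ultimately show ?thesis by blast
    qed (use y in auto)
  qed
  have B_sum: "(\<Sum>y\<in>B U. weight y) =
     ((real (length (overlap U (bad_letter U))) + 2) / (real (length U) + 2)) ^ 16 *
     wsum (n - length U + length (overlap U (bad_letter U))) (overlap U (bad_letter U) @ [bad_letter U])"
    if "U \<in> blocks n p" for U
  proof -
    let ?a = "bad_letter U" let ?w = "overlap U ?a"
    have U: "U \<in> lang" "U @ [?a] \<notin> lang" "length U < n" using that by (auto simp: blocks_def)
    have "(\<Sum>y\<in>B U. weight y) = (\<Sum>z\<in>{z. length z = n - length U - 1}. weight (U @ ?a # z))"
      unfolding B_def by (subst sum.reindex) (auto simp: inj_on_def)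
    also have "\<dots> = ((real (length ?w) + 2) / (real (length U) + 2)) ^ 16 *
        (\<Sum>z\<in>{z. length z = n - length U - 1}. weight (?w @ ?a # z))"
      by (simp add: weight_block[OF U(1,2)] sum_distrib_left)
    also have "(\<Sum>z\<in>{z. length z = n - length U - 1}. weight (?w @ ?a # z)) =
        (\<Sum>y\<in>(\<lambda>z. ?w @ ?a # z) ` {z. length z = n - length U - 1}. weight y)"
      by (subst sum.reindex) (auto simp: inj_on_def)
    also have "(\<lambda>z. ?w @ ?a # z) ` {z. length z = n - length U - 1} =
        {y. length y = n - length U + length ?w \<and> prefix (?w @ [?a]) y}"
      using U(3) by (auto simp: prefix_def image_iff)
    finally show ?thesis unfolding wsum_def .
  qed
  have "wsum n p = (\<Sum>y\<in>Y. weight y)" by (simp add: wsum_def Y_def)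
  also have "\<dots> \<le> (\<Sum>y\<in>{u \<in> lang. length u = n} \<union> (\<Union>U\<in>blocks n p. B U). weight y)"
    using sub finL finB finite_blocks weight_pos by (intro sum_mono2) (auto intro: less_imp_le)
  also have "\<dots> \<le> (\<Sum>y\<in>{u \<in> lang. length u = n}. weight y) + (\<Sum>y\<in>(\<Union>U\<in>blocks n p. B U). weight y)"
    using finB finite_blocks weight_pos finL by (intro sum_Un_le) (auto intro: less_imp_le)
  also have "(\<Sum>y\<in>{u \<in> lang. length u = n}. weight y) \<le> 8 * n"
  proof -
    have "(\<Sum>y\<in>{u \<in> lang. length u = n}. weight y) \<le> of_nat (card {u \<in> lang. length u = n}) * 1"
      by (rule sum_bounded_above) (rule weight_le_1)
    also have "\<dots> \<le> 8 * n" using card_lang_le[OF assms(2)] by simp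
    finally show ?thesis by simp
  qed
  also have "(\<Sum>y\<in>(\<Union>U\<in>blocks n p. B U). weight y) \<le> (\<Sum>U\<in>blocks n p. \<Sum>y\<in>B U. weight y)"
    using finB finite_blocks weight_pos by (intro sum_UNION_le) (auto intro: less_imp_le)
  also have "\<dots> = (\<Sum>U\<in>blocks n p. ((real (length (overlap U (bad_letter U))) + 2) / (real (length U) + 2)) ^ 16 *
     wsum (n - length U + length (overlap U (bad_letter U))) (overlap U (bad_letter U) @ [bad_letter U]))"
    by (intro sum.cong B_sum) auto
  finally show ?thesis by simp
qed

section \<open>Polynomial growth of the total weight\<close>

lemma card_prefix_words: "card {U :: bool list. length U = L \<and> prefix p U} \<le> 2 ^ (L - length p)"
proof -
  have "{U. length U = L \<and> prefix p U} \<subseteq> (\<lambda>z. p @ z) ` {z. length z = L - length p}"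
    by (auto simp: prefix_def)
  from surj_card_le[OF finite_words this] show ?thesis by (simp add: card_words)
qed

lemma card_suffix_words: "card {U :: bool list. length U = L \<and> suffix p U} \<le> 2 ^ (L - length p)"
proof -
  have "{U. length U = L \<and> suffix p U} \<subseteq> (\<lambda>z. z @ p) ` {z. length z = L - length p}"
    by (auto simp: suffix_def)
  from surj_card_le[OF finite_words this] show ?thesis by (simp add: card_words)
qed

text \<open>Discrete form of integrating t^-15. Bernoulli bounds 1 + 14 / t by (1 + 1 / t)^14, and
  multiplying by (1 - 1 / t)^14 gives (1 - 1 / t^2)^14, which is at most 1.\<close>

lemma inverse_pow15_le:
  fixes t :: real
  assumes "t > 1"
  shows "1 / t ^ 15 \<le> (1 / (t - 1) ^ 14 - 1 / t ^ 14) / 14"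
proof -
  have "1 + 14 * (1 / t) \<le> (1 + 1 / t) ^ 14"
    using Bernoulli_inequality[of "1 / t" 14] order_trans[of "-1" 0 "1 / t"] assms by simp
  then have "(1 + 14 / t) * (1 - 1 / t) ^ 14 \<le> (1 + 1 / t) ^ 14 * (1 - 1 / t) ^ 14"
    using assms by (intro mult_right_mono) auto
  also have "\<dots> = (1 - (1 / t)\<^sup>2) ^ 14"
    by (simp add: power_mult_distrib[symmetric] power2_eq_square algebra_simps)
  also have "\<dots> \<le> 1"
    using assms by (intro power_le_one) (auto simp: power_le_one)
  finally have *: "(1 + 14 / t) * (1 - 1 / t) ^ 14 \<le> 1" .
  have "(t + 14) * (t - 1) ^ 14 = t ^ 15 * ((1 + 14 / t) * (1 - 1 / t) ^ 14)"
  proof -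
    have "t ^ 15 * ((1 + 14 / t) * (1 - 1 / t) ^ 14) = (t * (1 + 14 / t)) * (t ^ 14 * (1 - 1 / t) ^ 14)"
      by (simp add: power_Suc[symmetric] numeral_eq_Suc)
    also have "t ^ 14 * (1 - 1 / t) ^ 14 = (t - 1) ^ 14"
      using assms by (simp add: power_mult_distrib[symmetric] right_diff_distrib)
    also have "t * (1 + 14 / t) = t + 14" using assms by (simp add: distrib_left)
    finally show ?thesis by simp
  qed
  also have "\<dots> \<le> t ^ 15 * 1" using * assms by (intro mult_left_mono) auto
  finally have "(t + 14) * (t - 1) ^ 14 \<le> t ^ 15" by simp
  then have "(t + 14) / t ^ 15 \<le> 1 / (t - 1) ^ 14"
    using assms by (simp add: divide_simps)
  moreover have "(t + 14) / t ^ 15 = 1 / t ^ 14 + 14 / t ^ 15"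
    using assms by (simp add: add_divide_distrib power_Suc numeral_eq_Suc)
  ultimately show ?thesis by simp
qed

lemma sum_inverse_pow15_le:
  assumes "T \<ge> 1"
  shows "(\<Sum>t\<in>{T<..N}. 1 / real t ^ 15) \<le> 1 / (14 * real T ^ 14)"
proof -
  have "(\<Sum>t\<in>{T<..T + m}. 1 / real t ^ 15) \<le> (1 / real T ^ 14 - 1 / real (T + m) ^ 14) / 14" for m
  proof (induction m)
    case (Suc m)
    have "{T<..T + Suc m} = insert (T + Suc m) {T<..T + m}" by auto
    then have "(\<Sum>t\<in>{T<..T + Suc m}. 1 / real t ^ 15) =
        1 / real (T + Suc m) ^ 15 + (\<Sum>t\<in>{T<..T + m}. 1 / real t ^ 15)" by simp
    then show ?case
      using Suc inverse_pow15_le[of "real (T + Suc m)"] assms by (simp add: algebra_simps)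
  qed simp
  from this[of "N - T"] have "(\<Sum>t\<in>{T<..T + (N - T)}. 1 / real t ^ 15) \<le> 1 / (14 * real T ^ 14)"
    by (rule order_trans) (simp add: divide_simps)
  moreover have "{T<..N} \<subseteq> {T<..T + (N - T)}" by auto
  then have "(\<Sum>t\<in>{T<..N}. 1 / real t ^ 15) \<le> (\<Sum>t\<in>{T<..T + (N - T)}. 1 / real t ^ 15)"
    by (intro sum_mono2) auto
  ultimately show ?thesis by simp
qed

text \<open>The conjugated weight of a block: for l and m the overlap lengths plus 2, (m / (|U| +
  2))^16 * l^8 / m^8 is this expression with \<open>K\<close> = l m.\<close>

definition hterm :: "real \<Rightarrow> bool list \<Rightarrow> real" where
  "hterm K U = (K / (real (length U) + 2)\<^sup>2) ^ 8"

lemma hterm_nonneg: "hterm K U \<ge> 0"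
  unfolding hterm_def by (simp add: zero_le_even_power)

text \<open>At most 8 (L + 2) words of length L, each of weight K^8 / (L + 2)^16, reduce the sum to
  8 K^8 times the tail of t^-15 beyond \<open>T\<close>.\<close>

lemma sum_hterm_tail:
  assumes "finite A" "A \<subseteq> lang" "\<And>U. U \<in> A \<Longrightarrow> T < length U + 2 \<and> U \<noteq> []" "T \<ge> 1"
  shows "(\<Sum>U\<in>A. hterm K U) \<le> 4 * K ^ 8 / (7 * real T ^ 14)"
proof -
  define N where "N = Max (length ` A) + 2"
  have "(\<Sum>U\<in>A. hterm K U) = (\<Sum>L\<in>length ` A. \<Sum>U\<in>{U \<in> A. length U = L}. hterm K U)"
    by (rule sum.image_gen[OF assms(1)])
  also have "\<dots> \<le> (\<Sum>L\<in>length ` A. 8 * K ^ 8 * (1 / real (L + 2) ^ 15))"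
  proof (rule sum_mono)
    fix L assume "L \<in> length ` A"
    then have L: "L \<ge> 1" using assms(3) by (auto simp: Suc_le_eq)
    have "card {U \<in> A. length U = L} \<le> card {U \<in> lang. length U = L}"
      using assms(2) finite_subset[OF _ finite_words[of L]] by (intro card_mono) auto
    also have "\<dots> \<le> 8 * (L + 2)" using card_lang_le[OF L] by simp
    finally have c: "card {U \<in> A. length U = L} \<le> 8 * (L + 2)" .
    have "(\<Sum>U\<in>{U \<in> A. length U = L}. hterm K U) =
        (\<Sum>U\<in>{U \<in> A. length U = L}. (K / (real L + 2)\<^sup>2) ^ 8)"
      by (rule sum.cong) (auto simp: hterm_def)
    also have "\<dots> = real (card {U \<in> A. length U = L}) * (K / (real L + 2)\<^sup>2) ^ 8" by simp
    also have "\<dots> \<le> real (8 * (L + 2)) * (K / (real L + 2)\<^sup>2) ^ 8"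
      using c by (intro mult_right_mono) (auto simp only: of_nat_le_iff zero_le_even_power even_numeral)
    also have "\<dots> = 8 * K ^ 8 * (1 / real (L + 2) ^ 15)"
    proof -
      define s where "s = real L + 2"
      have "s * (1 / s ^ 16) = 1 / s ^ 15" "(K / s\<^sup>2) ^ 8 = K ^ 8 / s ^ 16"
        by (simp_all add: s_def numeral_eq_Suc power_divide flip: power_mult)
      moreover have "real (8 * (L + 2)) = 8 * s" "real (L + 2) = s" by (simp_all add: s_def)
      moreover have "8 * s * (K ^ 8 / s ^ 16) = 8 * K ^ 8 * (s * (1 / s ^ 16))" by simp
      ultimately show ?thesis by (simp only: s_def[symmetric])
    qed
    finally show "(\<Sum>U\<in>{U \<in> A. length U = L}. hterm K U) \<le> 8 * K ^ 8 * (1 / real (L + 2) ^ 15)" .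
  qed
  also have "\<dots> = 8 * K ^ 8 * (\<Sum>L\<in>length ` A. 1 / real (L + 2) ^ 15)"
    by (simp add: sum_distrib_left)
  also have "(\<Sum>L\<in>length ` A. 1 / real (L + 2) ^ 15) = (\<Sum>t\<in>(\<lambda>L. L + 2) ` length ` A. 1 / real t ^ 15)"
    by (subst sum.reindex) (auto simp: inj_on_def)
  also have "\<dots> \<le> (\<Sum>t\<in>{T<..N}. 1 / real t ^ 15)"
    using assms(1,3) by (intro sum_mono2) (auto simp: N_def)
  also have "\<dots> \<le> 1 / (14 * real T ^ 14)" by (rule sum_inverse_pow15_le[OF assms(4)])
  finally show ?thesis by (simp add: mult_left_mono zero_le_even_power)
qed

lemma sum_hterm_length:
  assumes "finite A" "\<And>U. U \<in> A \<Longrightarrow> length U = L" "card A \<le> c"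
  shows "(\<Sum>U\<in>A. hterm K U) \<le> real c * (K / (real L + 2)\<^sup>2) ^ 8"
proof -
  have "(\<Sum>U\<in>A. hterm K U) = (\<Sum>U\<in>A. (K / (real L + 2)\<^sup>2) ^ 8)"
    by (rule sum.cong) (auto simp: hterm_def assms(2))
  also have "\<dots> = real (card A) * (K / (real L + 2)\<^sup>2) ^ 8" by simp
  also have "\<dots> \<le> real c * (K / (real L + 2)\<^sup>2) ^ 8"
    using assms(3) by (intro mult_right_mono) (auto simp: zero_le_even_power)
  finally show ?thesis .
qed

lemma pow6_growth:
  fixes b :: real
  assumes "b \<ge> 0" "b \<le> 3 * 2 ^ r + 2"
  shows "b ^ 6 * 2 ^ k \<le> (3 * 2 ^ (r + k) + 2) ^ 6"
proof (induction k)
  case 0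
  then show ?case using assms by (auto intro: power_mono)
next
  case (Suc k)
  define M :: real where "M = 3 * 2 ^ (r + k) + 2"
  have p1: "(2::real) ^ (r + k) \<ge> 1" by simp
  \<comment> \<open>The ratio 8 / 5 is attained at exponent 0, where 5 becomes 8. Its sixth power
    exceeds 2.\<close>
  have "M * (8 / 5) \<le> 3 * 2 ^ (r + Suc k) + 2" unfolding M_def using p1 by simp
  moreover have "M \<ge> 0" unfolding M_def using p1 by simp
  ultimately have "(M * (8 / 5)) ^ 6 \<le> (3 * 2 ^ (r + Suc k) + 2) ^ 6"
    by (intro power_mono) auto
  moreover have "M ^ 6 * 2 \<le> (M * (8 / 5)) ^ 6"
    using \<open>M \<ge> 0\<close> by (simp add: power_mult_distrib power_divide)
  moreover have "b ^ 6 * 2 ^ Suc k \<le> M ^ 6 * 2" using Suc by (simp add: M_def)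
  ultimately show ?case by linarith
qed

text \<open>One level is 0, the other is \<open>r\<close>, and the longer end leaves the fewer free
  letters. If it is the prefix, the word \<open>v @ [a]\<close> is fixed. If it is the suffix,
  either of the two words of \<open>bisp i\<close> may occur, hence the extra factor 2.\<close>

lemma level_card:
  assumes "v \<in> bisp j" "min i j = 0" "r = i + j" "finite A"
    "A \<subseteq> {U \<in> lang. prefix (v @ [a]) U \<and> (\<exists>v'\<in>bisp i. suffix v' U)}"
  shows "card {U \<in> A. length U = L} \<le> 2 ^ (L + 1 - 3 * 2 ^ r)"
    and "r = 0 \<Longrightarrow> card {U \<in> A. length U = L} \<le> 2 ^ (L - 4)"
proof -
  have lv: "length v = 3 * 2 ^ j" using length_bisp[OF assms(1)] .
  have pre: "card {U \<in> A. length U = L} \<le> 2 ^ (L - (3 * 2 ^ j + 1))"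
  proof -
    have "card {U \<in> A. length U = L} \<le> card {U. length U = L \<and> prefix (v @ [a]) U}"
      using assms(5) finite_fixed_words by (intro card_mono) auto
    also have "\<dots> \<le> 2 ^ (L - (3 * 2 ^ j + 1))"
      using card_prefix_words[of L "v @ [a]"] lv by simp
    finally show ?thesis .
  qed
  show "card {U \<in> A. length U = L} \<le> 2 ^ (L - 4)" if "r = 0"
    using pre assms(3) that by simp
  show "card {U \<in> A. length U = L} \<le> 2 ^ (L + 1 - 3 * 2 ^ r)"
  proof (cases "i = 0")
    case True
    then have "r = j" using assms(3) by simp
    moreover have "(2::nat) ^ (L - (3 * 2 ^ j + 1)) \<le> 2 ^ (L + 1 - 3 * 2 ^ j)"
      by (rule power_increasing) auto
    ultimately show ?thesis using pre by (auto intro: order_trans)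
  next
    case False
    then have r: "r = i" using assms(2,3) by (simp add: min_def split: if_splits)
    show ?thesis
    proof (cases "{U \<in> A. length U = L} = {}")
      case False
      then obtain U v' where "U \<in> A" "length U = L" "v' \<in> bisp i" "suffix v' U"
        using assms(5) by blast
      then have L: "3 * 2 ^ r \<le> L" using suffix_length_le length_bisp r by metis
      have "bisp i = {(theta ^^ i) [False, True, False], (theta ^^ i) [True, False, True]}"
        by (simp add: bisp_def)
      then have "{U \<in> A. length U = L} \<subseteq> {U. length U = L \<and> suffix ((theta ^^ i) [False, True, False]) U}
          \<union> {U. length U = L \<and> suffix ((theta ^^ i) [True, False, True]) U}" (is "_ \<subseteq> ?B \<union> ?C")
        using assms(5) by auto
      then have "card {U \<in> A. length U = L} \<le> card (?B \<union> ?C)"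
        using finite_fixed_words by (intro card_mono finite_UnI) auto
      also have "\<dots> \<le> card ?B + card ?C" by (rule card_Un_le)
      also have "card ?B \<le> 2 ^ (L - 3 * 2 ^ r)" "card ?C \<le> 2 ^ (L - 3 * 2 ^ r)"
      proof -
        have "length ((theta ^^ i) [False, True, False]) = 3 * 2 ^ i"
          "length ((theta ^^ i) [True, False, True]) = 3 * 2 ^ i"
          by (rule length_bisp, simp add: bisp_def)+
        then show "card ?B \<le> 2 ^ (L - 3 * 2 ^ r)" "card ?C \<le> 2 ^ (L - 3 * 2 ^ r)"
          using card_suffix_words r by metis+
      qed
      then have "card ?B + card ?C \<le> 2 * 2 ^ (L - 3 * 2 ^ r)" by simp
      also have "\<dots> = 2 ^ (L + 1 - 3 * 2 ^ r)" using L by (simp add: Suc_diff_le)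
      finally show ?thesis by simp
    next
      case True
      then show ?thesis by (simp only: card.empty)
    qed
  qed
qed

text \<open>The base case after removing the common power of \<open>theta\<close>. The factor 5 = 3
  + 2 belongs to the overlap of level 0, and 3 * 2^r + 2 to the other one.\<close>

lemma level_sum:
  assumes "v \<in> bisp j" "min i j = 0" "r = i + j" "finite A"
    "A \<subseteq> {U \<in> lang. prefix (v @ [a]) U \<and> (\<exists>v'\<in>bisp i. suffix v' U)}"
    "\<And>U. U \<in> A \<Longrightarrow> 3 * 2 ^ r < length U"
  shows "(\<Sum>U\<in>A. hterm (5 * (3 * 2 ^ r + 2)) U) \<le> 0.2 / 2 ^ r"
proof -
  note card = level_card[OF assms(1-5)]
  let ?K = "5 * (3 * 2 ^ r + 2) :: real"
  have split: "(\<Sum>U\<in>A. hterm ?K U) \<le> (\<Sum>U\<in>{U \<in> A. length U = L}. hterm ?K U) +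
    (\<Sum>U\<in>{U \<in> A. length U = Suc L}. hterm ?K U) + (\<Sum>U\<in>{U \<in> A. Suc L < length U}. hterm ?K U)"
    if "L = Suc (3 * 2 ^ r)" for L
  proof -
    have "A = {U \<in> A. length U = L} \<union> {U \<in> A. length U = Suc L} \<union> {U \<in> A. Suc L < length U}"
      using assms(6) that by force
    then have "(\<Sum>U\<in>A. hterm ?K U) = (\<Sum>U\<in>{U \<in> A. length U = L} \<union> {U \<in> A. length U = Suc L} \<union> {U \<in> A. Suc L < length U}. hterm ?K U)"
      by simp
    also have "\<dots> \<le> (\<Sum>U\<in>{U \<in> A. length U = L} \<union> {U \<in> A. length U = Suc L}. hterm ?K U) + (\<Sum>U\<in>{U \<in> A. Suc L < length U}. hterm ?K U)"
      using assms(4) by (intro sum_Un_le) (auto simp: hterm_nonneg)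
    also have "(\<Sum>U\<in>{U \<in> A. length U = L} \<union> {U \<in> A. length U = Suc L}. hterm ?K U) \<le>
       (\<Sum>U\<in>{U \<in> A. length U = L}. hterm ?K U) + (\<Sum>U\<in>{U \<in> A. length U = Suc L}. hterm ?K U)"
      using assms(4) by (intro sum_Un_le) (auto simp: hterm_nonneg)
    finally show ?thesis by simp
  qed
  have AL: "A \<subseteq> lang" using assms(5) by auto
  \<comment> \<open>The tail estimate alone would give 100 / 7 for \<open>r\<close> = 0 and about
    0.85 for \<open>r\<close> = 1, so there the two shortest lengths are split off. From
    \<open>r\<close> = 2 on it suffices.\<close>
  consider "r = 0" | "r = 1" | "r \<ge> 2" by linarith
  then show ?thesis
  proof cases
    case 1
    have "(\<Sum>U\<in>{U \<in> A. length U = 4}. hterm ?K U) \<le> real 1 * (?K / (real 4 + 2)\<^sup>2) ^ 8"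
      using card(2)[OF 1, of 4] assms(4) by (intro sum_hterm_length) auto
    moreover have "(\<Sum>U\<in>{U \<in> A. length U = 5}. hterm ?K U) \<le> real 2 * (?K / (real 5 + 2)\<^sup>2) ^ 8"
      using card(2)[OF 1, of 5] assms(4) by (intro sum_hterm_length) auto
    moreover have "(\<Sum>U\<in>{U \<in> A. 5 < length U}. hterm ?K U) \<le> 4 * ?K ^ 8 / (7 * real 7 ^ 14)"
      using assms(4) AL by (intro sum_hterm_tail) auto
    ultimately show ?thesis using split[of 4] 1 by (simp add: power_divide)
  next
    case 2
    have "(\<Sum>U\<in>{U \<in> A. length U = 7}. hterm ?K U) \<le> real 4 * (?K / (real 7 + 2)\<^sup>2) ^ 8"
      using card(1)[of 7] 2 assms(4) by (intro sum_hterm_length) auto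
    moreover have "(\<Sum>U\<in>{U \<in> A. length U = 8}. hterm ?K U) \<le> real 8 * (?K / (real 8 + 2)\<^sup>2) ^ 8"
      using card(1)[of 8] 2 assms(4) by (intro sum_hterm_length) auto
    moreover have "(\<Sum>U\<in>{U \<in> A. 8 < length U}. hterm ?K U) \<le> 4 * ?K ^ 8 / (7 * real 10 ^ 14)"
      using assms(4) AL by (intro sum_hterm_tail) auto
    ultimately show ?thesis using split[of 7] 2 by (simp add: power_divide)
  next
    case 3
    define M :: real where "M = 3 * 2 ^ r + 2"
    have Mpos: "M > 0" unfolding M_def by (simp add: add_pos_pos)
    have "(\<Sum>U\<in>A. hterm ?K U) \<le> 4 * ?K ^ 8 / (7 * real (3 * 2 ^ r + 2) ^ 14)"
    proof (rule sum_hterm_tail)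
      show "3 * 2 ^ r + 2 < length U + 2 \<and> U \<noteq> []" if "U \<in> A" for U
        using assms(6)[OF that] by auto
    qed (use assms(4) AL in auto)
    also have "\<dots> = 4 * (5 * M) ^ 8 / (7 * M ^ 14)" by (simp add: M_def add.commute)
    also have "\<dots> = 1562500 / (7 * M ^ 6)"
      using Mpos by (simp add: power_mult_distrib field_simps flip: power_add)
    also have "\<dots> \<le> 0.2 / 2 ^ r"
    proof -
      \<comment> \<open>7529536 = 14^6, where 14 = 3 * 2^2 + 2 is the value of \<open>M\<close> at
        \<open>r\<close> = 2. The 1562500 above is 4 * 5^8.\<close>
      have "7529536 * 2 ^ (r - 2) \<le> M ^ 6"
        using pow6_growth[of 14 2 "r - 2"] unfolding M_def le_add_diff_inverse[OF 3] by simp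
      moreover have "(2::real) ^ r = 4 * 2 ^ (r - 2)"
        using 3 by (metis le_add_diff_inverse power_add power2_eq_square numeral_Bit0 numeral_One mult_2 mult.commute)
      ultimately have "2 ^ r * 1562500 * 5 \<le> M ^ 6 * 7"
        using zero_le_power[of "2::real" "r - 2", OF zero_le_numeral] by linarith
      then show ?thesis using Mpos by (simp add: divide_simps mult_ac)
    qed
    finally show ?thesis .
  qed
qed

section \<open>Transitions from one overlap to the next\<close>

lemma bisp_add: "w \<in> bisp (m + j) \<Longrightarrow> \<exists>v\<in>bisp j. w = (theta ^^ m) v"
  by (auto simp: bisp_def funpow_add)

text \<open>Adding 2 to lengths destroys scale invariance, but the error has the right sign: undoing
  \<open>theta ^^ m\<close>, with q = 2^m, can only increase the ratio.\<close>

lemma rescale_ratio: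
  fixes c q L :: real
  assumes "q \<ge> 1" "c \<ge> 0" "L \<ge> c"
  shows "(q * c + 2) / (q * L + 2) \<le> (c + 2) / (L + 2)"
proof -
  have "0 \<le> (q - 1) * (L - c)" using assms by simp
  moreover have "q * L + 2 > 0" "L + 2 > 0" using assms by (auto intro: add_nonneg_pos)
  ultimately show ?thesis by (simp add: divide_simps algebra_simps)
qed

lemma blocks_overlap:
  assumes "U \<in> blocks n p"
  defines "w \<equiv> overlap U (bad_letter U)"
  shows "suffix w U" "length w < length U" "w = [bad_letter U] \<or> (\<exists>i. w \<in> bisp i)"
proof -
  have U: "U \<in> lang" "U @ [bad_letter U] \<notin> lang" using assms(1) by (auto simp: blocks_def)
  obtain p c where *: "U = p @ c # w" "exit c w (bad_letter U)"
    using overlap[OF U] unfolding w_def by metis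
  show "suffix w U" using *(1) by (metis append.assoc append_Cons append_Nil suffixI)
  show "length w < length U" using arg_cong[OF *(1), of length] by simp
  show "w = [bad_letter U] \<or> (\<exists>i. w \<in> bisp i)"
    using exit_cases *(2) unfolding exit_def by blast
qed

text \<open>Entry of the transfer operator for a block \<open>U\<close> entered through an overlap
  of length \<open>l\<close>, conjugated by the 8th powers.\<close>

definition transition :: "real \<Rightarrow> bool list \<Rightarrow> real" where
  "transition l U = hterm ((l + 2) * (real (length (overlap U (bad_letter U))) + 2)) U"

lemma blocks_level_sum:
  assumes w: "w \<in> bisp j"
  shows "(\<Sum>U\<in>{U \<in> blocks n (w @ [a]). overlap U (bad_letter U) \<in> bisp i}. transition (length w) U)
    \<le> 0.2 / 2 ^ ((i - j) + (j - i))"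
proof -
  define B where "B = {U \<in> blocks n (w @ [a]). overlap U (bad_letter U) \<in> bisp i}"
  define m where "m = min i j"
  define r where "r = (i - m) + (j - m)"
  obtain v where v: "v \<in> bisp (j - m)" "w = (theta ^^ m) v"
    using bisp_add[of w m "j - m"] w by (auto simp: m_def)
  \<comment> \<open>Of the preimages only what the counting uses is kept: their two ends and,
    through membership of the image in \<open>B\<close>, their length.\<close>
  define A where "A = {V \<in> lang. prefix (v @ [a]) V \<and> (\<exists>v'\<in>bisp (i - m). suffix v' V) \<and> (theta ^^ m) V \<in> B}"
  have finB: "finite B" unfolding B_def using finite_blocks by simp
  have finA: "finite A"
    by (rule finite_subset[of _ "(theta ^^ m) -` B"])
      (auto simp: A_def intro!: finite_vimageI finB inj_theta_pow)
  have BA: "B \<subseteq> (theta ^^ m) ` A"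
  proof
    fix U assume U: "U \<in> B"
    then have "U \<in> blocks n (w @ [a])" "overlap U (bad_letter U) \<in> bisp (m + (i - m))"
      by (auto simp: B_def m_def)
    moreover have "U \<in> lang" "prefix (w @ [a]) U" using calculation(1) by (auto simp: blocks_def)
    ultimately obtain V u u' where V: "V \<in> lang" "U = (theta ^^ m) V" "w = (theta ^^ m) u"
      "prefix (u @ [a]) V" "suffix u' V" "u \<in> bisp (j - m)" "u' \<in> bisp (i - m)"
      using factor_desubst_pow[of U w a "overlap U (bad_letter U)" m "j - m" "i - m"] w
        blocks_overlap(1) by (auto simp: m_def)
    have "u = v" using V(3) v(2) inj_theta_pow[of m] by (simp add: inj_eq)
    then show "U \<in> (theta ^^ m) ` A" using V U by (auto simp: A_def)
  qed
  have len: "3 * 2 ^ r < length V" if "V \<in> A" for V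
  proof -
    have *: "(theta ^^ m) V \<in> B" using that by (simp add: A_def)
    have "length (overlap ((theta ^^ m) V) (bad_letter ((theta ^^ m) V))) = 3 * 2 ^ i"
      using * by (auto simp: B_def length_bisp)
    moreover have "length (overlap ((theta ^^ m) V) (bad_letter ((theta ^^ m) V))) < length ((theta ^^ m) V)"
      using * blocks_overlap(2)[of "(theta ^^ m) V"] unfolding B_def by blast
    ultimately have 1: "3 * 2 ^ i < 2 ^ m * length V" by simp
    have "prefix (w @ [a]) ((theta ^^ m) V)" using * by (auto simp: B_def blocks_def)
    from prefix_length_le[OF this] have 2: "3 * 2 ^ j < 2 ^ m * length V"
      using length_bisp[OF w] by simp
    have "(2::nat) ^ m * (3 * 2 ^ r) = 3 * 2 ^ max i j"
      by (auto simp: r_def m_def min_def max_def simp flip: power_add)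
    moreover have "3 * 2 ^ max i j < 2 ^ m * length V" using 1 2 by (auto simp: max_def)
    ultimately have "2 ^ m * (3 * 2 ^ r) < 2 ^ m * length V" by (simp only:)
    then show ?thesis by simp
  qed
  let ?K = "((3 * 2 ^ j + 2) * (3 * 2 ^ i + 2)) :: real"
  have "(\<Sum>U\<in>B. transition (length w) U) = (\<Sum>U\<in>B. hterm ?K U)"
    by (rule sum.cong) (auto simp: transition_def length_bisp[OF w] B_def length_bisp)
  also have "\<dots> \<le> (\<Sum>U\<in>(theta ^^ m) ` A. hterm ?K U)"
    using BA finA by (intro sum_mono2) (auto simp: hterm_nonneg)
  also have "\<dots> = (\<Sum>V\<in>A. hterm ?K ((theta ^^ m) V))"
    using inj_on_subset[OF inj_theta_pow] by (subst sum.reindex) auto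
  also have "\<dots> \<le> (\<Sum>V\<in>A. hterm (5 * (3 * 2 ^ r + 2)) V)"
  proof (rule sum_mono)
    fix V assume V: "V \<in> A"
    define L q where "L = real (length V)" and "q = (2::real) ^ m"
    have "real (3 * 2 ^ r) < real (length V)" using len[OF V] by (simp only: of_nat_less_iff)
    then have L: "3 * 2 ^ r \<le> L" by (simp add: L_def)
    have "(3::real) * 1 \<le> 3 * 2 ^ r" by simp
    then have L3: "3 \<le> L" using L by linarith
    have q: "q \<ge> 1" by (simp add: q_def)
    \<comment> \<open>The lower level gives the first factor and the higher level the second; the
      product forgets which of them is the entry.\<close>
    have K: "?K = (q * 3 + 2) * (q * (3 * 2 ^ r) + 2)"
    proof (cases "i \<le> j")
      case True
      then have "(2::real) ^ i * 2 ^ (j - i) = 2 ^ j" by (simp flip: power_add)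
      then have "q * (3 * 2 ^ r) = 3 * 2 ^ j" "q = 2 ^ i"
        using True by (simp_all add: q_def r_def m_def)
      then show ?thesis by (simp add: mult.commute)
    next
      case False
      then have "(2::real) ^ j * 2 ^ (i - j) = 2 ^ i" by (simp flip: power_add)
      then have "q * (3 * 2 ^ r) = 3 * 2 ^ i" "q = 2 ^ j"
        using False by (simp_all add: q_def r_def m_def)
      then show ?thesis by (simp add: mult.commute)
    qed
    have "?K / (q * L + 2)\<^sup>2 = ((q * 3 + 2) / (q * L + 2)) * ((q * (3 * 2 ^ r) + 2) / (q * L + 2))"
      unfolding K by (simp add: power2_eq_square)
    also have "\<dots> \<le> ((3 + 2) / (L + 2)) * ((3 * 2 ^ r + 2) / (L + 2))"
      using q L L3 by (intro mult_mono rescale_ratio) (auto intro!: divide_nonneg_nonneg add_nonneg_nonneg)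
    also have "\<dots> = (5 * (3 * 2 ^ r + 2)) / (L + 2)\<^sup>2"
      by (simp add: power2_eq_square)
    finally have "(?K / (q * L + 2)\<^sup>2) ^ 8 \<le> ((5 * (3 * 2 ^ r + 2)) / (L + 2)\<^sup>2) ^ 8"
      by (intro power_mono) auto
    then show "hterm ?K ((theta ^^ m) V) \<le> hterm (5 * (3 * 2 ^ r + 2)) V"
      by (simp add: hterm_def L_def q_def)
  qed
  also have "\<dots> \<le> 0.2 / 2 ^ r"
    by (rule level_sum[OF v(1), of "i - m" r A a]) (use finA len in \<open>auto simp: r_def m_def A_def min_def\<close>)
  also have "r = (i - j) + (j - i)" by (auto simp: r_def m_def)
  finally show ?thesis by (simp add: B_def)
qed

lemma sum_half_power_le: "(\<Sum>i<n. 1 / 2 ^ i :: real) \<le> 2"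
proof -
  have "(\<Sum>i<n. 1 / 2 ^ i :: real) = 2 - 2 / 2 ^ n"
    by (induction n) (auto simp: field_simps)
  then show ?thesis by simp
qed

text \<open>With truncated subtraction the exponent is the distance of i and j. The part below
  \<open>j\<close> sums to at most 1, the part from \<open>j\<close> on to at most 2.\<close>

lemma sum_half_power_dist_le: "(\<Sum>i<n. 1 / 2 ^ ((i - j) + (j - i)) :: real) \<le> 3"
proof -
  let ?f = "\<lambda>i. 1 / 2 ^ ((i - j) + (j - i)) :: real"
  have 1: "(\<Sum>i<j. ?f i) \<le> 1"
  proof -
    have "(\<Sum>i<j. ?f i) = (\<Sum>i<j. 1 / 2 * (1 / 2 ^ (j - Suc i)))"
    proof (rule sum.cong)
      fix i assume "i \<in> {..<j}"
      then have "(i - j) + (j - i) = Suc (j - Suc i)" by auto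
      then show "?f i = 1 / 2 * (1 / 2 ^ (j - Suc i))" by simp
    qed simp
    also have "\<dots> = 1 / 2 * (\<Sum>i<j. 1 / 2 ^ (j - Suc i))" by (rule sum_distrib_left[symmetric])
    also have "(\<Sum>i<j. 1 / 2 ^ (j - Suc i) :: real) = (\<Sum>i<j. 1 / 2 ^ i)"
      by (rule sum.nat_diff_reindex)
    finally show ?thesis using sum_half_power_le[of j] by simp
  qed
  have "(\<Sum>i\<in>{j..<j + n}. ?f i) = (\<Sum>i<n. 1 / 2 ^ i)"
    by (rule sum.reindex_bij_witness[of _ "\<lambda>i. i + j" "\<lambda>i. i - j"]) auto
  then have 2: "(\<Sum>i\<in>{j..<j + n}. ?f i) \<le> 2" using sum_half_power_le by simp
  have "(\<Sum>i<n. ?f i) \<le> (\<Sum>i\<in>{..<j} \<union> {j..<j + n}. ?f i)"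
    by (rule sum_mono2) auto
  also have "\<dots> = (\<Sum>i<j. ?f i) + (\<Sum>i\<in>{j..<j + n}. ?f i)"
    by (rule sum.union_disjoint) auto
  finally show ?thesis using 1 2 by simp
qed

lemma transition_nonneg: "transition l U \<ge> 0"
  by (simp add: transition_def hterm_nonneg)

lemma blocks_D:
  assumes "U \<in> blocks n p"
  shows "U \<in> lang" "length U < n" "prefix p U" "length p \<le> length U"
  using assms prefix_length_le by (auto simp: blocks_def)

text \<open>Only levels below \<open>n\<close> occur, because an overlap of level i has more than i
  letters and is shorter than its block.\<close>

lemma blocks_split_sum:
  assumes "(\<Sum>U\<in>{U \<in> blocks n p. length (overlap U (bad_letter U)) = 1}. transition l U) \<le> s"
    and "\<And>i. (\<Sum>U\<in>{U \<in> blocks n p. overlap U (bad_letter U) \<in> bisp i}. transition l U) \<le> t i"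
  shows "(\<Sum>U\<in>blocks n p. transition l U) \<le> s + (\<Sum>i<n. t i)"
proof -
  let ?S = "{U \<in> blocks n p. length (overlap U (bad_letter U)) = 1}"
  let ?B = "\<lambda>i. {U \<in> blocks n p. overlap U (bad_letter U) \<in> bisp i}"
  have "blocks n p \<subseteq> ?S \<union> (\<Union>i<n. ?B i)"
  proof
    fix U assume U: "U \<in> blocks n p"
    note * = blocks_overlap[OF U]
    show "U \<in> ?S \<union> (\<Union>i<n. ?B i)"
    proof (cases "overlap U (bad_letter U) = [bad_letter U]")
      case False
      then obtain i where i: "overlap U (bad_letter U) \<in> bisp i" using *(3) by blast
      have "i < 2 ^ i" by simp
      also have "\<dots> \<le> length (overlap U (bad_letter U))" using length_bisp[OF i] by simp
      also have "\<dots> < n" using *(2) blocks_D(2)[OF U] by simp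
      finally show ?thesis using i U by auto
    qed (use U in auto)
  qed
  then have "(\<Sum>U\<in>blocks n p. transition l U) \<le> (\<Sum>U\<in>?S \<union> (\<Union>i<n. ?B i). transition l U)"
    using finite_blocks by (intro sum_mono2) (auto simp: transition_nonneg)
  also have "\<dots> \<le> (\<Sum>U\<in>?S. transition l U) + (\<Sum>U\<in>(\<Union>i<n. ?B i). transition l U)"
    using finite_blocks by (intro sum_Un_le) (auto simp: transition_nonneg)
  also have "(\<Sum>U\<in>(\<Union>i<n. ?B i). transition l U) \<le> (\<Sum>i<n. \<Sum>U\<in>?B i. transition l U)"
    using finite_blocks by (intro sum_UNION_le) (auto simp: transition_nonneg)
  also have "\<dots> \<le> (\<Sum>i<n. t i)" by (intro sum_mono assms(2))
  finally show ?thesis using assms(1) by simp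
qed

lemma transition_sum_le_1:
  assumes "exit c w a"
  shows "(\<Sum>U\<in>blocks n (w @ [a]). transition (length w) U) \<le> 1"
proof -
  let ?p = "w @ [a]"
  let ?S = "{U \<in> blocks n ?p. length (overlap U (bad_letter U)) = 1}"
  have finS: "finite ?S" using finite_blocks by simp
  have SL: "?S \<subseteq> lang" using blocks_D(1) by auto
  consider "w = [a]" | j where "w \<in> bisp j"
    using exit_cases[of c w a] assms unfolding exit_def by blast
  then show ?thesis
  proof cases
    case 1
    have S: "(\<Sum>U\<in>?S. transition (length w) U) \<le> 0.11"
    proof -
      \<comment> \<open>9 = (1 + 2)^2, as both overlaps are letters. The tail estimate from length 2
        on would exceed 1, so the only possible block of that length is treated apart.\<close>
      have "(\<Sum>U\<in>?S. transition (length w) U) = (\<Sum>U\<in>?S. hterm 9 U)"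
        by (rule sum.cong) (auto simp: transition_def 1)
      also have "\<dots> \<le> (\<Sum>U\<in>{U \<in> ?S. length U = 2} \<union> {U \<in> ?S. 2 < length U}. hterm 9 U)"
      proof (rule sum_mono2)
        have "length U = 2 \<or> 2 < length U" if "U \<in> ?S" for U
          using blocks_D(4)[of U n ?p] that 1 by auto
        then show "?S \<subseteq> {U \<in> ?S. length U = 2} \<union> {U \<in> ?S. 2 < length U}" by blast
      qed (use finite_blocks[of n ?p] in \<open>auto simp: hterm_nonneg\<close>)
      also have "\<dots> \<le> (\<Sum>U\<in>{U \<in> ?S. length U = 2}. hterm 9 U) + (\<Sum>U\<in>{U \<in> ?S. 2 < length U}. hterm 9 U)"
        using finite_blocks[of n ?p] by (intro sum_Un_le) (auto simp: hterm_nonneg)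
      also have "(\<Sum>U\<in>{U \<in> ?S. length U = 2}. hterm 9 U) \<le> real 1 * (9 / (real 2 + 2)\<^sup>2) ^ 8"
      proof (rule sum_hterm_length)
        have "card {U \<in> ?S. length U = 2} \<le> card {U. length U = 2 \<and> prefix ?p U}"
          using blocks_D(3) finite_fixed_words by (intro card_mono) auto
        also have "\<dots> \<le> 1" using card_prefix_words[of 2 ?p] 1 by simp
        finally show "card {U \<in> ?S. length U = 2} \<le> 1" .
      qed (use finite_blocks[of n ?p] in auto)
      also have "(\<Sum>U\<in>{U \<in> ?S. 2 < length U}. hterm 9 U) \<le> 4 * 9 ^ 8 / (7 * real 4 ^ 14)"
        using finite_blocks[of n ?p] SL by (intro sum_hterm_tail) auto
      finally show ?thesis by (simp add: power_divide)
    qed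
    have B: "(\<Sum>U\<in>{U \<in> blocks n ?p. overlap U (bad_letter U) \<in> bisp i}. transition (length w) U) \<le>
      0.24 * (1 / 2 ^ i)" (is "sum _ ?B \<le> _") for i
    proof -
      define M :: real where "M = 3 * 2 ^ i + 2"
      have Mpos: "M > 0" unfolding M_def by (simp add: add_pos_pos)
      have "(\<Sum>U\<in>?B. transition (length w) U) = (\<Sum>U\<in>?B. hterm (3 * M) U)"
        by (rule sum.cong) (auto simp: transition_def 1 length_bisp M_def)
      also have "\<dots> \<le> 4 * (3 * M) ^ 8 / (7 * real (3 * 2 ^ i + 2) ^ 14)"
      proof (rule sum_hterm_tail)
        fix U assume "U \<in> ?B"
        then show "3 * 2 ^ i + 2 < length U + 2 \<and> U \<noteq> []"
          using blocks_overlap(2)[of U n ?p] length_bisp by fastforce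
      qed (use finite_blocks blocks_D(1) in auto)
      also have "\<dots> = 4 * (3 * M) ^ 8 / (7 * M ^ 14)" by (simp add: M_def add.commute)
      also have "\<dots> = 26244 / (7 * M ^ 6)"
        using Mpos by (simp add: power_mult_distrib field_simps flip: power_add)
      also have "\<dots> \<le> 0.24 * (1 / 2 ^ i)"
      proof -
        \<comment> \<open>15625 = 5^6, the value at \<open>i\<close> = 0, and 109350 = 26244 / 0.24
          is just below 7 * 15625. The numerator 26244 is 4 * 3^8.\<close>
        have "15625 * 2 ^ i \<le> M ^ 6" using pow6_growth[of 5 0 i] by (simp add: M_def)
        then have "109350 * 2 ^ i \<le> 7 * M ^ 6"
          using zero_le_power[of "2::real" i, OF zero_le_numeral] by linarith
        then show ?thesis using Mpos by (simp add: divide_simps)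
      qed
      finally show ?thesis .
    qed
    have "(\<Sum>U\<in>blocks n ?p. transition (length w) U) \<le> 0.11 + (\<Sum>i<n. 0.24 * (1 / 2 ^ i))"
      by (rule blocks_split_sum[OF S B])
    also have "\<dots> = 0.11 + 0.24 * (\<Sum>i<n. 1 / 2 ^ i)" by (simp add: sum_distrib_left)
    finally show ?thesis using sum_half_power_le[of n] by simp
  next
    case (2 j)
    define M :: real where "M = real (length w + 2)"
    have "(3::real) * 1 \<le> 3 * 2 ^ j" by simp
    then have M5: "M \<ge> 5" using length_bisp[OF 2] by (simp add: M_def)
    have S: "(\<Sum>U\<in>?S. transition (length w) U) \<le> 0.24"
    proof -
      have "(\<Sum>U\<in>?S. transition (length w) U) = (\<Sum>U\<in>?S. hterm (3 * M) U)"
        by (rule sum.cong) (auto simp: transition_def M_def algebra_simps)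
      also have "\<dots> \<le> 4 * (3 * M) ^ 8 / (7 * real (length w + 2) ^ 14)"
      proof (rule sum_hterm_tail)
        fix U assume "U \<in> ?S"
        then show "length w + 2 < length U + 2 \<and> U \<noteq> []"
          using blocks_D(4)[of U n ?p] by auto
      qed (use finS SL in auto)
      also have "\<dots> = 26244 / (7 * M ^ 6)"
        using M5 unfolding M_def[symmetric] by (simp add: power_mult_distrib field_simps flip: power_add)
      also have "\<dots> \<le> 0.24"
      proof -
        have "5 ^ 6 \<le> M ^ 6" using M5 by (intro power_mono) auto
        then show ?thesis using M5 by (simp add: divide_simps)
      qed
      finally show ?thesis .
    qed
    have "(\<Sum>U\<in>blocks n ?p. transition (length w) U) \<le> 0.24 + (\<Sum>i<n. 0.2 / 2 ^ ((i - j) + (j - i)))"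
      by (rule blocks_split_sum[OF S blocks_level_sum[OF 2]])
    also have "\<dots> = 0.24 + 0.2 * (\<Sum>i<n. 1 / 2 ^ ((i - j) + (j - i)))" by (simp add: sum_distrib_left)
    finally show ?thesis using sum_half_power_dist_le[of j n] by simp
  qed
qed

text \<open>Row sums at most 1 mean that each step of the recursion adds only the 8 n words inside
  the language, and n strictly decreases; this accounts for the n^2. The denominator is the
  conjugating factor, and (n + 2)^8 keeps the quotient above 1 so that the added term fits under
  it.\<close>

lemma wsum_exit_le:
  assumes "exit c w a"
  shows "wsum n (w @ [a]) \<le> 8 * real n ^ 2 * (real n + 2) ^ 8 / (real (length w) + 2) ^ 8"
  using assms
proof (induction n arbitrary: c w a rule: less_induct)
  case (less n)
  let ?p = "w @ [a]"
  show ?case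
  proof (cases "n < length ?p")
    case True
    then have "{y. length y = n \<and> prefix ?p y} = {}" by (auto dest: prefix_length_le)
    then have "wsum n ?p = 0" unfolding wsum_def by (simp only: sum.empty)
    then show ?thesis by simp
  next
    case False
    then have n: "n \<ge> 1" "length w \<le> n" by auto
    \<comment> \<open>Since \<open>n'\<close> is at most n - 1, its square is at most (n - 1) n, and
      the missing n is exactly the room for the new words.\<close>
    define E where "E = 8 * (real n - 1) * real n * (real n + 2) ^ 8"
    have E0: "E \<ge> 0" using n by (simp add: E_def)
    define l where "l = real (length w) + 2"
    have l: "l > 0" "l \<le> real n + 2" using n by (auto simp: l_def)
    have p: "?p \<in> lang" using less.prems by (simp add: exit_def)
    have step: "((real (length (overlap U (bad_letter U))) + 2) / (real (length U) + 2)) ^ 16 *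
      wsum (n - length U + length (overlap U (bad_letter U))) (overlap U (bad_letter U) @ [bad_letter U])
      \<le> E / l ^ 8 * transition (length w) U" if U: "U \<in> blocks n ?p" for U
    proof -
      define b v where "b = bad_letter U" and "v = overlap U b"
      have UL: "U \<in> lang" "U @ [b] \<notin> lang" "length U < n" using U by (auto simp: blocks_def b_def)
      obtain q d where ex: "U = q @ d # v" "exit d v b" using overlap[OF UL(1,2)] unfolding v_def by metis
      have lv: "length v < length U" using ex(1) by simp
      define n' where "n' = n - length U + length v"
      have n': "n' < n" using lv UL(3) by (simp add: n'_def)
      define m where "m = real (length v) + 2"
      have m: "m > 0" by (simp add: m_def)
      have "wsum n' (v @ [b]) \<le> 8 * real n' ^ 2 * (real n' + 2) ^ 8 / m ^ 8"
        unfolding m_def by (rule less.IH[OF n' ex(2)])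
      also have "\<dots> \<le> E / m ^ 8"
      proof -
        have "real n' \<le> real n - 1" using n' by linarith
        then have "real n' ^ 2 \<le> (real n - 1) * real n"
          unfolding power2_eq_square using n by (intro mult_mono) auto
        moreover have "(real n' + 2) ^ 8 \<le> (real n + 2) ^ 8" using n' by (intro power_mono) auto
        ultimately have "real n' ^ 2 * (real n' + 2) ^ 8 \<le> (real n - 1) * real n * (real n + 2) ^ 8"
          using n by (intro mult_mono) auto
        then have "8 * real n' ^ 2 * (real n' + 2) ^ 8 \<le> E"
          unfolding E_def by (simp only: mult.assoc mult_le_cancel_left_pos zero_less_numeral)
        then show ?thesis using m by (intro divide_right_mono) auto
      qed
      finally have "(m / (real (length U) + 2)) ^ 16 * wsum n' (v @ [b]) \<le>
          (m / (real (length U) + 2)) ^ 16 * (E / m ^ 8)"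
        using m by (intro mult_left_mono) auto
      \<comment> \<open>Half of the 16th power of m is cancelled by the induction hypothesis; the
        other half pairs with l^8.\<close>
      also have "\<dots> = E / l ^ 8 * (l * m / (real (length U) + 2)\<^sup>2) ^ 8"
        using l m by (simp add: power_divide power_mult_distrib field_simps flip: power_mult power_add)
      finally show ?thesis
        unfolding transition_def hterm_def b_def[symmetric] v_def[symmetric] n'_def[symmetric] m_def[symmetric] l_def[symmetric] .
    qed
    have "wsum n ?p \<le> 8 * real n + (\<Sum>U\<in>blocks n ?p. E / l ^ 8 * transition (length w) U)"
      by (rule order_trans[OF wsum_step[OF p n(1)]], rule add_left_mono, rule sum_mono, rule step)
    also have "\<dots> = 8 * real n + E / l ^ 8 * (\<Sum>U\<in>blocks n ?p. transition (length w) U)"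
      by (simp add: sum_distrib_left)
    also have "\<dots> \<le> 8 * real n + E / l ^ 8 * 1"
      using transition_sum_le_1[OF less.prems] E0 l by (intro add_left_mono mult_left_mono) auto
    also have "8 * real n \<le> 8 * real n * (real n + 2) ^ 8 / l ^ 8"
    proof -
      have "l ^ 8 \<le> (real n + 2) ^ 8" using l by (intro power_mono) auto
      then show ?thesis using l by (simp add: pos_le_divide_eq mult_left_mono)
    qed
    also have "8 * real n * (real n + 2) ^ 8 / l ^ 8 + E / l ^ 8 * 1 =
        8 * real n ^ 2 * (real n + 2) ^ 8 / l ^ 8"
      by (simp add: E_def add_divide_distrib[symmetric] power2_eq_square algebra_simps)
    finally show ?thesis by (simp add: l_def)
  qed
qed

text \<open>The first block has no incoming overlap, so it is bounded crudely: at most 8 n^2 blocks,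
  each followed by at most 8 n^2 (n + 2)^8. This explains the degree 12 and the constant 72 = 8 +
  64.\<close>

lemma weight_sum_polynomial:
  assumes "n \<ge> 1"
  shows "(\<Sum>y\<in>{y. length y = n}. weight y) \<le> 72 * (real n + 2) ^ 12"
proof -
  define C where "C = 8 * real n ^ 2 * (real n + 2) ^ 8"
  have step: "((real (length (overlap U (bad_letter U))) + 2) / (real (length U) + 2)) ^ 16 *
      wsum (n - length U + length (overlap U (bad_letter U))) (overlap U (bad_letter U) @ [bad_letter U])
      \<le> C" if U: "U \<in> blocks n []" for U
  proof -
    define b v where "b = bad_letter U" and "v = overlap U b"
    have UL: "U \<in> lang" "U @ [b] \<notin> lang" "length U < n" using U by (auto simp: blocks_def b_def)
    obtain q d where ex: "U = q @ d # v" "exit d v b" using overlap[OF UL(1,2)] unfolding v_def by metis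
    have lv: "length v < length U" using ex(1) by simp
    define n' where "n' = n - length U + length v"
    have n': "n' < n" using lv UL(3) by (simp add: n'_def)
    have w0: "wsum n' (v @ [b]) \<ge> 0"
      unfolding wsum_def using weight_pos by (intro sum_nonneg) (auto intro: less_imp_le)
    have "((real (length v) + 2) / (real (length U) + 2)) ^ 16 * wsum n' (v @ [b]) \<le> 1 * wsum n' (v @ [b])"
      using lv w0 by (intro mult_right_mono power_le_one) auto
    also have "\<dots> \<le> 8 * real n' ^ 2 * (real n' + 2) ^ 8 / (real (length v) + 2) ^ 8"
      using wsum_exit_le[OF ex(2)] by simp
    also have "\<dots> \<le> 8 * real n' ^ 2 * (real n' + 2) ^ 8 / 1"
      by (intro divide_left_mono) auto
    also have "\<dots> \<le> C"
      unfolding C_def using n' by (simp, intro mult_mono power_mono) auto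
    finally show ?thesis unfolding b_def v_def n'_def .
  qed
  have card: "card (blocks n []) \<le> n * (8 * n)"
  proof -
    have "blocks n [] \<subseteq> (\<Union>L<n. {U \<in> lang. length U = L})" by (auto simp: blocks_def)
    moreover have "finite {U \<in> lang. length U = L}" for L
      by (rule finite_subset[OF _ finite_words[of L]]) auto
    ultimately have "card (blocks n []) \<le> card (\<Union>L<n. {U \<in> lang. length U = L})"
      by (intro card_mono finite_UN_I) auto
    also have "\<dots> \<le> (\<Sum>L<n. card {U \<in> lang. length U = L})" by (rule card_UN_le) simp
    also have "\<dots> \<le> (\<Sum>L<n. 8 * n)"
    proof (rule sum_mono)
      fix L assume L: "L \<in> {..<n}"
      show "card {U \<in> lang. length U = L} \<le> 8 * n"
      proof (cases "L = 0")
        case True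
        then have "{U \<in> lang. length U = L} = {[]}" by auto
        then show ?thesis using assms by simp
      next
        case False
        then show ?thesis using card_lang_le[of L] L by simp
      qed
    qed
    finally show ?thesis by simp
  qed
  have "(\<Sum>y\<in>{y. length y = n}. weight y) = wsum n []" by (simp add: wsum_def)
  also have "\<dots> \<le> 8 * real n + (\<Sum>U\<in>blocks n []. C)"
    by (rule order_trans[OF wsum_step[OF Nil_lang assms]], rule add_left_mono, rule sum_mono, rule step)
  also have "\<dots> = 8 * real n + real (card (blocks n [])) * C" by simp
  also have "\<dots> \<le> 8 * real n + real (n * (8 * n)) * C"
    using card by (intro add_left_mono mult_right_mono) (auto simp only: of_nat_le_iff C_def, auto)
  also have "\<dots> = 8 * real n * 1 + 64 * (real n ^ 4 * (real n + 2) ^ 8)"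
    by (simp add: C_def algebra_simps numeral_eq_Suc)
  also have "8 * real n * 1 \<le> 8 * (real n + 2) * (real n + 2) ^ 11"
    by (intro mult_mono one_le_power) auto
  also have "8 * (real n + 2) * (real n + 2) ^ 11 = 8 * (real n + 2) ^ 12"
    by (simp add: numeral_eq_Suc)
  also have "real n ^ 4 * (real n + 2) ^ 8 \<le> (real n + 2) ^ 4 * (real n + 2) ^ 8"
    by (intro mult_right_mono power_mono) auto
  also have "(real n + 2) ^ 4 * (real n + 2) ^ 8 = (real n + 2) ^ 12"
    by (simp flip: power_add)
  finally show ?thesis by simp
qed

section \<open>The potential as a function of the words of a point\<close>

definition pre :: "seq \<Rightarrow> nat \<Rightarrow> bool list" where
  "pre x n = map x [0..<n]"

lemma length_pre [simp]: "length (pre x n) = n"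
  by (simp add: pre_def)

lemma nth_pre: "i < n \<Longrightarrow> pre x n ! i = x i"
  by (simp add: pre_def)

lemma take_pre: "take m (pre x n) = pre x (min m n)"
  by (simp add: pre_def take_map min_def)

lemma pre_eq_iff: "pre x n = pre y n \<longleftrightarrow> (\<forall>i<n. x i = y i)"
  by (auto simp: pre_def)

lemma pre_Suc: "pre x (Suc n) = x 0 # pre (shift x) n"
  by (rule nth_equalityI) (auto simp: nth_pre nth_Cons shift_def split: nat.splits)

lemma pre_snoc: "pre x (Suc n) = pre x n @ [x n]"
  by (simp add: pre_def)

lemma shift_pow: "(shift ^^ k) x n = x (k + n)"
  by (induction k arbitrary: n) (auto simp: shift_def)

lemma drop_pre: "drop k (pre x n) = pre ((shift ^^ k) x) (n - k)"
  by (rule nth_equalityI) (auto simp: nth_pre shift_pow)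

lemma lang_pre_mono: "pre x n \<in> lang \<Longrightarrow> m \<le> n \<Longrightarrow> pre x m \<in> lang"
  using lang_take[of "pre x n" m] by (simp add: take_pre min_def)

lemma TM_iff: "x \<in> TM \<longleftrightarrow> (\<forall>n. pre x n \<in> lang)"
proof
  assume x: "x \<in> TM"
  have "pre x (Suc n) \<in> lang" for n
    using x unfolding TM_def lang_def pre_def by (auto dest: spec[of _ 0])
  then show "\<forall>n. pre x n \<in> lang" using lang_pre_mono by (meson le_SucI order_refl)
next
  assume L: "\<forall>n. pre x n \<in> lang"
  have "map x [i..<Suc (i + j)] \<in> lang" for i j
  proof -
    have "drop i (pre x (Suc (i + j))) = map x [i..<Suc (i + j)]"
      by (simp add: pre_def drop_map del: upt_Suc)
    then show ?thesis using lang_drop L by metis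
  qed
  then show "x \<in> TM" unfolding TM_def lang_def by blast
qed

lemma lang_extends_TM:
  assumes "w \<in> lang"
  obtains y where "y \<in> TM" "pre y (length w) = w"
proof -
  define f where "f k = ((\<lambda>u. u @ [SOME c. u @ [c] \<in> lang]) ^^ k) w" for k
  have f_Suc: "f (Suc k) = f k @ [SOME c. f k @ [c] \<in> lang]" for k by (simp add: f_def)
  have fL: "f k \<in> lang" for k
  proof (induction k)
    case (Suc k)
    obtain b c where "b # f k @ [c] \<in> lang" using lang_extend Suc by blast
    then have "f k @ [c] \<in> lang" using lang_appendD2[of "[b]"] by simp
    then show ?case unfolding f_Suc by (rule someI)
  qed (use assms in \<open>simp add: f_def\<close>)
  have len: "length (f k) = length w + k" for k by (induction k) (simp_all add: f_Suc, simp add: f_def)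
  define y where "y n = f (Suc n) ! n" for n
  have stable: "n < length (f k) \<Longrightarrow> k \<le> m \<Longrightarrow> f m ! n = f k ! n" for k m n
  proof (induction m)
    case (Suc m)
    then show ?case by (cases "k = Suc m") (auto simp: f_Suc nth_append len)
  qed simp
  have pre: "pre y (length w + k) = f k" for k
  proof (rule nth_equalityI)
    fix i assume "i < length (pre y (length w + k))"
    then have i: "i < length (f k)" by (simp add: len)
    have "f (max (Suc i) k) ! i = f k ! i" "f (max (Suc i) k) ! i = f (Suc i) ! i"
      using stable[OF i, of "max (Suc i) k"] stable[of i "Suc i" "max (Suc i) k"] by (simp_all add: len)
    then show "pre y (length w + k) ! i = f k ! i" using i by (simp add: nth_pre y_def len)
  qed (simp add: len)
  have "pre y n \<in> lang" for n
    using lang_pre_mono[of y "length w + n" n] pre[of n] fL[of n] by simp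
  then have "y \<in> TM" by (simp add: TM_iff)
  moreover have "pre y (length w) = w" using pre[of 0] by (simp add: f_def)
  ultimately show ?thesis using that by blast
qed

text \<open>For \<open>x\<close> outside \<open>TM\<close> this is the length of its longest prefix
  in the language.\<close>

definition lang_time :: "seq \<Rightarrow> nat" where
  "lang_time x = (LEAST n. pre x (Suc n) \<notin> lang)"

lemma lang_time:
  assumes "x \<notin> TM"
  shows "pre x n \<in> lang \<longleftrightarrow> n \<le> lang_time x"
proof -
  obtain m where m: "pre x m \<notin> lang" using assms TM_iff by blast
  then obtain k where "m = Suc k" by (cases m) (auto simp: pre_def)
  with m have "pre x (Suc (lang_time x)) \<notin> lang" unfolding lang_time_def by (metis (mono_tags) LeastI)
  moreover have "pre x (lang_time x) \<in> lang"
  proof (cases "lang_time x")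
    case 0
    then show ?thesis by (simp add: pre_def)
  next
    case (Suc j)
    then have "j < lang_time x" by simp
    then show ?thesis using not_less_Least[of j "\<lambda>n. pre x (Suc n) \<notin> lang"] Suc by (simp add: lang_time_def)
  qed
  ultimately show ?thesis using lang_pre_mono by (meson not_less_eq_eq)
qed

section \<open>Distance to the subshift and the potential\<close>

lemma seq_dist_le_iff: "seq_dist x y \<le> (1/2) ^ n \<longleftrightarrow> (\<forall>i<n. x i = y i)"
proof (cases n)
  case 0
  have "seq_dist x y \<le> 1" by (simp add: seq_dist_def power_le_one)
  then show ?thesis using 0 by simp
next
  case (Suc m)
  have "seq_dist x y \<le> (1/2) ^ Suc m \<longleftrightarrow> seq_dist x y < (1/2) ^ m"
  proof
    assume "seq_dist x y < (1/2) ^ m"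
    show "seq_dist x y \<le> (1/2) ^ Suc m"
    proof (cases "x = y")
      case False
      then have "m < (LEAST i. x i \<noteq> y i)"
        using \<open>seq_dist x y < (1/2) ^ m\<close> by (simp add: seq_dist_def power_strict_decreasing_iff)
      then have "(1/2 :: real) ^ (LEAST i. x i \<noteq> y i) \<le> (1/2) ^ Suc m"
        by (intro power_decreasing) auto
      then show ?thesis using False by (simp add: seq_dist_def)
    qed (simp add: seq_dist_def)
  qed (rule le_less_trans, assumption, simp)
  then show ?thesis by (simp add: Suc seq_dist_less_iff less_Suc_eq_le)
qed

text \<open>The infimum is attained at any point of \<open>TM\<close> prolonging the longest prefix
  of \<open>x\<close> in the language; no point of \<open>TM\<close> agrees with \<open>x\<close>
  for one letter more.\<close>

lemma dist_to_TM:
  assumes "x \<notin> TM"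
  shows "dist_to x TM = (1/2) ^ lang_time x"
  unfolding dist_to_def
proof (rule cInf_eq_minimum)
  obtain y where y: "y \<in> TM" "pre y (lang_time x) = pre x (lang_time x)"
    using lang_extends_TM[of "pre x (lang_time x)"] lang_time[OF assms, of "lang_time x"] by auto
  have lower: "(1/2) ^ lang_time x \<le> seq_dist x z" if "z \<in> TM" for z
  proof (rule ccontr)
    assume "\<not> (1/2) ^ lang_time x \<le> seq_dist x z"
    then have "pre x (Suc (lang_time x)) = pre z (Suc (lang_time x))"
      by (simp add: not_le seq_dist_less_iff pre_eq_iff less_Suc_eq_le)
    then show False using that lang_time[OF assms, of "Suc (lang_time x)"] TM_iff by auto
  qed
  have "seq_dist x y \<le> (1/2) ^ lang_time x"
    using y(2) by (simp add: seq_dist_le_iff pre_eq_iff)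
  then have "seq_dist x y = (1/2) ^ lang_time x" using lower[OF y(1)] by simp
  then show "(1/2) ^ lang_time x \<in> seq_dist x ` TM" using y(1) by (metis imageI)
  show "(1/2) ^ lang_time x \<le> d" if "d \<in> seq_dist x ` TM" for d using that lower by blast
qed

lemma phi0_TM:
  "phi0 TM x = (if x \<in> TM then 0 else ln (1 + 1 / (real (lang_time x) + 1)))"
proof -
  have "(THE n. (1/2 :: real) ^ lang_time x = (1/2) ^ n) = lang_time x"
    by (rule the_equality) (auto simp: power_one_over)
  then show ?thesis by (simp add: phi0_def dist_to_TM)
qed

lemma phi0_nonneg: "phi0 TM x \<ge> 0"
  by (simp add: phi0_TM)

lemma phi0_le: "x \<notin> TM \<Longrightarrow> phi0 TM x \<le> 1 / (real (lang_time x) + 1)"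
  by (simp add: phi0_TM ln_add_one_self_le_self)

lemma weight_pre_le: "- ln (weight (pre x n)) \<le> 16 * (\<Sum>k<n. phi0 TM ((shift ^^ k) x))"
proof (induction n arbitrary: x)
  case 0
  then show ?case by (simp add: pre_def)
next
  case (Suc n)
  have *: "- ln (if pre x (Suc n) \<in> lang then 1
      else ((real (lang_prefix_len (pre x (Suc n))) + 1) / (real (lang_prefix_len (pre x (Suc n))) + 2)) ^ 16) \<le> 16 * phi0 TM x"
  proof (cases "pre x (Suc n) \<in> lang")
    case True
    then show ?thesis using phi0_nonneg by simp
  next
    case False
    then have x: "x \<notin> TM" using TM_iff by blast
    define l where "l = lang_time x"
    have ln: "l \<le> n" using False lang_time[OF x, of "Suc n"] by (simp add: l_def)
    \<comment> \<open>The exit of \<open>x\<close> is already visible in this prefix, so word and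
      point have the same exit time and the bound is an equality.\<close>
    have "l \<le> lang_prefix_len (pre x (Suc n))" "\<not> Suc l \<le> lang_prefix_len (pre x (Suc n))"
      using take_lang_iff[of l "pre x (Suc n)"] take_lang_iff[of "Suc l" "pre x (Suc n)"] ln
        lang_time[OF x, of l] lang_time[OF x, of "Suc l"]
      by (simp_all add: take_pre l_def)
    then have l: "lang_prefix_len (pre x (Suc n)) = l" by simp
    have "1 + 1 / (real l + 1) = (real l + 2) / (real l + 1)" by (simp add: field_simps)
    then have "phi0 TM x = - ln ((real l + 1) / (real l + 2))"
      using x by (simp add: phi0_TM l_def[symmetric] ln_div)
    then show ?thesis using False l by (simp add: ln_realpow)
  qed
  have "- ln (weight (pre x (Suc n))) = - ln (if pre x (Suc n) \<in> lang then 1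
      else ((real (lang_prefix_len (pre x (Suc n))) + 1) / (real (lang_prefix_len (pre x (Suc n))) + 2)) ^ 16)
      - ln (weight (pre (shift x) n))"
    using weight_pos[of "pre (shift x) n"] by (auto simp: pre_Suc ln_mult)
  also have "\<dots> \<le> 16 * phi0 TM x + 16 * (\<Sum>k<n. phi0 TM ((shift ^^ k) (shift x)))"
    using * Suc[of "shift x"] by simp
  also have "\<dots> = 16 * (\<Sum>k<Suc n. phi0 TM ((shift ^^ k) x))"
    by (subst sum.lessThan_Suc_shift) (simp add: funpow_swap1 distrib_left)
  finally show ?case .
qed

definition cyl :: "bool list \<Rightarrow> seq set" where
  "cyl w = {x. pre x (length w) = w}"

lemma open_cyl: "open (cyl w)"
  unfolding open_iff_seq_dist
proof
  fix x assume "x \<in> cyl w"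
  then have "\<forall>y. seq_dist x y < (1/2) ^ length w \<longrightarrow> y \<in> cyl w"
    by (auto simp: cyl_def seq_dist_less_iff) (metis pre_eq_iff less_imp_le)
  then show "\<exists>e>0. \<forall>y. seq_dist x y < e \<longrightarrow> y \<in> cyl w"
    by (intro exI[of _ "(1/2) ^ length w"]) auto
qed

lemma open_pre: "open {x. pre x n \<in> A}"
proof -
  have "{x. pre x n \<in> A} = (\<Union>w\<in>{w \<in> A. length w = n}. cyl w)"
    by (auto simp: cyl_def)
  then show ?thesis using open_cyl by (simp add: open_UN)
qed

lemma closed_pre: "closed {x. pre x n \<in> A}"
proof -
  have "- {x. pre x n \<in> A} = {x. pre x n \<in> - A}" by auto
  then show ?thesis using open_pre[of n "- A"] by (simp add: closed_def)
qed

lemma closed_TM: "closed TM"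
proof -
  have "TM = (\<Inter>n. {x. pre x n \<in> lang})" by (auto simp: TM_iff)
  moreover have "closed (\<Inter>n. {x. pre x n \<in> lang})" by (intro closed_INT ballI closed_pre)
  ultimately show ?thesis by simp
qed

lemma compact_seq: "compact (UNIV :: seq set)"
proof -
  have "compactin euclidean (UNIV :: bool set)"
    by (simp add: finite_imp_compact)
  then have "compactin (product_topology (\<lambda>_ :: nat. euclidean :: bool topology) UNIV) (PiE UNIV (\<lambda>_. UNIV))"
    unfolding compactin_PiE by simp
  then show ?thesis by (simp add: euclidean_product_topology PiE_UNIV_domain)
qed

text \<open>Near \<open>TM\<close> the asymptotics give \<phi> at least (m / 2) / n, with m the
  minimum of g, while \<open>phi0\<close> is at most 1 / (n + 1). The points that exit within their
  first \<open>N\<close> letters form a compact set disjoint from \<open>TM\<close>, on which \<phi>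
  has a positive minimum and \<open>phi0\<close> is at most 1.\<close>

lemma Xi_TM_lower_bound:
  assumes "V \<in> Xi TM"
  obtains \<phi> c where "V = (\<lambda>x. - \<phi> x)" "continuous_on UNIV \<phi>" "\<And>x. \<phi> x \<ge> 0"
    "\<And>x. \<phi> x = 0 \<longleftrightarrow> x \<in> TM" "c > 0" "\<And>x. c * phi0 TM x \<le> \<phi> x"
proof -
  obtain \<phi> g where \<phi>: "V = (\<lambda>x. - \<phi> x)" "continuous_on UNIV \<phi>" "\<And>x. \<phi> x \<ge> 0"
    "\<And>x. \<phi> x = 0 \<longleftrightarrow> x \<in> TM"
    and g: "continuous_on UNIV g" "\<And>x. g x > 0"
    and asym: "\<And>\<epsilon>. \<epsilon> > 0 \<Longrightarrow> \<exists>N\<ge>1. \<forall>n\<ge>N. \<forall>x. dist_to x TM = (1/2) ^ n \<longrightarrow>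
           \<bar>\<phi> x - g x / real n\<bar> \<le> \<epsilon> * (1 / real n)"
    using assms unfolding Xi_def by blast
  obtain x0 where x0: "\<And>x. g x0 \<le> g x"
    using continuous_attains_inf[OF compact_seq _ g(1)] by auto
  define m where "m = g x0"
  have m: "m > 0" "\<And>x. m \<le> g x" using g(2) x0 by (simp_all add: m_def)
  obtain N where N: "N \<ge> 1" "\<And>n x. n \<ge> N \<Longrightarrow> dist_to x TM = (1/2) ^ n \<Longrightarrow>
      \<bar>\<phi> x - g x / real n\<bar> \<le> (m / 2) * (1 / real n)"
    using asym[of "m / 2"] m(1) by auto
  define K where "K = {x. pre x N \<in> - lang}"
  have "\<exists>m'>0. \<forall>x\<in>K. m' \<le> \<phi> x"
  proof (cases "K = {}")
    case False
    have "compact K" using compact_Int_closed[OF compact_seq closed_pre[of N "- lang"]] by (simp add: K_def)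
    from continuous_attains_inf[OF this False, of \<phi>] obtain z where z: "z \<in> K" "\<forall>x\<in>K. \<phi> z \<le> \<phi> x"
      using \<phi>(2) continuous_on_subset by blast
    have "z \<notin> TM" using z(1) TM_iff by (auto simp: K_def)
    then have "\<phi> z > 0" using \<phi>(3,4)[of z] by simp
    then show ?thesis using z(2) by blast
  qed (auto intro: exI[of _ 1])
  then obtain m' where m': "m' > 0" "\<And>x. x \<in> K \<Longrightarrow> m' \<le> \<phi> x" by blast
  have "min (m / 2) m' * phi0 TM x \<le> \<phi> x" for x
  proof (cases "x \<in> TM")
    case True
    then show ?thesis using \<phi>(3) by (simp add: phi0_TM)
  next
    case x: False
    define n where "n = lang_time x"
    note bound = phi0_le[OF x, folded n_def]
    show ?thesis
    proof (cases "x \<in> K")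
      case True
      have "1 / (real n + 1) \<le> 1" by simp
      then have "phi0 TM x \<le> 1" using bound by linarith
      then have "min (m / 2) m' * phi0 TM x \<le> m' * 1"
        using m' m(1) phi0_nonneg by (intro mult_mono) auto
      then show ?thesis using m'(2)[OF True] by simp
    next
      case False
      then have n: "n \<ge> N" using lang_time[OF x, of N] by (simp add: K_def n_def)
      then have n0: "real n > 0" using N(1) by simp
      have "\<bar>\<phi> x - g x / real n\<bar> \<le> (m / 2) * (1 / real n)"
        using N(2)[OF n] dist_to_TM[OF x] by (simp add: n_def)
      moreover have "m / real n \<le> g x / real n" using m(2) n0 by (intro divide_right_mono) auto
      ultimately have 1: "(m / 2) * (1 / real n) \<le> \<phi> x" by (simp add: abs_le_iff)
      have "1 / (real n + 1) \<le> 1 / real n" using n0 by (simp add: divide_simps)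
      then have "min (m / 2) m' * phi0 TM x \<le> (m / 2) * (1 / real n)"
        using bound m m'(1) phi0_nonneg by (intro mult_mono) auto
      then show ?thesis using 1 by simp
    qed
  qed
  moreover have "min (m / 2) m' > 0" using m m' by simp
  ultimately show ?thesis using that \<phi> by blast
qed

section \<open>Entropy of invariant measures\<close>

text \<open>Fekete's lemma. \<open>entropy_wrt\<close> is defined by \<open>lim\<close>, which says
  something only once convergence is known.\<close>

lemma subadditive_convergent:
  fixes a :: "nat \<Rightarrow> real"
  assumes nonneg: "\<And>n. a n \<ge> 0" and sub: "\<And>m n. a (m + n) \<le> a m + a n"
  shows "convergent (\<lambda>n. a n / real n)"
proof -
  define L where "L = (INF n\<in>{1..}. a n / real n)"
  have bdd: "bdd_below ((\<lambda>n. a n / real n) ` {1..})"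
    using nonneg by (intro bdd_belowI[of _ 0]) auto
  have lower: "L \<le> a n / real n" if "n \<ge> 1" for n
    unfolding L_def using bdd that by (intro cINF_lower) auto
  have mult: "a (q * m) \<le> real q * a m + a 0" for q m
  proof (induction q)
    case (Suc q)
    then show ?case using sub[of m "q * m"] by (simp add: algebra_simps)
  qed simp
  have "(\<lambda>n. a n / real n) \<longlonglongrightarrow> L"
  proof (rule LIMSEQ_I)
    fix e :: real assume e: "e > 0"
    have "\<exists>m\<in>{1..}. a m / real m < L + e / 2"
      using cINF_less_iff[of "{1..}" "\<lambda>n. a n / real n" "L + e / 2"] bdd e by (auto simp: L_def)
    then obtain m where m: "m \<ge> 1" "a m / real m < L + e / 2" by auto
    define B where "B = a 0 + (\<Sum>i<m. a i)"
    have B0: "B \<ge> 0" using nonneg by (simp add: B_def sum_nonneg)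
    have upper: "a n / real n \<le> a m / real m + B / real n" if "n \<ge> 1" for n
    proof -
      have "a n = a ((n div m) * m + n mod m)" by simp
      also have "\<dots> \<le> a ((n div m) * m) + a (n mod m)" by (rule sub)
      also have "a (n mod m) \<le> (\<Sum>i<m. a i)"
        using m(1) nonneg by (intro member_le_sum) auto
      also have "a ((n div m) * m) \<le> real (n div m) * a m + a 0" by (rule mult)
      also have "real (n div m) * a m \<le> (real n / real m) * a m"
      proof (rule mult_right_mono)
        have "real (n div m * m) \<le> real n" by (simp only: of_nat_le_iff div_times_less_eq_dividend)
        then show "real (n div m) \<le> real n / real m" using m(1) by (simp add: pos_le_divide_eq)
      qed (rule nonneg)
      finally have "a n \<le> real n * (a m / real m) + B" by (simp add: B_def)
      then show ?thesis using that by (simp add: divide_simps mult_ac)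
    qed
    obtain N where N: "real N > 2 * B / e" using reals_Archimedean2 by blast
    show "\<exists>no. \<forall>n\<ge>no. norm (a n / real n - L) < e"
    proof (intro exI allI impI)
      fix n assume n: "n \<ge> max N 1"
      then have "2 * B / e < real n" using N by linarith
      then have "B / real n < e / 2" using e n by (simp add: divide_simps mult_ac)
      then have "a n / real n < L + e" using upper[of n] m(2) n by linarith
      moreover have "L \<le> a n / real n" using lower n by simp
      ultimately show "norm (a n / real n - L) < e" by simp
    qed
  qed
  then show ?thesis by (rule convergentI)
qed

text \<open>Termwise ln t \<le> t - 1 at t = \<open>q p / m p\<close>.\<close>

lemma gibbs_inequality:
  fixes m q :: "'a \<Rightarrow> real"
  assumes "\<And>p. p \<in> S \<Longrightarrow> m p \<ge> 0" "\<And>p. p \<in> S \<Longrightarrow> q p \<ge> 0"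
    "\<And>p. p \<in> S \<Longrightarrow> m p > 0 \<Longrightarrow> q p > 0" "sum q S \<le> sum m S"
  shows "- (\<Sum>p\<in>S. m p * ln (m p)) \<le> - (\<Sum>p\<in>S. m p * ln (q p))"
proof -
  have "m p * ln (q p) - m p * ln (m p) \<le> q p - m p" if "p \<in> S" for p
  proof (cases "m p > 0")
    case True
    then have q: "q p > 0" using assms(3) that by blast
    have "m p * ln (q p) - m p * ln (m p) = m p * ln (q p / m p)"
      using True q by (simp add: ln_div right_diff_distrib)
    also have "\<dots> \<le> m p * (q p / m p - 1)"
      using True q ln_le_minus_one[of "q p / m p"] by (intro mult_left_mono) auto
    also have "\<dots> = q p - m p" using True by (simp add: right_diff_distrib)
    finally show ?thesis .
  next
    case False
    then have "m p = 0" using assms(1)[OF that] by simp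
    then show ?thesis using assms(2)[OF that] by simp
  qed
  then have "(\<Sum>p\<in>S. m p * ln (q p) - m p * ln (m p)) \<le> (\<Sum>p\<in>S. q p - m p)"
    by (rule sum_mono)
  then show ?thesis using assms(4) by (simp add: sum_subtractf)
qed

section \<open>Cylinder sets, invariance and approximation\<close>

lemma sets_borel_seq:
  "sets (borel :: seq measure) = sigma_sets UNIV {{x. pre x n \<in> B} | n B. True}"
proof -
  let ?G = "{{x. pre x n \<in> B} | n B. True} :: seq set set"
  have "sigma_sets UNIV {S :: seq set. open S} = sigma_sets UNIV ?G"
  proof (rule sigma_sets_eqI)
    fix S :: "seq set" assume "S \<in> {S. open S}"
    then have S: "open S" by simp
    define W where "W = {w. cyl w \<subseteq> S}"
    have "S = (\<Union>w\<in>W. cyl w)"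
    proof
      show "S \<subseteq> (\<Union>w\<in>W. cyl w)"
      proof
        fix x assume "x \<in> S"
        then obtain e where e: "e > 0" "\<And>y. seq_dist x y < e \<Longrightarrow> y \<in> S"
          using S open_iff_seq_dist by blast
        obtain n where n: "(1/2 :: real) ^ n < e" using real_arch_pow_inv[OF e(1), of "1/2"] by auto
        have "cyl (pre x (Suc n)) \<subseteq> S"
        proof
          fix y assume "y \<in> cyl (pre x (Suc n))"
          then have "pre y (Suc n) = pre x (Suc n)" by (simp add: cyl_def)
          then have "seq_dist x y < (1/2) ^ n"
            unfolding seq_dist_less_iff pre_eq_iff by (metis less_Suc_eq_le)
          then show "y \<in> S" using e(2) n by simp
        qed
        then have "pre x (Suc n) \<in> W" by (simp add: W_def)
        moreover have "x \<in> cyl (pre x (Suc n))" by (simp add: cyl_def)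
        ultimately show "x \<in> (\<Union>w\<in>W. cyl w)" by blast
      qed
    qed (auto simp: W_def)
    moreover have "(\<Union>w\<in>W. cyl w) \<in> sigma_sets UNIV ?G"
    proof -
      interpret sigma_algebra UNIV "sigma_sets UNIV ?G" by (rule sigma_algebra_sigma_sets) auto
      have "cyl w \<in> sigma_sets UNIV ?G" for w
      proof -
        have "cyl w = {x. pre x (length w) \<in> {w}}" by (simp add: cyl_def)
        then have "cyl w \<in> ?G" by blast
        then show ?thesis by (rule sigma_sets.Basic)
      qed
      then show ?thesis by (intro countable_UN') auto
    qed
    ultimately show "S \<in> sigma_sets UNIV ?G" by simp
  next
    fix S assume "S \<in> ?G"
    then show "S \<in> sigma_sets UNIV {S. open S}" using open_pre by blast
  qed
  then show ?thesis by (simp add: borel_def)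
qed

lemma Int_stable_pre: "Int_stable {{x. pre x n \<in> B} | n B. True}"
proof (rule Int_stableI)
  fix S T assume "S \<in> {{x. pre x n \<in> B} | n B. True}" "T \<in> {{x. pre x n \<in> B} | n B. True}"
  then obtain n B m C where ST: "S = {x. pre x n \<in> B}" "T = {x. pre x m \<in> C}" by blast
  have "S \<inter> T = {x. pre x (max m n) \<in> {w. take n w \<in> B \<and> take m w \<in> C}}"
    by (auto simp: ST take_pre min_def max_def)
  then show "S \<inter> T \<in> {{x. pre x n \<in> B} | n B. True}" by blast
qed

lemma pre_sets: "{x. pre x n \<in> B} \<in> sets borel"
  using open_pre by (rule borel_open)

lemma shift_measurable: "shift \<in> borel \<rightarrow>\<^sub>M borel"
proof (rule measurable_sigma_sets[of borel UNIV "{{x. pre x n \<in> B} | n B. True}"])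
  show "sets borel = sigma_sets UNIV {{x. pre x n \<in> B} | n B. True}" by (rule sets_borel_seq)
  fix S assume "S \<in> {{x. pre x n \<in> B} | n B. True}"
  then obtain n B where S: "S = {x. pre x n \<in> B}" by blast
  have "shift -` S \<inter> space borel = {x. pre x (Suc n) \<in> {w. tl w \<in> B}}"
    by (auto simp: S pre_Suc)
  then show "shift -` S \<inter> space borel \<in> sets borel" by (simp only: pre_sets)
qed auto

locale inv_measure =
  fixes \<mu> :: "seq measure"
  assumes inv: "invariant_prob \<mu>"
begin

sublocale prob_space \<mu>
  using inv by (simp add: invariant_prob_def)

lemma sets_mu [measurable_cong, simp]: "sets \<mu> = sets borel"
  using inv by (simp add: invariant_prob_def)

lemma space_mu [simp]: "space \<mu> = UNIV"
  using sets_eq_imp_space_eq[OF sets_mu] by simp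

lemma distr_shift: "distr \<mu> borel shift = \<mu>"
  using inv by (simp add: invariant_prob_def)

lemma shift_meas [measurable]: "shift \<in> \<mu> \<rightarrow>\<^sub>M borel" "shift \<in> \<mu> \<rightarrow>\<^sub>M \<mu>"
  using shift_measurable by (simp_all cong: measurable_cong_sets)

lemma shift_pow_meas [measurable]: "(shift ^^ k) \<in> \<mu> \<rightarrow>\<^sub>M \<mu>"
  by (induction k) auto

lemma integral_shift_pow:
  fixes f :: "seq \<Rightarrow> real"
  assumes f: "integrable \<mu> f"
  shows "integrable \<mu> (\<lambda>x. f ((shift ^^ k) x)) \<and> (\<integral>x. f ((shift ^^ k) x) \<partial>\<mu>) = (\<integral>x. f x \<partial>\<mu>)"
proof (induction k)
  case (Suc k)
  let ?g = "\<lambda>x. f ((shift ^^ k) x)"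
  have g: "?g \<in> borel_measurable borel"
    using Suc borel_measurable_integrable[of \<mu> ?g] by (simp cong: measurable_cong_sets)
  have i: "integrable (distr \<mu> borel shift) ?g" using Suc by (simp add: distr_shift)
  have "(\<integral>x. ?g x \<partial>distr \<mu> borel shift) = (\<integral>x. ?g (shift x) \<partial>\<mu>)"
    by (rule integral_distr[OF _ g]) simp
  then show ?case
    using Suc integrable_distr[OF shift_meas(1) i] by (simp add: distr_shift funpow_swap1)
qed (use f in simp)

lemma measure_shift_pow:
  assumes "A \<in> sets borel"
  shows "measure \<mu> {x. (shift ^^ k) x \<in> A} = measure \<mu> A"
proof -
  have "(\<integral>x. indicator A ((shift ^^ k) x) \<partial>\<mu>) = (\<integral>x. indicator A x \<partial>\<mu> :: real)"
    using assms by (intro integral_shift_pow[THEN conjunct2]) (auto simp: integrable_indicator_iff less_top[symmetric])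
  moreover have "(\<lambda>x. indicator A ((shift ^^ k) x) :: real) = indicator {x. (shift ^^ k) x \<in> A}"
    by (auto simp: indicator_def)
  ultimately show ?thesis by simp
qed

text \<open>Induction over the generated sigma-algebra with disjoint unions: such a union is cut off
  at a finite stage, and its finitely many remaining members are approximated separately.\<close>

lemma approx_by_cylinder:
  assumes "A \<in> sets borel" "\<delta> > 0"
  shows "\<exists>n B. measure \<mu> ((A - {x. pre x n \<in> B}) \<union> ({x. pre x n \<in> B} - A)) < \<delta>"
proof -
  have "{{x. pre x n \<in> B} | n B. True} \<subseteq> Pow (UNIV :: seq set)" by simp
  from Int_stable_pre this assms(1)[unfolded sets_borel_seq] assms(2)
  show ?thesis
  proof (induction arbitrary: \<delta> rule: sigma_sets_induct_disjoint)
    case (basic A)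
    then obtain n B where "A = {x. pre x n \<in> B}" by blast
    then show ?case using basic by (intro exI[of _ n] exI[of _ B]) simp
  next
    case empty
    then show ?case by (intro exI[of _ 0] exI[of _ "{}"]) simp
  next
    case (compl A)
    then obtain n B where nB: "measure \<mu> ((A - {x. pre x n \<in> B}) \<union> ({x. pre x n \<in> B} - A)) < \<delta>" by blast
    have "((UNIV - A) - {x. pre x n \<in> - B}) \<union> ({x. pre x n \<in> - B} - (UNIV - A)) =
        (A - {x. pre x n \<in> B}) \<union> ({x. pre x n \<in> B} - A)" by auto
    then show ?case using nB by metis
  next
    case (union A)
    have A: "A i \<in> sets borel" for i using union(2) by (auto simp: sets_borel_seq)
    define U where "U m = (\<Union>i<m. A i)" for m
    have Um: "U m \<in> sets borel" for m unfolding U_def using A by auto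
    have "(\<lambda>m. measure \<mu> (U m)) \<longlonglongrightarrow> measure \<mu> (\<Union>m. U m)"
    proof (rule finite_Lim_measure_incseq)
      show "incseq U" unfolding U_def by (rule monoI) force
    qed (use Um in auto)
    moreover have "(\<Union>m. U m) = (\<Union>i. A i)" unfolding U_def by blast
    ultimately have "(\<lambda>m. measure \<mu> (U m)) \<longlonglongrightarrow> measure \<mu> (\<Union>i. A i)" by simp
    from LIMSEQ_D[OF this, of "\<delta> / 2"] \<open>\<delta> > 0\<close>
    obtain m where m: "\<bar>measure \<mu> (U m) - measure \<mu> (\<Union>i. A i)\<bar> < \<delta> / 2" by fastforce
    have sub: "U m \<subseteq> (\<Union>i. A i)" unfolding U_def by blast
    have tail: "measure \<mu> ((\<Union>i. A i) - U m) < \<delta> / 2"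
      using m finite_measure_Diff[of "\<Union>i. A i" "U m"] A Um sub by (auto simp: abs_if split: if_splits)
    \<comment> \<open>The \<open>m\<close> errors add up to at most \<delta> / 2; the 1 avoids a
      division by zero for \<open>m\<close> = 0.\<close>
    define e where "e = \<delta> / (2 * (real m + 1))"
    have e: "e > 0" using \<open>\<delta> > 0\<close> by (simp add: e_def)
    obtain n B where nB: "\<And>i. measure \<mu> ((A i - {x. pre x (n i) \<in> B i}) \<union> ({x. pre x (n i) \<in> B i} - A i)) < e"
      using union(3)[OF e] by metis
    define N where "N = (\<Sum>i<m. n i)"
    define C where "C = {w. \<exists>i<m. take (n i) w \<in> B i}"
    have nN: "n i \<le> N" if "i < m" for i unfolding N_def using that by (intro member_le_sum) auto
    have C: "{x. pre x N \<in> C} = (\<Union>i<m. {x. pre x (n i) \<in> B i})"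
      using nN by (auto simp: C_def take_pre min_absorb1)
    let ?D = "\<lambda>i. (A i - {x. pre x (n i) \<in> B i}) \<union> ({x. pre x (n i) \<in> B i} - A i)"
    have Dm: "?D i \<in> sets \<mu>" for i using A pre_sets by auto
    have "((\<Union>i. A i) - {x. pre x N \<in> C}) \<union> ({x. pre x N \<in> C} - (\<Union>i. A i)) \<subseteq>
        ((\<Union>i. A i) - U m) \<union> (\<Union>i<m. ?D i)" (is "?E \<subseteq> ?F")
      unfolding C U_def by blast
    then have "measure \<mu> ?E \<le> measure \<mu> ?F"
      using A Um Dm by (intro finite_measure_mono) auto
    also have "\<dots> \<le> measure \<mu> ((\<Union>i. A i) - U m) + measure \<mu> (\<Union>i<m. ?D i)"
      using A Um Dm by (intro measure_Un_le) auto
    also have "measure \<mu> (\<Union>i<m. ?D i) \<le> (\<Sum>i<m. measure \<mu> (?D i))"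
      using Dm by (intro finite_measure_subadditive_finite) auto
    also have "\<dots> \<le> (\<Sum>i<m. e)" using nB by (intro sum_mono less_imp_le)
    also have "\<dots> \<le> \<delta> / 2" using \<open>\<delta> > 0\<close> by (simp add: e_def divide_simps)
    finally show ?case using tail by (intro exI[of _ N] exI[of _ C]) simp
  qed
qed

end

section \<open>Itineraries and block entropies\<close>

locale inv_partition = inv_measure +
  fixes P :: "seq set set"
  assumes P: "finite_partition \<mu> P"
begin

lemma finite_P: "finite P" and P_sets: "A \<in> P \<Longrightarrow> A \<in> sets borel" and P_part: "partition_on UNIV P"
  using P by (auto simp: finite_partition_def)

definition cell :: "seq \<Rightarrow> seq set" where
  "cell x = (THE A. A \<in> P \<and> x \<in> A)"

lemma cell_eq: "A \<in> P \<Longrightarrow> x \<in> A \<Longrightarrow> cell x = A"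
  unfolding cell_def using P_part by (intro the_equality) (auto simp: partition_on_def disjoint_def)

lemma cell: "cell x \<in> P" "x \<in> cell x"
proof -
  obtain A where "A \<in> P" "x \<in> A" using P_part by (auto simp: partition_on_def)
  then show "cell x \<in> P" "x \<in> cell x" using cell_eq by auto
qed

lemma cell_iff: "A \<in> P \<Longrightarrow> cell x = A \<longleftrightarrow> x \<in> A"
  using cell cell_eq by metis

definition itineraries :: "nat \<Rightarrow> (nat \<Rightarrow> seq set) set" where
  "itineraries n = PiE {..<n} (\<lambda>_. P)"

definition itinerary :: "nat \<Rightarrow> seq \<Rightarrow> nat \<Rightarrow> seq set" where
  "itinerary n x = restrict (\<lambda>i. cell ((shift ^^ i) x)) {..<n}"

definition itinerary_prob :: "nat \<Rightarrow> (nat \<Rightarrow> seq set) \<Rightarrow> real" where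
  "itinerary_prob n p = measure \<mu> {x. itinerary n x = p}"

lemma finite_names: "finite (itineraries n)"
  unfolding itineraries_def using finite_P by (intro finite_PiE) auto

lemma itinerary_names: "itinerary n x \<in> itineraries n"
  by (auto simp: itinerary_def itineraries_def cell)

lemma itinerary_eq_iff: "p \<in> itineraries n \<Longrightarrow> itinerary n x = p \<longleftrightarrow> (\<forall>i<n. (shift ^^ i) x \<in> p i)"
proof -
  assume p: "p \<in> itineraries n"
  have "itinerary n x = p \<longleftrightarrow> (\<forall>i<n. cell ((shift ^^ i) x) = p i)"
    using p by (auto simp: itinerary_def itineraries_def fun_eq_iff PiE_def extensional_def)
  also have "\<dots> \<longleftrightarrow> (\<forall>i<n. (shift ^^ i) x \<in> p i)"
  proof -
    have "p i \<in> P" if "i < n" for i using p that by (auto simp: itineraries_def)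
    then show ?thesis using cell_iff by blast
  qed
  finally show ?thesis .
qed

lemma itinerary_sets: "p \<in> itineraries n \<Longrightarrow> {x. itinerary n x = p} \<in> sets borel"
proof -
  assume p: "p \<in> itineraries n"
  have "(shift ^^ i) -` p i \<inter> space \<mu> \<in> sets \<mu>" if "i < n" for i
    using p that P_sets by (intro measurable_sets[OF shift_pow_meas]) (auto simp: itineraries_def)
  then have "(\<Inter>i\<in>{..<n}. (shift ^^ i) -` p i) \<in> sets \<mu> \<or> n = 0"
    by (cases n) (auto intro!: sets.finite_INT)
  moreover have "{x. itinerary n x = p} = (\<Inter>i\<in>{..<n}. (shift ^^ i) -` p i)"
    using p by (auto simp: itinerary_eq_iff)
  ultimately show ?thesis by auto
qed

lemma sum_names:
  fixes f :: "(nat \<Rightarrow> seq set) \<Rightarrow> real"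
  shows "(\<Sum>p\<in>itineraries n. itinerary_prob n p * f p) = (\<integral>x. f (itinerary n x) \<partial>\<mu>)" "integrable \<mu> (\<lambda>x. f (itinerary n x))"
proof -
  have *: "f (itinerary n x) = (\<Sum>p\<in>itineraries n. f p * indicator {x. itinerary n x = p} x)" for x
    using finite_names itinerary_names by (simp add: indicator_def if_distrib sum.If_cases Int_absorb1 cong: if_cong)
  have i: "integrable \<mu> (\<lambda>x. f p * indicator {x. itinerary n x = p} x)" if "p \<in> itineraries n" for p
    using itinerary_sets[OF that] by (intro integrable_mult_right) (auto simp: integrable_indicator_iff less_top[symmetric])
  show "integrable \<mu> (\<lambda>x. f (itinerary n x))"
    unfolding * using i by (rule Bochner_Integration.integrable_sum)
  have "(\<integral>x. f (itinerary n x) \<partial>\<mu>) = (\<Sum>p\<in>itineraries n. \<integral>x. f p * indicator {x. itinerary n x = p} x \<partial>\<mu>)"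
    unfolding * using i by (rule Bochner_Integration.integral_sum)
  then show "(\<Sum>p\<in>itineraries n. itinerary_prob n p * f p) = (\<integral>x. f (itinerary n x) \<partial>\<mu>)"
    using itinerary_sets by (simp add: itinerary_prob_def mult.commute)
qed

lemma sum_ms: "(\<Sum>p\<in>itineraries n. itinerary_prob n p) = 1"
  using sum_names(1)[of n "\<lambda>_. 1"] prob_space by simp

definition block_entropy :: "nat \<Rightarrow> real" where
  "block_entropy n = - (\<Sum>p\<in>itineraries n. itinerary_prob n p * ln (itinerary_prob n p))"

text \<open>\<open>join\<close> is a set of sets, so all itineraries with an empty atom are
  identified there. They contribute 0 on both sides, and indexing by itineraries is what the product
  arguments below need.\<close>

lemma partition_entropy_join: "partition_entropy \<mu> (join shift \<mu> P n) = block_entropy n"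
proof -
  define atom where "atom a = {x \<in> space \<mu>. \<forall>i<n. (shift ^^ i) x \<in> a i}" for a
  have atom: "atom p = {x. itinerary n x = p}" if "p \<in> itineraries n" for p
    using that by (simp add: atom_def itinerary_eq_iff)
  have "join shift \<mu> P n = atom ` itineraries n"
  proof
    show "join shift \<mu> P n \<subseteq> atom ` itineraries n"
    proof
      fix S assume "S \<in> join shift \<mu> P n"
      then obtain a where a: "S = atom a" "\<forall>i<n. a i \<in> P" by (auto simp: join_def atom_def)
      then have "S = atom (restrict a {..<n})" "restrict a {..<n} \<in> itineraries n"
        by (auto simp: atom_def itineraries_def)
      then show "S \<in> atom ` itineraries n" by blast
    qed
  qed (auto simp: join_def atom_def itineraries_def)
  then have "(\<Sum>A\<in>join shift \<mu> P n. measure \<mu> A * ln (measure \<mu> A)) =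
      (\<Sum>p\<in>itineraries n. measure \<mu> (atom p) * ln (measure \<mu> (atom p)))"
  proof (simp only:, subst sum.reindex_nontrivial)
    fix p q assume "p \<in> itineraries n" "q \<in> itineraries n" "p \<noteq> q" "atom p = atom q"
    then have "atom p = {}" by (auto simp: atom)
    then show "measure \<mu> (atom p) * ln (measure \<mu> (atom p)) = 0" by simp
  qed (simp_all add: finite_names)
  also have "\<dots> = (\<Sum>p\<in>itineraries n. itinerary_prob n p * ln (itinerary_prob n p))"
    by (rule sum.cong) (auto simp: atom itinerary_prob_def)
  finally show ?thesis by (simp add: partition_entropy_def block_entropy_def)
qed

lemma itinerary_prob_nonneg: "itinerary_prob n p \<ge> 0" and itinerary_prob_le_1: "itinerary_prob n p \<le> 1"
  by (simp_all add: itinerary_prob_def)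

lemma block_entropy_nonneg: "block_entropy n \<ge> 0"
proof -
  have "itinerary_prob n p * ln (itinerary_prob n p) \<le> 0" for p
    using itinerary_prob_nonneg[of n p] itinerary_prob_le_1[of n p] by (cases "itinerary_prob n p = 0") (auto simp: mult_nonneg_nonpos)
  then show ?thesis unfolding block_entropy_def by (simp add: sum_nonpos)
qed

text \<open>Gibbs' inequality against the product of the laws of the first \<open>n\<close> and the
  last \<open>k\<close> symbols; by invariance the latter is the law of an itinerary of length
  \<open>k\<close>.\<close>

lemma block_entropy_subadditive: "block_entropy (n + k) \<le> block_entropy n + block_entropy k"
proof -
  define l where "l p = restrict p {..<n}" for p :: "nat \<Rightarrow> seq set"
  define r where "r p = restrict (\<lambda>i. p (n + i)) {..<k}" for p :: "nat \<Rightarrow> seq set"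
  have l: "l (itinerary (n + k) x) = itinerary n x" for x by (auto simp: l_def itinerary_def restrict_def fun_eq_iff)
  have r: "r (itinerary (n + k) x) = itinerary k ((shift ^^ n) x)" for x
    by (auto simp: r_def itinerary_def restrict_def fun_eq_iff add.commute[of n] funpow_add)
  have ln_names: "l p \<in> itineraries n" "r p \<in> itineraries k" if "p \<in> itineraries (n + k)" for p
    using that by (auto simp: l_def r_def itineraries_def)
  have inj: "inj_on (\<lambda>p. (l p, r p)) (itineraries (n + k))"
  proof (rule inj_onI)
    fix p q assume pq: "p \<in> itineraries (n + k)" "q \<in> itineraries (n + k)" "(l p, r p) = (l q, r q)"
    show "p = q"
    proof (rule PiE_ext[of p "{..<n + k}" "\<lambda>_. P" q])
      fix i assume i: "i \<in> {..<n + k}"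
      show "p i = q i"
      proof (cases "i < n")
        case True
        have "l p i = l q i" using pq(3) by simp
        then show ?thesis using True by (simp add: l_def)
      next
        case False
        have "r p (i - n) = r q (i - n)" using pq(3) by simp
        moreover have "i - n < k" using False i by auto
        ultimately show ?thesis using False by (simp add: r_def)
      qed
    qed (use pq in \<open>auto simp: itineraries_def\<close>)
  qed
  have itinerary_prob_r: "measure \<mu> {x. itinerary k ((shift ^^ n) x) = p} = itinerary_prob k p" if "p \<in> itineraries k" for p
    using measure_shift_pow[OF itinerary_sets[OF that], of n] by (simp add: itinerary_prob_def)
  have pos: "itinerary_prob n (l p) > 0 \<and> itinerary_prob k (r p) > 0" if p: "p \<in> itineraries (n + k)" "itinerary_prob (n + k) p > 0" for p
  proof -
    have "itinerary_prob (n + k) p \<le> itinerary_prob n (l p)"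
      unfolding itinerary_prob_def using itinerary_sets[OF ln_names(1)[OF p(1)]] by (intro finite_measure_mono) (auto simp: l)
    moreover have "{x. itinerary k ((shift ^^ n) x) = r p} \<in> sets \<mu>"
      using measurable_sets[OF shift_pow_meas, of "{x. itinerary k x = r p}" n] itinerary_sets[OF ln_names(2)[OF p(1)]]
      by (simp add: vimage_def)
    then have "itinerary_prob (n + k) p \<le> measure \<mu> {x. itinerary k ((shift ^^ n) x) = r p}"
      unfolding itinerary_prob_def by (intro finite_measure_mono) (auto simp: r)
    ultimately show ?thesis using p(2) itinerary_prob_r[OF ln_names(2)[OF p(1)]] by simp
  qed
  have "(\<Sum>p\<in>itineraries (n + k). itinerary_prob n (l p) * itinerary_prob k (r p)) =
      (\<Sum>(a, b)\<in>(\<lambda>p. (l p, r p)) ` itineraries (n + k). itinerary_prob n a * itinerary_prob k b)"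
    by (subst sum.reindex[OF inj]) simp
  also have "\<dots> \<le> (\<Sum>(a, b)\<in>itineraries n \<times> itineraries k. itinerary_prob n a * itinerary_prob k b)"
    using finite_names ln_names itinerary_prob_nonneg by (intro sum_mono2) auto
  also have "\<dots> = (\<Sum>a\<in>itineraries n. itinerary_prob n a) * (\<Sum>b\<in>itineraries k. itinerary_prob k b)"
    by (simp add: sum_product sum.cartesian_product)
  finally have q1: "(\<Sum>p\<in>itineraries (n + k). itinerary_prob n (l p) * itinerary_prob k (r p)) \<le> (\<Sum>p\<in>itineraries (n + k). itinerary_prob (n + k) p)"
    by (simp add: sum_ms)
  have "block_entropy (n + k) \<le> - (\<Sum>p\<in>itineraries (n + k). itinerary_prob (n + k) p * ln (itinerary_prob n (l p) * itinerary_prob k (r p)))"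
    unfolding block_entropy_def
    by (rule gibbs_inequality) (use itinerary_prob_nonneg pos q1 in auto)
  also have "(\<Sum>p\<in>itineraries (n + k). itinerary_prob (n + k) p * ln (itinerary_prob n (l p) * itinerary_prob k (r p))) =
      (\<Sum>p\<in>itineraries (n + k). itinerary_prob (n + k) p * (ln (itinerary_prob n (l p)) + ln (itinerary_prob k (r p))))"
  proof (rule sum.cong)
    fix p assume p: "p \<in> itineraries (n + k)"
    show "itinerary_prob (n + k) p * ln (itinerary_prob n (l p) * itinerary_prob k (r p)) = itinerary_prob (n + k) p * (ln (itinerary_prob n (l p)) + ln (itinerary_prob k (r p)))"
      using pos[OF p] itinerary_prob_nonneg[of "n + k" p] by (cases "itinerary_prob (n + k) p = 0") (auto simp: ln_mult)
  qed simp
  also have "\<dots> = (\<Sum>p\<in>itineraries (n + k). itinerary_prob (n + k) p * ln (itinerary_prob n (l p))) +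
      (\<Sum>p\<in>itineraries (n + k). itinerary_prob (n + k) p * ln (itinerary_prob k (r p)))"
    by (simp add: distrib_left sum.distrib)
  also have "(\<Sum>p\<in>itineraries (n + k). itinerary_prob (n + k) p * ln (itinerary_prob n (l p))) = - block_entropy n"
    using sum_names(1)[of "n + k" "\<lambda>p. ln (itinerary_prob n (l p))"] sum_names(1)[of n "\<lambda>p. ln (itinerary_prob n p)"]
    by (simp add: l block_entropy_def)
  also have "(\<Sum>p\<in>itineraries (n + k). itinerary_prob (n + k) p * ln (itinerary_prob k (r p))) = - block_entropy k"
  proof -
    have "(\<Sum>p\<in>itineraries (n + k). itinerary_prob (n + k) p * ln (itinerary_prob k (r p))) = (\<integral>x. ln (itinerary_prob k (itinerary k ((shift ^^ n) x))) \<partial>\<mu>)"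
      using sum_names(1)[of "n + k" "\<lambda>p. ln (itinerary_prob k (r p))"] by (simp add: r)
    also have "\<dots> = (\<integral>x. ln (itinerary_prob k (itinerary k x)) \<partial>\<mu>)"
      using integral_shift_pow[OF sum_names(2)[of "\<lambda>p. ln (itinerary_prob k p)" k], of n] by simp
    finally show ?thesis using sum_names(1)[of k "\<lambda>p. ln (itinerary_prob k p)"] by (simp add: block_entropy_def)
  qed
  finally show ?thesis by simp
qed

lemma entropy_limit: "(\<lambda>n. block_entropy n / real n) \<longlonglongrightarrow> entropy_wrt shift \<mu> P"
  using subadditive_convergent[of block_entropy, OF block_entropy_nonneg block_entropy_subadditive]
  unfolding entropy_wrt_def partition_entropy_join by (simp add: convergent_LIMSEQ_iff)

end

section \<open>The entropy bound\<close>

context inv_partition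
begin

lemma cell_sets: "{x. cell x \<noteq> c (pre x N)} \<in> sets borel"
proof -
  have "{x. cell x \<noteq> c (pre x N)} = (\<Union>A\<in>P. A \<inter> {x. pre x N \<in> {w. c w \<noteq> A}})"
  proof (intro set_eqI iffI)
    fix x assume "x \<in> {x. cell x \<noteq> c (pre x N)}"
    then show "x \<in> (\<Union>A\<in>P. A \<inter> {x. pre x N \<in> {w. c w \<noteq> A}})"
      by (intro UN_I[of "cell x"]) (auto simp: cell)
  next
    fix x assume "x \<in> (\<Union>A\<in>P. A \<inter> {x. pre x N \<in> {w. c w \<noteq> A}})"
    then obtain A where "A \<in> P" "x \<in> A" "c (pre x N) \<noteq> A" by blast
    then show "x \<in> {x. cell x \<noteq> c (pre x N)}" using cell_eq[of A x] by simp
  qed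
  also have "\<dots> \<in> sets borel"
    by (intro sets.finite_UN sets.Int pre_sets P_sets finite_P)
  finally show ?thesis .
qed

text \<open>
  The name of \<open>x\<close> with respect to \<open>P\<close> is guessed from the letters of \<open>x\<close>, letting a word \<open>y\<close> of
  length \<open>n + N\<close> have probability proportional to \<open>W y\<close> and every guess be wrong with
  probability \<open>\<eta>\<close>. The resulting distribution on itineraries is the one used in Gibbs' inequality.
\<close>

lemma block_entropy_le:
  fixes W :: "bool list \<Rightarrow> real" and \<psi> :: "seq \<Rightarrow> real" and c :: "bool list \<Rightarrow> seq set"
  assumes W: "\<And>y. W y > 0"
    and \<psi>: "integrable \<mu> \<psi>"
    and W\<psi>: "\<And>x n. - ln (W (pre x n)) \<le> (\<Sum>k<n. \<psi> ((shift ^^ k) x))"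
    and \<eta>: "0 < \<eta>" "\<eta> < 1"
  shows "block_entropy n \<le> ln (\<Sum>y\<in>{y. length y = n + N}. W y) + real (n + N) * (\<integral>x. \<psi> x \<partial>\<mu>)
    + real n * (- ln (1 - \<eta>)) + real n * (- ln (\<eta> / card P) * measure \<mu> {x. cell x \<noteq> c (pre x N)})"
proof -
  define Z where "Z = (\<Sum>y\<in>{y. length y = n + N}. W y)"
  \<comment> \<open>Spreading \<eta> over all of \<open>P\<close> instead of the other cells keeps
    the sum below 1, and the guess \<open>C\<close> may even lie outside \<open>P\<close>.\<close>
  define r where "r A C = (if A = C then 1 - \<eta> else \<eta> / card P)" for A C :: "seq set"
  define K where "K = - ln (\<eta> / card P)"
  define D where "D = {x. cell x \<noteq> c (pre x N)}"
  define q where "q p = (\<Sum>y\<in>{y. length y = n + N}. W y / Z * (\<Prod>i<n. r (p i) (c (take N (drop i y)))))" for p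
  have Pne: "P \<noteq> {}" using cell(1) by auto
  have cP: "real (card P) \<ge> 1" using finite_P Pne by (simp add: Suc_le_eq card_gt_0_iff)
  have \<eta>P: "0 < \<eta> / card P" "\<eta> / card P \<le> 1" using \<eta> cP by (auto simp: divide_simps)
  have K0: "K \<ge> 0" using \<eta>P by (simp add: K_def)
  have Z: "Z > 0"
    unfolding Z_def using W finite_words by (intro sum_pos) (auto intro: exI[of _ "replicate (n + N) True"])
  have r_pos: "r A C > 0" for A C using \<eta> \<eta>P by (simp add: r_def)
  have r_sum: "(\<Sum>A\<in>P. r A C) \<le> 1" for C
  proof -
    have "(\<Sum>A\<in>P. r A C) \<le> (\<Sum>A\<in>P. (if A = C then 1 - \<eta> else 0) + \<eta> / card P)"
      using \<eta>P \<eta> by (intro sum_mono) (auto simp: r_def)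
    also have "\<dots> = (if C \<in> P then 1 - \<eta> else 0) + \<eta>"
      using finite_P Pne by (simp add: sum.distrib card_gt_0_iff)
    also have "\<dots> \<le> 1" using \<eta> by simp
    finally show ?thesis .
  qed
  have q_pos: "q p > 0" for p
    unfolding q_def using W Z r_pos finite_words
    by (intro sum_pos mult_pos_pos prod_pos divide_pos_pos) (auto intro: exI[of _ "replicate (n + N) True"])
  have q_sum: "(\<Sum>p\<in>itineraries n. q p) \<le> 1"
  proof -
    have "(\<Sum>p\<in>itineraries n. q p) = (\<Sum>y\<in>{y. length y = n + N}. W y / Z *
        (\<Sum>p\<in>itineraries n. \<Prod>i<n. r (p i) (c (take N (drop i y)))))"
      unfolding q_def by (subst sum.swap) (simp add: sum_distrib_left)
    also have "\<dots> \<le> (\<Sum>y\<in>{y. length y = n + N}. W y / Z * 1)"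
    proof (intro sum_mono mult_left_mono)
      fix y
      have "(\<Sum>p\<in>itineraries n. \<Prod>i<n. r (p i) (c (take N (drop i y)))) =
          (\<Prod>i<n. \<Sum>A\<in>P. r A (c (take N (drop i y))))"
        unfolding itineraries_def by (rule prod_sum_PiE[symmetric]) (use finite_P in auto)
      also have "\<dots> \<le> 1" by (intro prod_le_1 conjI sum_nonneg less_imp_le[OF r_pos] r_sum)
      finally show "(\<Sum>p\<in>itineraries n. \<Prod>i<n. r (p i) (c (take N (drop i y)))) \<le> 1" .
      show "0 \<le> W y / Z" using W[of y] Z by simp
    qed
    also have "\<dots> = 1" using Z by (simp add: sum_divide_distrib[symmetric] Z_def[symmetric])
    finally show ?thesis .
  qed
  define G where "G x = ln Z + (\<Sum>k<n + N. \<psi> ((shift ^^ k) x)) + real n * (- ln (1 - \<eta>))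
    + (\<Sum>i<n. K * indicator D ((shift ^^ i) x))" for x
  have bound: "- ln (q (itinerary n x)) \<le> G x" for x
  proof -
    define y where "y = pre x (n + N)"
    have y: "length y = n + N" by (simp add: y_def)
    let ?R = "\<Prod>i<n. r (itinerary n x i) (c (take N (drop i y)))"
    have Rpos: "?R > 0" using r_pos by (intro prod_pos) auto
    \<comment> \<open>Of the mixture only the term of the actual prefix of \<open>x\<close> is kept.
      It has \<open>n + N\<close> letters because the guess at time i reads the \<open>N\<close>
      letters from i on.\<close>
    have "W y / Z * ?R \<le> q (itinerary n x)"
      unfolding q_def
    proof (rule member_le_sum)
      show "0 \<le> W y / Z * (\<Prod>i<n. r (itinerary n x i) (c (take N (drop i y))))" for y
        by (intro less_imp_le mult_pos_pos divide_pos_pos W Z prod_pos r_pos)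
    qed (use y finite_words in auto)
    then have "- ln (q (itinerary n x)) \<le> - ln (W y / Z * ?R)"
      using Rpos W[of y] Z q_pos by simp
    also have "- ln (W y / Z * ?R) = ln Z - ln (W y) - ln ?R"
    proof -
      have "- ln (w / z * R) = ln z - ln w - ln R" if "w > 0" "z > 0" "R > 0" for w z R :: real
        using that by (simp add: ln_mult ln_div)
      then show ?thesis using W Z Rpos by blast
    qed
    finally have 0: "- ln (q (itinerary n x)) \<le> ln Z - ln (W y) - ln ?R" .
    have lnR: "ln ?R = (\<Sum>i<n. ln (r (itinerary n x i) (c (take N (drop i y)))))"
    proof -
      have "r A C \<noteq> 0" for A C using r_pos[of A C] by simp
      then show ?thesis using r_pos by (intro ln_prod) auto
    qed
    have 1: "- ln (W y) \<le> (\<Sum>k<n + N. \<psi> ((shift ^^ k) x))" unfolding y_def by (rule W\<psi>)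
    have 2: "- (\<Sum>i<n. ln (r (itinerary n x i) (c (take N (drop i y))))) \<le>
        (\<Sum>i<n. - ln (1 - \<eta>) + K * indicator D ((shift ^^ i) x))"
      unfolding sum_negf[symmetric]
    proof (rule sum_mono)
      fix i assume i: "i \<in> {..<n}"
      have a: "itinerary n x i = cell ((shift ^^ i) x)" using i by (simp add: itinerary_def)
      have b: "take N (drop i y) = pre ((shift ^^ i) x) N"
        using i by (simp add: y_def drop_pre take_pre min_absorb1)
      have "ln (1 - \<eta>) \<le> 0" using \<eta> by simp
      then show "- ln (r (itinerary n x i) (c (take N (drop i y)))) \<le> - ln (1 - \<eta>) + K * indicator D ((shift ^^ i) x)"
        unfolding a b by (simp add: r_def D_def K_def indicator_def)
    qed
    have "(\<Sum>i<n. - ln (1 - \<eta>) + K * indicator D ((shift ^^ i) x)) =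
        real n * (- ln (1 - \<eta>)) + (\<Sum>i<n. K * indicator D ((shift ^^ i) x))"
      by (simp only: sum.distrib sum_constant card_lessThan)
    then show ?thesis using 0 1 2 unfolding lnR G_def by linarith
  qed
  have D_sets: "D \<in> sets borel" unfolding D_def by (rule cell_sets)
  have iD: "integrable \<mu> (\<lambda>x. K * indicator D x)"
    using D_sets by (intro integrable_mult_right) (auto simp: integrable_indicator_iff less_top[symmetric])
  define A where "A x = (\<Sum>k<n + N. \<psi> ((shift ^^ k) x))" for x
  define B where "B x = (\<Sum>i<n. K * indicator D ((shift ^^ i) x))" for x
  have A: "integrable \<mu> A" "(\<integral>x. A x \<partial>\<mu>) = real (n + N) * (\<integral>x. \<psi> x \<partial>\<mu>)"
    unfolding A_def using integral_shift_pow[OF \<psi>] by (auto simp: Bochner_Integration.integral_sum)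
  have B: "integrable \<mu> B" "(\<integral>x. B x \<partial>\<mu>) = real n * (K * measure \<mu> D)"
  proof -
    show "integrable \<mu> B"
      unfolding B_def using integral_shift_pow[OF iD] by (intro Bochner_Integration.integrable_sum) blast
    have "(\<integral>x. B x \<partial>\<mu>) = (\<Sum>i<n. \<integral>x. K * indicator D ((shift ^^ i) x) \<partial>\<mu>)"
      unfolding B_def using integral_shift_pow[OF iD] by (intro Bochner_Integration.integral_sum) blast
    also have "\<dots> = (\<Sum>i<n. \<integral>x. K * indicator D x \<partial>\<mu>)"
      using integral_shift_pow[OF iD] by (intro sum.cong) auto
    finally show "(\<integral>x. B x \<partial>\<mu>) = real n * (K * measure \<mu> D)" using D_sets by simp
  qed
  define a where "a = ln Z + real n * (- ln (1 - \<eta>))"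
  have G: "G = (\<lambda>x. a + (A x + B x))" by (auto simp: G_def A_def B_def a_def)
  have AB: "integrable \<mu> (\<lambda>x. A x + B x)" using A B by simp
  have G_int: "integrable \<mu> G" unfolding G using AB by simp
  have "(\<integral>x. G x \<partial>\<mu>) = a + (\<integral>x. A x + B x \<partial>\<mu>)"
    unfolding G by (subst Bochner_Integration.integral_add[OF _ AB]) (use prob_space in simp_all)
  also have "\<dots> = ln Z + real (n + N) * (\<integral>x. \<psi> x \<partial>\<mu>) + real n * (- ln (1 - \<eta>))
    + real n * (K * measure \<mu> D)"
    using A B by (simp add: a_def)
  finally have "(\<integral>x. G x \<partial>\<mu>) = ln Z + real (n + N) * (\<integral>x. \<psi> x \<partial>\<mu>) + real n * (- ln (1 - \<eta>))
    + real n * (K * measure \<mu> D)" .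
  moreover have "block_entropy n \<le> - (\<Sum>p\<in>itineraries n. itinerary_prob n p * ln (q p))"
    unfolding block_entropy_def by (rule gibbs_inequality) (use itinerary_prob_nonneg q_pos q_sum sum_ms in \<open>auto intro: less_imp_le\<close>)
  moreover have "- (\<Sum>p\<in>itineraries n. itinerary_prob n p * ln (q p)) = (\<integral>x. - ln (q (itinerary n x)) \<partial>\<mu>)"
    using sum_names(1)[of n "\<lambda>p. - ln (q p)"] by (simp add: sum_negf)
  moreover have "(\<integral>x. - ln (q (itinerary n x)) \<partial>\<mu>) \<le> (\<integral>x. G x \<partial>\<mu>)"
    using sum_names(2)[of "\<lambda>p. - ln (q p)" n] G_int bound by (intro integral_mono)
  ultimately show ?thesis by (simp add: Z_def K_def D_def)
qed

text \<open>Each cell is approximated by a condition on finitely many letters. Off the exceptional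
  sets exactly one of these conditions holds, and it selects the true cell.\<close>

lemma guess_exists:
  assumes "\<delta> > 0"
  obtains N c where "measure \<mu> {x. cell x \<noteq> c (pre x N)} \<le> \<delta>"
proof -
  have Pne: "P \<noteq> {}" using cell(1) by auto
  have cP: "real (card P) > 0" using finite_P Pne by (simp add: card_gt_0_iff)
  have "\<exists>n B. measure \<mu> ((A - {x. pre x n \<in> B}) \<union> ({x. pre x n \<in> B} - A)) < \<delta> / card P" if "A \<in> P" for A
    using approx_by_cylinder[OF P_sets[OF that]] assms cP by simp
  then obtain n B where nB: "\<And>A. A \<in> P \<Longrightarrow>
      measure \<mu> ((A - {x. pre x (n A) \<in> B A}) \<union> ({x. pre x (n A) \<in> B A} - A)) < \<delta> / card P"
    by metis
  define N where "N = (\<Sum>A\<in>P. n A)"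
  have nN: "n A \<le> N" if "A \<in> P" for A unfolding N_def using that finite_P by (intro member_le_sum) auto
  define c where "c w = (SOME A. A \<in> P \<and> take (n A) w \<in> B A)" for w
  let ?D = "\<lambda>A. (A - {x. pre x (n A) \<in> B A}) \<union> ({x. pre x (n A) \<in> B A} - A)"
  have "{x. cell x \<noteq> c (pre x N)} \<subseteq> (\<Union>A\<in>P. ?D A)"
  proof (rule subsetI, rule ccontr)
    fix x assume x: "x \<in> {x. cell x \<noteq> c (pre x N)}" "x \<notin> (\<Union>A\<in>P. ?D A)"
    then have *: "pre x (n A) \<in> B A \<longleftrightarrow> x \<in> A" if "A \<in> P" for A using that by auto
    have "A \<in> P \<and> take (n A) (pre x N) \<in> B A \<longleftrightarrow> A = cell x" for A
    proof -
      have "A \<in> P \<Longrightarrow> take (n A) (pre x N) = pre x (n A)" using nN[of A] by (simp add: take_pre min_absorb1)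
      then show ?thesis using * cell cell_eq by metis
    qed
    then have "c (pre x N) = cell x" unfolding c_def by simp
    then show False using x(1) by simp
  qed
  moreover have Dm: "?D A \<in> sets \<mu>" if "A \<in> P" for A using P_sets[OF that] pre_sets by auto
  ultimately have "measure \<mu> {x. cell x \<noteq> c (pre x N)} \<le> measure \<mu> (\<Union>A\<in>P. ?D A)"
    using finite_P by (intro finite_measure_mono) auto
  also have "\<dots> \<le> (\<Sum>A\<in>P. measure \<mu> (?D A))"
    using Dm finite_P by (intro finite_measure_subadditive_finite) auto
  also have "\<dots> \<le> (\<Sum>A\<in>P. \<delta> / card P)" using nB by (intro sum_mono less_imp_le)
  also have "\<dots> = \<delta>" using cP by simp
  finally show ?thesis using that by blast
qed

end

lemma tendsto_ln_polynomial_over_n: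
  "(\<lambda>n. (ln C + real d * ln (real (n + N) + 2)) / real n) \<longlonglongrightarrow> 0"
proof -
  have 1: "(\<lambda>n. ln (real n) / real n) \<longlonglongrightarrow> 0" by (rule lim_ln_over_n)
  have "(\<lambda>n. ln (real (n + (N + 2))) / real (n + (N + 2))) \<longlonglongrightarrow> 0"
    using LIMSEQ_ignore_initial_segment[OF 1, of "N + 2"] by simp
  moreover have "(\<lambda>n. 1 + real (N + 2) * (1 / real n)) \<longlonglongrightarrow> 1 + real (N + 2) * 0"
    by (intro tendsto_intros lim_1_over_n)
  ultimately have "(\<lambda>n. ln (real (n + (N + 2))) / real (n + (N + 2)) * (1 + real (N + 2) * (1 / real n))) \<longlonglongrightarrow> 0 * (1 + real (N + 2) * 0)"
    by (rule tendsto_mult)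
  moreover have "eventually (\<lambda>n. ln (real (n + (N + 2))) / real (n + (N + 2)) * (1 + real (N + 2) * (1 / real n)) =
     ln (real (n + N) + 2) / real n) sequentially"
    using eventually_gt_at_top[of 0]
  proof eventually_elim
    case (elim n)
    have "1 + real (N + 2) * (1 / real n) = real (n + (N + 2)) / real n"
      using elim by (simp add: field_simps)
    then show ?case using elim by (simp add: add_ac)
  qed
  ultimately have 2: "(\<lambda>n. ln (real (n + N) + 2) / real n) \<longlonglongrightarrow> 0"
    by (simp add: tendsto_cong)
  have "(\<lambda>n. ln C * (1 / real n) + real d * (ln (real (n + N) + 2) / real n)) \<longlonglongrightarrow> ln C * 0 + real d * 0"
    by (intro tendsto_intros lim_1_over_n 2)
  then show ?thesis by (simp add: add_divide_distrib)
qed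

context inv_partition
begin

text \<open>After division by n the polynomial total weight and the \<open>N\<close> extra letters
  disappear; what remains besides the integral is the cost of guessing, made smaller than e.\<close>

lemma entropy_wrt_le:
  fixes W :: "bool list \<Rightarrow> real" and \<psi> :: "seq \<Rightarrow> real"
  assumes W: "\<And>y. W y > 0"
    and \<psi>: "integrable \<mu> \<psi>"
    and W\<psi>: "\<And>x n. - ln (W (pre x n)) \<le> (\<Sum>k<n. \<psi> ((shift ^^ k) x))"
    and Z: "\<And>n. n \<ge> 1 \<Longrightarrow> (\<Sum>y\<in>{y. length y = n}. W y) \<le> C * (real n + 2) ^ d"
    and C: "C > 0"
  shows "entropy_wrt shift \<mu> P \<le> (\<integral>x. \<psi> x \<partial>\<mu>)"
proof (rule field_le_epsilon)
  fix e :: real assume e: "e > 0"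
  \<comment> \<open>A correct guess costs e / 2. The price \<open>K\<close> of a wrong one depends
    on \<eta>, so \<eta> is fixed first and the guess is made accurate relative to \<open>K\<close>
    afterwards.\<close>
  define \<eta> where "\<eta> = 1 - exp (- (e / 2))"
  have \<eta>: "0 < \<eta>" "\<eta> < 1" "- ln (1 - \<eta>) = e / 2" using e by (auto simp: \<eta>_def)
  define K where "K = - ln (\<eta> / card P)"
  have Pne: "P \<noteq> {}" using cell(1) by auto
  then have cP: "real (card P) \<ge> 1" using finite_P by (simp add: Suc_le_eq card_gt_0_iff)
  have K0: "K \<ge> 0" using \<eta> cP by (simp add: K_def divide_simps)
  have "e / (2 * (K + 1)) > 0" using e K0 by simp
  then obtain N c where Nc: "measure \<mu> {x. cell x \<noteq> c (pre x N)} \<le> e / (2 * (K + 1))"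
    by (rule guess_exists)
  let ?D = "{x. cell x \<noteq> c (pre x N)}"
  have KD: "K * measure \<mu> ?D \<le> e / 2"
  proof -
    have "K * measure \<mu> ?D \<le> (K + 1) * (e / (2 * (K + 1)))"
      using Nc K0 by (intro mult_mono) auto
    also have "\<dots> = e / 2"
    proof -
      have "2 * K + 2 \<noteq> 0" using K0 by simp
      then show ?thesis by (simp add: field_simps)
    qed
    finally show ?thesis .
  qed
  let ?I = "\<integral>x. \<psi> x \<partial>\<mu>"
  let ?u = "\<lambda>n. (ln C + real d * ln (real (n + N) + 2)) / real n + (1 + real N * (1 / real n)) * ?I + e"
  have "?u \<longlonglongrightarrow> 0 + (1 + real N * 0) * ?I + e"
    by (intro tendsto_intros tendsto_ln_polynomial_over_n lim_1_over_n)
  then have u: "?u \<longlonglongrightarrow> ?I + e" by simp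
  have "block_entropy n / real n \<le> ?u n" if n: "n \<ge> 1" for n
  proof -
    have "(\<Sum>y\<in>{y. length y = n + N}. W y) > 0"
      using W finite_words by (intro sum_pos) (auto intro: exI[of _ "replicate (n + N) True"])
    then have "ln (\<Sum>y\<in>{y. length y = n + N}. W y) \<le> ln (C * (real (n + N) + 2) ^ d)"
      using Z[of "n + N"] n C by simp
    also have "\<dots> = ln C + real d * ln (real (n + N) + 2)"
      using C by (simp add: ln_mult ln_realpow)
    finally have lnZ: "ln (\<Sum>y\<in>{y. length y = n + N}. W y) \<le> ln C + real d * ln (real (n + N) + 2)" .
    have "block_entropy n \<le> ln C + real d * ln (real (n + N) + 2) + real (n + N) * ?I + real n * (e / 2) + real n * (e / 2)"
      using block_entropy_le[OF W \<psi> W\<psi> \<eta>(1,2), of n N c] lnZ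
        mult_left_mono[OF KD, of "real n"] unfolding \<eta>(3) K_def by linarith
    then have "block_entropy n / real n \<le> (ln C + real d * ln (real (n + N) + 2) + real (n + N) * ?I + real n * (e / 2) + real n * (e / 2)) / real n"
      using n by (intro divide_right_mono) auto
    also have "\<dots> = ?u n" using n by (simp add: field_simps)
    finally show ?thesis .
  qed
  then show "entropy_wrt shift \<mu> P \<le> ?I + e"
    by (intro LIMSEQ_le[OF entropy_limit u]) (auto intro: exI[of _ 1])
qed

end

text \<open>The majorant \<psi> will be a multiple of the continuous function \<phi>, whose
  integrability is immediate.\<close>

lemma kolmogorov_entropy_le:
  assumes "invariant_prob \<mu>" "integrable \<mu> \<psi>" "\<And>x. 16 * phi0 TM x \<le> \<psi> x"
  shows "kolmogorov_entropy shift \<mu> \<le> ereal (\<integral>x. \<psi> x \<partial>\<mu>)"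
  unfolding kolmogorov_entropy_def
proof (rule SUP_least)
  fix P assume "P \<in> {P. finite_partition \<mu> P}"
  then interpret inv_partition \<mu> P
    using assms(1) by unfold_locales auto
  have "- ln (weight (pre x n)) \<le> (\<Sum>k<n. \<psi> ((shift ^^ k) x))" for x n
  proof -
    have "- ln (weight (pre x n)) \<le> (\<Sum>k<n. 16 * phi0 TM ((shift ^^ k) x))"
      using weight_pre_le by (simp add: sum_distrib_left)
    also have "\<dots> \<le> (\<Sum>k<n. \<psi> ((shift ^^ k) x))" by (intro sum_mono assms(3))
    finally show ?thesis .
  qed
  then show "ereal (entropy_wrt shift \<mu> P) \<le> ereal (\<integral>x. \<psi> x \<partial>\<mu>)"
    using entropy_wrt_le[OF weight_pos assms(2) _ weight_sum_polynomial] by simp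
qed

lemma kolmogorov_entropy_nonneg:
  assumes "invariant_prob \<mu>"
  shows "kolmogorov_entropy shift \<mu> \<ge> 0"
proof -
  interpret inv_measure \<mu> using assms by unfold_locales
  have fp: "finite_partition \<mu> {UNIV}"
    by (simp add: finite_partition_def partition_on_def disjoint_def)
  interpret inv_partition \<mu> "{UNIV}" by unfold_locales (rule fp)
  have "entropy_wrt shift \<mu> {UNIV} \<ge> 0"
    using entropy_limit by (rule LIMSEQ_le_const) (auto simp: block_entropy_nonneg)
  then have "0 \<le> ereal (entropy_wrt shift \<mu> {UNIV})" by simp
  also have "\<dots> \<le> kolmogorov_entropy shift \<mu>"
    unfolding kolmogorov_entropy_def using fp by (intro SUP_upper) auto
  finally show ?thesis .
qed

section \<open>The invariant measure on the subshift\<close>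

text \<open>Occurrences are counted by their starting letter, so the empty word occurs
  \<open>length u\<close> times; this gives \<open>freq [] = 1\<close>.\<close>

fun occ :: "bool list \<Rightarrow> bool list \<Rightarrow> nat" where
  "occ w [] = 0"
| "occ w (a # u) = (if prefix w (a # u) then 1 else 0) + occ w u"

lemma occ_append_ge: "occ w u + occ w v \<le> occ w (u @ v)"
proof (induction u)
  case (Cons a u)
  have "prefix w (a # u) \<Longrightarrow> prefix w (a # u @ v)" by (metis append_Cons prefix_prefix)
  then show ?case using Cons by auto
qed simp

lemma occ_append_le: "occ w (u @ v) \<le> occ w u + occ w v + min (length u) (length w)"
proof (induction u)
  case (Cons a u)
  have "prefix w (a # u @ v) \<Longrightarrow> length w \<le> length (a # u) \<Longrightarrow> prefix w (a # u)"
    by (metis append_Cons prefixI prefix_length_prefix)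
  then show ?case using Cons by (auto simp: min_def split: if_splits)
qed simp

lemma occ_le_length: "occ w u \<le> length u"
  by (induction u) auto

lemma occ_Nil: "occ [] u = length u"
  by (induction u) auto

lemma occ_short: "length u < length w \<Longrightarrow> occ w u = 0"
  by (induction u) (auto dest: prefix_length_le)

lemma occ_notin_lang: "w \<notin> lang \<Longrightarrow> u \<in> lang \<Longrightarrow> occ w u = 0"
proof (induction u)
  case (Cons a u)
  have "\<not> prefix w (a # u)" using Cons.prems lang_appendD1 by (auto simp: prefix_def)
  then show ?case using Cons lang_appendD2[of "[a]" u] by simp
qed simp

text \<open>Every occurrence of \<open>w\<close> can be prolonged by a letter except possibly the
  one at the right end of \<open>u\<close>.\<close>

lemma occ_snoc:
  "occ (w @ [False]) u + occ (w @ [True]) u \<le> occ w u \<and>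
   occ w u \<le> occ (w @ [False]) u + occ (w @ [True]) u + 1"
proof (induction u)
  case (Cons a u)
  consider "length (a # u) < length w" | "length (a # u) = length w" | "length w < length (a # u)"
    by linarith
  then show ?case
  proof cases
    case 1
    then have "occ w (a # u) = 0" "occ (w @ [False]) (a # u) = 0" "occ (w @ [True]) (a # u) = 0"
      by (auto simp del: occ.simps intro!: occ_short)
    then show ?thesis by simp
  next
    case 2
    then have "occ w u = 0" "occ (w @ [False]) (a # u) = 0" "occ (w @ [True]) (a # u) = 0"
      by (auto simp del: occ.simps intro!: occ_short)
    then show ?thesis by simp
  next
    case 3
    have "prefix w (a # u) \<longleftrightarrow> prefix (w @ [False]) (a # u) \<or> prefix (w @ [True]) (a # u)"
    proof
      assume "prefix w (a # u)"
      then obtain z where "a # u = w @ z" by (auto simp: prefix_def)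
      with 3 obtain b z' where "a # u = (w @ [b]) @ z'" by (cases z) auto
      then have "prefix (w @ [b]) (a # u)" by (metis prefixI)
      then show "prefix (w @ [False]) (a # u) \<or> prefix (w @ [True]) (a # u)" by (cases b) auto
    qed (auto dest: append_prefixD)
    moreover have "\<not> (prefix (w @ [False]) (a # u) \<and> prefix (w @ [True]) (a # u))"
    proof
      assume "prefix (w @ [False]) (a # u) \<and> prefix (w @ [True]) (a # u)"
      then obtain z z' where "a # u = (w @ [False]) @ z" "a # u = (w @ [True]) @ z'"
        unfolding prefix_def by blast
      then have "w @ False # z = w @ True # z'" by (simp only: append.assoc append_Cons append_Nil)
      then show False by simp
    qed
    ultimately show ?thesis using Cons by auto
  qed
qed simp

lemma occ_Cons:
  "w \<noteq> [] \<Longrightarrow> occ w u = occ (False # w) u + occ (True # w) u + (if prefix w u then 1 else 0)"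
  by (induction u) auto

text \<open>The images of both letters under \<open>theta ^^ n\<close> consist of the same two
  halves in opposite order, so the counts differ only by occurrences across the middle.\<close>

lemma occ_pow_diff:
  "\<bar>real (occ w ((theta ^^ n) [a])) - real (occ w ((theta ^^ n) [b]))\<bar> \<le> length w"
proof (cases n)
  case 0
  then show ?thesis by (cases w) (auto simp: Cons_prefix_Cons)
next
  case (Suc m)
  have *: "(theta ^^ Suc m) [x] = (theta ^^ m) [x] @ (theta ^^ m) [\<not> x]" for x
  proof -
    have "(theta ^^ Suc m) [x] = (theta ^^ m) ([x] @ [\<not> x])" by (simp add: funpow_swap1)
    then show ?thesis by (simp only: theta_pow_append)
  qed
  define S where "S = occ w ((theta ^^ m) [False]) + occ w ((theta ^^ m) [True])"
  have "S \<le> occ w ((theta ^^ n) [x]) \<and> occ w ((theta ^^ n) [x]) \<le> S + length w" for x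
    unfolding Suc * S_def
    using occ_append_ge[of w "(theta ^^ m) [x]" "(theta ^^ m) [\<not> x]"]
      occ_append_le[of w "(theta ^^ m) [x]" "(theta ^^ m) [\<not> x]"] by (cases x) auto
  from this[of a] this[of b] show ?thesis by linarith
qed

lemma occ_pow_Suc:
  "\<bar>real (occ w ((theta ^^ Suc n) [False])) - 2 * real (occ w ((theta ^^ n) [False]))\<bar> \<le> 2 * real (length w)"
proof -
  have "(theta ^^ Suc n) [False] = (theta ^^ n) ([False] @ [True])" by (simp add: funpow_swap1)
  then have *: "(theta ^^ Suc n) [False] = (theta ^^ n) [False] @ (theta ^^ n) [True]"
    by (simp only: theta_pow_append)
  show ?thesis
    using occ_append_ge[of w "(theta ^^ n) [False]" "(theta ^^ n) [True]"]
      occ_append_le[of w "(theta ^^ n) [False]" "(theta ^^ n) [True]"]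
      occ_pow_diff[of w n True False] unfolding * by linarith
qed

text \<open>The normalized counts \<open>s n\<close> move by at most c / 2^(n+1), so the intervals
  of radius c / 2^n around them are nested and shrink to l. This gives the error c = 2 |w| for the
  letter 0, and exchanging letters costs another |w|.\<close>

lemma freq_exists: "\<exists>l. \<forall>n a. \<bar>real (occ w ((theta ^^ n) [a])) - l * 2 ^ n\<bar> \<le> 3 * real (length w)"
proof -
  define c where "c = 2 * real (length w)"
  define s where "s n = real (occ w ((theta ^^ n) [False])) / 2 ^ n" for n
  have step: "\<bar>s (Suc n) - s n\<bar> \<le> c / 2 ^ Suc n" for n
  proof -
    have "s (Suc n) - s n = (real (occ w ((theta ^^ Suc n) [False])) - 2 * real (occ w ((theta ^^ n) [False]))) / 2 ^ Suc n"
      by (simp add: s_def field_simps)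
    then have "\<bar>s (Suc n) - s n\<bar> = \<bar>real (occ w ((theta ^^ Suc n) [False])) - 2 * real (occ w ((theta ^^ n) [False]))\<bar> / 2 ^ Suc n"
      by (simp only: abs_divide power_abs abs_numeral)
    also have "\<dots> \<le> c / 2 ^ Suc n"
      unfolding c_def using occ_pow_Suc[of w n] by (intro divide_right_mono) auto
    finally show ?thesis .
  qed
  have "\<exists>l. ((\<forall>n. s n - c / 2 ^ n \<le> l) \<and> (\<lambda>n. s n - c / 2 ^ n) \<longlonglongrightarrow> l) \<and>
      ((\<forall>n. l \<le> s n + c / 2 ^ n) \<and> (\<lambda>n. s n + c / 2 ^ n) \<longlonglongrightarrow> l)"
  proof (rule nested_sequence_unique)
    have *: "c / 2 ^ n = 2 * (c / 2 ^ Suc n)" for n by simp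
    show "\<forall>n. s n - c / 2 ^ n \<le> s (Suc n) - c / 2 ^ Suc n"
      using step * by (smt (verit))
    show "\<forall>n. s (Suc n) + c / 2 ^ Suc n \<le> s n + c / 2 ^ n"
      using step * by (smt (verit))
    show "\<forall>n. s n - c / 2 ^ n \<le> s n + c / 2 ^ n" by (simp add: c_def)
    have "(\<lambda>n. (- 2 * c) * (1 / 2) ^ n) \<longlonglongrightarrow> (- 2 * c) * 0"
      by (intro tendsto_intros LIMSEQ_realpow_zero) auto
    then show "(\<lambda>n. (s n - c / 2 ^ n) - (s n + c / 2 ^ n)) \<longlonglongrightarrow> 0"
      by (simp add: power_divide)
  qed
  then obtain l where l: "\<And>n. s n - c / 2 ^ n \<le> l" "\<And>n. l \<le> s n + c / 2 ^ n" by blast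
  have "\<bar>real (occ w ((theta ^^ n) [a])) - l * 2 ^ n\<bar> \<le> 3 * real (length w)" for n a
  proof -
    have "s n * 2 ^ n - c \<le> l * 2 ^ n" "l * 2 ^ n \<le> s n * 2 ^ n + c"
      using mult_right_mono[OF l(1)[of n], of "2 ^ n"] mult_right_mono[OF l(2)[of n], of "2 ^ n"]
      by (simp_all add: algebra_simps)
    moreover have "s n * 2 ^ n = real (occ w ((theta ^^ n) [False]))" by (simp add: s_def)
    ultimately show ?thesis using occ_pow_diff[of w n a False] by (simp add: c_def)
  qed
  then show ?thesis by blast
qed

definition freq :: "bool list \<Rightarrow> real" where
  "freq w = (SOME l. \<forall>n a. \<bar>real (occ w ((theta ^^ n) [a])) - l * 2 ^ n\<bar> \<le> 3 * real (length w))"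

lemma freq: "\<bar>real (occ w ((theta ^^ n) [a])) - freq w * 2 ^ n\<bar> \<le> 3 * real (length w)"
  using someI_ex[OF freq_exists[of w]] unfolding freq_def by blast

text \<open>Turns linear relations between occurrence numbers that hold up to a bounded error into
  exact relations between frequencies.\<close>

lemma bounded_pow_eq_0:
  fixes x :: real
  assumes "\<And>n. \<bar>x * 2 ^ n\<bar> \<le> C"
  shows "x = 0"
proof (rule ccontr)
  assume "x \<noteq> 0"
  obtain n where "C / \<bar>x\<bar> < 2 ^ n" using real_arch_pow[of 2 "C / \<bar>x\<bar>"] by auto
  then have "C < \<bar>x * 2 ^ n\<bar>" using \<open>x \<noteq> 0\<close> by (simp add: divide_simps abs_mult mult.commute)
  then show False using assms[of n] by simp
qed

lemma freq_nonneg: "freq w \<ge> 0"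
proof (rule ccontr)
  assume "\<not> freq w \<ge> 0"
  then have neg: "freq w < 0" by simp
  have "\<bar>freq w * 2 ^ n\<bar> \<le> 3 * real (length w)" for n
  proof -
    have "freq w * 2 ^ n \<le> 0" using neg by (simp add: mult_nonpos_nonneg)
    then show ?thesis using freq[of w n False] by linarith
  qed
  then show False using bounded_pow_eq_0 neg by force
qed

lemma freq_Nil: "freq [] = 1"
proof -
  have "\<bar>(freq [] - 1) * 2 ^ n\<bar> \<le> 0" for n
    using freq[of "[]" n False] by (simp add: occ_Nil algebra_simps)
  then show ?thesis using bounded_pow_eq_0[of "freq [] - 1" 0] by simp
qed

lemma freq_notin_lang: "w \<notin> lang \<Longrightarrow> freq w = 0"
proof -
  assume "w \<notin> lang"
  then have "\<bar>freq w * 2 ^ n\<bar> \<le> 3 * real (length w)" for n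
    using freq[of w n False] occ_notin_lang[OF _ lang_theta_powI[of n False]] by simp
  then show ?thesis by (rule bounded_pow_eq_0)
qed

lemma freq_snoc: "freq w = freq (w @ [False]) + freq (w @ [True])"
proof -
  \<comment> \<open>3 |w| and twice 3 (|w| + 1) come from \<open>freq\<close>, and 1 from
    \<open>occ_snoc\<close>.\<close>
  have "\<bar>(freq w - freq (w @ [False]) - freq (w @ [True])) * 2 ^ n\<bar> \<le> 9 * real (length w) + 7" for n
    using freq[of w n False] freq[of "w @ [False]" n False] freq[of "w @ [True]" n False]
      occ_snoc[of w "(theta ^^ n) [False]"]
    unfolding left_diff_distrib by simp linarith
  then show ?thesis using bounded_pow_eq_0[of "freq w - freq (w @ [False]) - freq (w @ [True])"] by force
qed

lemma freq_Cons: "freq w = freq (False # w) + freq (True # w)"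
proof (cases "w = []")
  case True
  then show ?thesis using freq_snoc[of "[]"] by simp
next
  case False
  have "\<bar>(freq w - freq (False # w) - freq (True # w)) * 2 ^ n\<bar> \<le> 9 * real (length w) + 7" for n
    using freq[of w n False] freq[of "False # w" n False] freq[of "True # w" n False]
      occ_Cons[OF False, of "(theta ^^ n) [False]"]
    unfolding left_diff_distrib by (simp split: if_splits)
  then show ?thesis using bounded_pow_eq_0[of "freq w - freq (False # w) - freq (True # w)"] by force
qed

lemma freq_le_1: "freq w \<le> 1"
proof (induction w rule: rev_induct)
  case (snoc a w)
  then show ?case using freq_snoc[of w] freq_nonneg[of "w @ [False]"] freq_nonneg[of "w @ [True]"]
    by (cases a) auto
qed (simp add: freq_Nil)

section \<open>Uniform frequencies in all factors\<close>

lemma occ_pow_word: "\<bar>real (occ w ((theta ^^ n) V)) - freq w * 2 ^ n * length V\<bar> \<le> 4 * real (length w) * length V"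
proof (induction V)
  case (Cons a V)
  have eq: "(theta ^^ n) (a # V) = (theta ^^ n) [a] @ (theta ^^ n) V"
    using theta_pow_append[of n "[a]" V] by simp
  have "\<bar>real (occ w ((theta ^^ n) (a # V))) - real (occ w ((theta ^^ n) [a])) - real (occ w ((theta ^^ n) V))\<bar> \<le> length w"
    unfolding eq using occ_append_ge[of w "(theta ^^ n) [a]" "(theta ^^ n) V"]
      occ_append_le[of w "(theta ^^ n) [a]" "(theta ^^ n) V"] by linarith
  moreover have "freq w * 2 ^ n * length (a # V) = freq w * 2 ^ n + freq w * 2 ^ n * length V"
    "4 * real (length w) * length (a # V) = 4 * real (length w) + 4 * real (length w) * length V"
    by (simp_all add: algebra_simps)
  ultimately show ?case using Cons freq[of w n a] by linarith
qed simp

text \<open>Up to two ends shorter than 2^n, \<open>u\<close> is an image under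
  \<open>theta ^^ n\<close> of about |u| / 2^n letters, each causing an error of at most 4 |w|.
  Choosing \<open>n\<close> large first and \<open>u\<close> long afterwards makes the relative
  error small.\<close>

lemma occ_lang:
  assumes "u \<in> lang"
  shows "\<bar>real (occ w u) - freq w * length u\<bar> \<le>
    4 * real (length w) / 2 ^ n * length u + (10 * real (length w) + 4 * 2 ^ n)"
proof -
  obtain V p s where V: "(theta ^^ n) V = p @ u @ s" "length p < 2 ^ n" "length s < 2 ^ n"
    using desubst_pow_trim[OF assms] by metis
  define v where "v = real (length V)"
  have len: "2 ^ n * v = real (length p) + real (length u) + real (length s)"
    using arg_cong[OF V(1), of "\<lambda>x. real (length x)"] by (simp add: v_def)
  have ps: "real (length p) < 2 ^ n" "real (length s) < 2 ^ n"
    using V(2,3) by (simp_all only: of_nat_less_iff of_nat_power of_nat_numeral flip: of_nat_less_iff[where 'a=real])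
  have 1: "\<bar>real (occ w (p @ u @ s)) - freq w * (2 ^ n * v)\<bar> \<le> 4 * real (length w) * v"
    using occ_pow_word[of w n V] by (simp add: V(1) v_def mult.assoc)
  have 2: "real (occ w u) \<le> real (occ w (p @ u @ s))"
    using occ_append_ge[of w p "u @ s"] occ_append_ge[of w u s] by linarith
  have 3: "real (occ w (p @ u @ s)) \<le> real (occ w u) + real (length p) + real (length s) + 2 * real (length w)"
    using occ_append_le[of w p "u @ s"] occ_append_le[of w u s] occ_le_length[of w p] occ_le_length[of w s]
    by linarith
  have 4: "freq w * length u \<le> freq w * (2 ^ n * v)"
    using freq_nonneg len by (intro mult_left_mono) auto
  have 5: "freq w * (2 ^ n * v) \<le> freq w * length u + 2 * 2 ^ n"
  proof -
    have "freq w * (real (length p) + real (length s)) \<le> 1 * (real (length p) + real (length s))"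
      using freq_le_1 by (intro mult_right_mono) auto
    then show ?thesis unfolding len using ps by (simp only: distrib_left mult_1)
  qed
  have "2 ^ n * v \<le> real (length u) + 2 * 2 ^ n" using len ps by linarith
  then have "v \<le> real (length u) / 2 ^ n + 2" by (simp add: field_simps)
  then have "4 * real (length w) * v \<le> 4 * real (length w) * (length u / 2 ^ n + 2)"
    by (intro mult_left_mono) auto
  then have 6: "4 * real (length w) * v \<le> 4 * real (length w) / 2 ^ n * length u + 8 * real (length w)"
    by (simp add: algebra_simps)
  show ?thesis using 1 2 3 4 5 6 ps by linarith
qed

lemma freq_uniform:
  fixes \<epsilon> :: real
  assumes "\<epsilon> > 0"
  obtains M where "\<And>u. u \<in> lang \<Longrightarrow> M \<le> length u \<Longrightarrow> \<bar>real (occ w u) - freq w * length u\<bar> \<le> \<epsilon> * length u"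
proof -
  obtain n where n: "8 * real (length w) / \<epsilon> < 2 ^ n" using real_arch_pow[of 2 "8 * real (length w) / \<epsilon>"] by auto
  then have n': "4 * real (length w) / 2 ^ n \<le> \<epsilon> / 2" using assms by (simp add: divide_simps mult_ac)
  define C where "C = 10 * real (length w) + 4 * 2 ^ n"
  obtain M where M: "2 * C / \<epsilon> < real M" using reals_Archimedean2 by blast
  have "\<bar>real (occ w u) - freq w * length u\<bar> \<le> \<epsilon> * length u" if u: "u \<in> lang" "M \<le> length u" for u
  proof -
    have "2 * C / \<epsilon> < real (length u)" using M u(2) by linarith
    then have "C \<le> \<epsilon> / 2 * length u" using assms by (simp add: divide_simps mult_ac)
    moreover have "4 * real (length w) / 2 ^ n * length u \<le> \<epsilon> / 2 * length u"
      using n' by (intro mult_right_mono) auto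
    ultimately show ?thesis using occ_lang[OF u(1), of w n] unfolding C_def by linarith
  qed
  then show ?thesis using that by blast
qed

text \<open>The Birkhoff sum also counts occurrences that start among the first \<open>n\<close>
  letters and reach beyond them.\<close>

lemma sum_indicator_cyl:
  "real (occ w (pre x n)) \<le> (\<Sum>k<n. indicator (cyl w) ((shift ^^ k) x)) \<and>
   (\<Sum>k<n. indicator (cyl w) ((shift ^^ k) x)) \<le> real (occ w (pre x n)) + real (min n (length w))"
proof (induction n arbitrary: x)
  case 0
  then show ?case by (simp add: pre_def)
next
  case (Suc n)
  have S: "(\<Sum>k<Suc n. indicator (cyl w) ((shift ^^ k) x) :: real) =
      indicator (cyl w) x + (\<Sum>k<n. indicator (cyl w) ((shift ^^ k) (shift x)))"
    by (subst sum.lessThan_Suc_shift) (simp add: funpow_swap1)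
  have O: "occ w (pre x (Suc n)) = (if prefix w (pre x (Suc n)) then 1 else 0) + occ w (pre (shift x) n)"
    by (simp add: pre_Suc)
  have p: "prefix w (pre x (Suc n)) \<longleftrightarrow> length w \<le> Suc n \<and> x \<in> cyl w"
  proof -
    have "prefix w (pre x (Suc n)) \<longleftrightarrow> length w \<le> Suc n \<and> take (length w) (pre x (Suc n)) = w"
      by (metis append_eq_conv_conj length_pre prefix_def prefix_length_le take_is_prefix)
    then show ?thesis by (auto simp: take_pre min_def cyl_def)
  qed
  have i: "(indicator (cyl w) x :: real) = (if x \<in> cyl w then 1 else 0)" by simp
  show ?case
  proof (cases "length w \<le> Suc n")
    case True
    have "real (min n (length w)) \<le> real (min (Suc n) (length w))" by simp
    then show ?thesis using Suc[of "shift x"] True unfolding S O p i by (auto simp del: of_nat_min)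
  next
    case False
    have "real (min (Suc n) (length w)) = real (min n (length w)) + 1" using False by simp
    then show ?thesis using Suc[of "shift x"] False unfolding S O p i by (auto simp del: of_nat_min)
  qed
qed

lemma cyl_sets: "cyl w \<in> sets borel"
  using open_cyl by (rule borel_open)

lemma TM_sets: "TM \<in> sets borel"
  using closed_TM by (rule borel_closed)

text \<open>By invariance the Birkhoff sum of the cylinder has integral n times its measure, and on
  \<open>TM\<close> it is uniformly within e n of n times the frequency. Integrating this uniform
  estimate gives the value directly.\<close>

lemma (in inv_measure) measure_cyl:
  assumes "supported_on \<mu> TM"
  shows "measure \<mu> (cyl w) = freq w"
proof -
  have "AE x in \<mu>. x \<in> TM"
    using assms TM_sets by (intro AE_in_set_eq_1[THEN iffD2]) (auto simp: supported_on_def measure_def)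
  have ic: "integrable \<mu> (indicator (cyl w) :: seq \<Rightarrow> real)"
    using cyl_sets by (auto simp: integrable_indicator_iff less_top[symmetric])
  define S where "S n x = (\<Sum>k<n. indicator (cyl w) ((shift ^^ k) x) :: real)" for n x
  have iS: "integrable \<mu> (S n)" for n
    unfolding S_def using integral_shift_pow[OF ic] by auto
  have IS: "(\<integral>x. S n x \<partial>\<mu>) = real n * measure \<mu> (cyl w)" for n
  proof -
    have "(\<integral>x. S n x \<partial>\<mu>) = (\<Sum>k<n. \<integral>x. indicator (cyl w) ((shift ^^ k) x) \<partial>\<mu>)"
      unfolding S_def using integral_shift_pow[OF ic] by (intro Bochner_Integration.integral_sum) auto
    also have "\<dots> = (\<Sum>k<n. measure \<mu> (cyl w))"
      using integral_shift_pow[OF ic] cyl_sets by (intro sum.cong) auto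
    finally show ?thesis by simp
  qed
  have "\<bar>measure \<mu> (cyl w) - freq w\<bar> \<le> e" if e: "e > 0" for e
  proof -
    have "e / 2 > 0" using e by simp
    then obtain M where M: "\<And>u. u \<in> lang \<Longrightarrow> M \<le> length u \<Longrightarrow>
        \<bar>real (occ w u) - freq w * length u\<bar> \<le> e / 2 * length u"
      using freq_uniform by blast
    obtain n0 where n0: "2 * real (length w) / e < real n0" using reals_Archimedean2 by blast
    define n where "n = max (max M n0) 1"
    have n: "M \<le> n" "n0 \<le> n" "n \<ge> 1" by (auto simp: n_def)
    have "2 * real (length w) / e < real n" using n0 n(2) by linarith
    then have lw: "real (length w) \<le> e / 2 * n" using e by (simp add: divide_simps mult_ac)
    have b: "\<bar>S n x - freq w * n\<bar> \<le> e * n" if "x \<in> TM" for x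
    proof -
      have "\<bar>real (occ w (pre x n)) - freq w * n\<bar> \<le> e / 2 * n"
        using M[of "pre x n"] that n(1) TM_iff by simp
      moreover have "real (min n (length w)) \<le> real (length w)" by simp
      ultimately show ?thesis
        using sum_indicator_cyl[of w x n] lw unfolding S_def[symmetric] by linarith
    qed
    have "(\<integral>x. S n x \<partial>\<mu>) \<le> (\<integral>x. freq w * n + e * n \<partial>\<mu>)"
      using \<open>AE x in \<mu>. x \<in> TM\<close> b iS
      by (intro integral_mono_AE) (auto elim!: eventually_mono simp: abs_le_iff algebra_simps)
    moreover have "(\<integral>x. freq w * n - e * n \<partial>\<mu>) \<le> (\<integral>x. S n x \<partial>\<mu>)"
      using \<open>AE x in \<mu>. x \<in> TM\<close> b iS
      by (intro integral_mono_AE) (auto elim!: eventually_mono simp: abs_le_iff algebra_simps)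
    ultimately have "\<bar>real n * measure \<mu> (cyl w) - real n * freq w\<bar> \<le> real n * e"
      using prob_space unfolding IS by (simp add: abs_le_iff algebra_simps)
    then have "real n * \<bar>measure \<mu> (cyl w) - freq w\<bar> \<le> real n * e"
      by (simp add: abs_mult right_diff_distrib[symmetric])
    then show ?thesis using n(3) by simp
  qed
  then have "\<bar>measure \<mu> (cyl w) - freq w\<bar> \<le> 0" by (rule field_le_epsilon) simp
  then show ?thesis by simp
qed

section \<open>Measures determined by their values on cylinders\<close>

lemma measure_pre:
  assumes "prob_space M" "sets M = sets borel"
  shows "measure M {x. pre x n \<in> B} = (\<Sum>w\<in>{w \<in> B. length w = n}. measure M (cyl w))"
proof -
  interpret prob_space M by fact
  have "finite {w \<in> B. length w = n}" by (rule finite_subset[OF _ finite_words[of n]]) auto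
  moreover have "disjoint_family_on cyl {w \<in> B. length w = n}"
    by (auto simp: disjoint_family_on_def cyl_def)
  moreover have "{x. pre x n \<in> B} = (\<Union>w\<in>{w \<in> B. length w = n}. cyl w)" by (auto simp: cyl_def)
  ultimately show ?thesis
    using finite_measure_finite_Union[of "{w \<in> B. length w = n}" cyl] cyl_sets assms(2) by auto
qed

lemma prob_eqI_cyl:
  assumes "prob_space M" "sets M = sets borel" "prob_space N" "sets N = sets borel"
    and "\<And>w. measure M (cyl w) = measure N (cyl w)"
  shows "M = N"
proof (rule measure_eqI_generator_eq[OF Int_stable_pre])
  interpret M: prob_space M by fact
  interpret N: prob_space N by fact
  show "emeasure M X = emeasure N X" if "X \<in> {{x. pre x n \<in> B} | n B. True}" for X
    using that measure_pre[OF assms(1,2)] measure_pre[OF assms(3,4)] assms(5)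
    by (auto simp: M.emeasure_eq_measure N.emeasure_eq_measure)
  show "sets M = sigma_sets UNIV {{x. pre x n \<in> B} | n B. True}" "sets N = sigma_sets UNIV {{x. pre x n \<in> B} | n B. True}"
    using assms sets_borel_seq by simp_all
  show "range (\<lambda>i. UNIV) \<subseteq> {{x :: seq. pre x n \<in> B} | n B. True}" by (auto intro: exI[of _ UNIV])
  show "emeasure M UNIV \<noteq> \<infinity>" by simp
qed auto

text \<open>The interval \<open>[0, 1)\<close> is subdivided successively in proportion to the weights \<open>m\<close>.\<close>

lemma measure_from_cylinders:
  fixes m :: "bool list \<Rightarrow> real"
  assumes m0: "\<And>w. m w \<ge> 0" and m1: "m [] = 1"
    and madd: "\<And>w. m w = m (w @ [False]) + m (w @ [True])"
  obtains M where "prob_space M" "sets M = sets (borel :: seq measure)" "\<And>w. measure M (cyl w) = m w"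
proof -
  \<comment> \<open>The left end of the interval of \<open>w\<close>: the total mass of the words of
    the same length that precede it lexicographically.\<close>
  define L where "L w = (\<Sum>i<length w. if w ! i then m (take i w @ [False]) else 0)" for w
  have L_snoc: "L (w @ [c]) = L w + (if c then m (w @ [False]) else 0)" for w c
    by (auto simp: L_def nth_append intro!: sum.cong)
  have range: "0 \<le> L w \<and> L w + m w \<le> 1" for w
  proof (induction w rule: rev_induct)
    case Nil
    then show ?case by (simp add: L_def m1)
  next
    case (snoc c w)
    then show ?case using madd[of w] m0[of "w @ [False]"] m0[of "w @ [True]"]
      by (cases c) (auto simp: L_snoc)
  qed
  \<comment> \<open>The word of length n whose interval contains \<open>u\<close>.\<close>
  define st where "st u n = rec_nat [] (\<lambda>_ w. w @ [\<not> u < L w + m (w @ [False])]) n" for u :: real and n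
  have st_0: "st u 0 = []" and st_Suc: "st u (Suc n) = st u n @ [\<not> u < L (st u n) + m (st u n @ [False])]" for u n
    by (simp_all add: st_def)
  have len: "length (st u n) = n" for u n by (induction n) (auto simp: st_0 st_Suc)
  have st_eq: "st u n = w \<longleftrightarrow> L w \<le> u \<and> u < L w + m w" if "0 \<le> u" "u < 1" "length w = n" for u n w
    using that(3)
  proof (induction n arbitrary: w)
    case 0
    then show ?case using that by (simp add: st_0 L_def m1)
  next
    case (Suc n)
    then obtain v c where w: "w = v @ [c]" by (metis length_Suc_conv_rev)
    have IH: "st u n = v \<longleftrightarrow> L v \<le> u \<and> u < L v + m v" using Suc w by simp
    have "st u (Suc n) = w \<longleftrightarrow> st u n = v \<and> c = (\<not> u < L v + m (v @ [False]))"
      by (auto simp: st_Suc w)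
    then show ?case
      using IH madd[of v] m0[of "v @ [False]"] m0[of "v @ [True]"] by (cases c) (auto simp: w L_snoc)
  qed
  define X where "X u = (\<lambda>n. st u (Suc n) ! n)" for u
  have pre_X: "pre (X u) n = st u n" for u n
    by (induction n) (simp_all add: pre_snoc st_0 st_Suc X_def nth_append len, simp add: pre_def)
  define R where "R = restrict_space lborel {0..<1::real}"
  have space_R: "space R = {0..<1}" by (simp add: R_def space_restrict_space)
  have vimage: "X -` {x. pre x n \<in> B} \<inter> space R = (\<Union>w\<in>{w \<in> B. length w = n}. {L w..<L w + m w})" for n B
  proof (intro set_eqI iffI)
    fix u assume "u \<in> X -` {x. pre x n \<in> B} \<inter> space R"
    then have u: "0 \<le> u" "u < 1" "st u n \<in> B" by (auto simp: space_R pre_X)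
    then have "u \<in> {L (st u n)..<L (st u n) + m (st u n)}" using st_eq[of u "st u n" n] len by auto
    then show "u \<in> (\<Union>w\<in>{w \<in> B. length w = n}. {L w..<L w + m w})" using u(3) len by blast
  next
    fix u assume "u \<in> (\<Union>w\<in>{w \<in> B. length w = n}. {L w..<L w + m w})"
    then obtain w where w: "w \<in> B" "length w = n" "L w \<le> u" "u < L w + m w" by auto
    moreover have "0 \<le> u" "u < 1" using range[of w] w by linarith+
    ultimately show "u \<in> X -` {x. pre x n \<in> B} \<inter> space R" using st_eq[of u w n] by (simp add: space_R pre_X)
  qed
  have sets_R: "A \<in> sets R" if "A \<in> sets borel" "A \<subseteq> {0..<1}" for A
    using that by (auto simp: R_def sets_restrict_space_iff)
  have X: "X \<in> R \<rightarrow>\<^sub>M borel"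
  proof (rule measurable_sigma_sets[OF sets_borel_seq])
    fix S assume "S \<in> {{x. pre x n \<in> B} | n B. True}"
    then obtain n B where S: "S = {x. pre x n \<in> B}" by blast
    have "finite {w \<in> B. length w = n}" by (rule finite_subset[OF _ finite_words[of n]]) auto
    then have "(\<Union>w\<in>{w \<in> B. length w = n}. {L w..<L w + m w}) \<in> sets borel" by (intro sets.finite_UN) auto
    moreover have "(\<Union>w\<in>{w \<in> B. length w = n}. {L w..<L w + m w}) \<subseteq> {0..<1}"
      using vimage[of n B] space_R by blast
    ultimately show "X -` S \<inter> space R \<in> sets R" unfolding S vimage by (rule sets_R)
  qed auto
  have emb: "emeasure R (X -` cyl w \<inter> space R) = ennreal (m w)" for w
  proof -
    have c: "cyl w = {x. pre x (length w) \<in> {w}}" by (simp add: cyl_def)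
    have "X -` cyl w \<inter> space R = {L w..<L w + m w}" unfolding c vimage by auto
    moreover have "{L w..<L w + m w} \<subseteq> {0..<1}" using range[of w] by auto
    ultimately show ?thesis using m0[of w] by (simp add: R_def emeasure_restrict_space)
  qed
  have "prob_space R"
    by (rule prob_spaceI) (simp add: space_R, simp add: R_def emeasure_restrict_space)
  then have "prob_space (distr R borel X)" using X by (rule prob_space.prob_space_distr)
  moreover have "measure (distr R borel X) (cyl w) = m w" for w
    using emb[of w] m0[of w] by (simp add: measure_def emeasure_distr[OF X cyl_sets])
  ultimately show ?thesis using that[of "distr R borel X"] by simp
qed

text \<open>Splitting frequencies on the right gives consistency and hence a measure, splitting on
  the left gives its invariance, and frequency 0 outside the language puts it on \<open>TM\<close>.
  Any other candidate has the same cylinder values by \<open>measure_cyl\<close>.\<close>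

lemma TM_unique_invariant:
  obtains \<mu> where "{\<nu>. invariant_prob \<nu> \<and> supported_on \<nu> TM} = {\<mu>}"
proof -
  obtain \<mu> where \<mu>: "prob_space \<mu>" "sets \<mu> = sets (borel :: seq measure)" "\<And>w. measure \<mu> (cyl w) = freq w"
    using measure_from_cylinders[of freq] freq_nonneg freq_Nil freq_snoc by metis
  interpret prob_space \<mu> by fact
  have space: "space \<mu> = UNIV" using sets_eq_imp_space_eq[OF \<mu>(2)] by simp
  have sh: "shift \<in> \<mu> \<rightarrow>\<^sub>M borel" using shift_measurable \<mu>(2) by (simp cong: measurable_cong_sets)
  have "distr \<mu> borel shift = \<mu>"
  proof (rule prob_eqI_cyl)
    show "prob_space (distr \<mu> borel shift)" using sh by (rule prob_space_distr)
    fix w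
    have "shift -` cyl w \<inter> space \<mu> = cyl (False # w) \<union> cyl (True # w)"
      by (auto simp: space cyl_def pre_Suc)
    moreover have "cyl (False # w) \<inter> cyl (True # w) = {}" by (auto simp: cyl_def)
    ultimately have "measure (distr \<mu> borel shift) (cyl w) = measure \<mu> (cyl (False # w)) + measure \<mu> (cyl (True # w))"
      using cyl_sets \<mu>(2) by (simp add: measure_distr[OF sh] finite_measure_Union)
    then show "measure (distr \<mu> borel shift) (cyl w) = measure \<mu> (cyl w)"
      using freq_Cons[of w] \<mu>(3) by simp
  qed (use \<mu> in auto)
  then have inv: "invariant_prob \<mu>" using \<mu> by (simp add: invariant_prob_def)
  have "AE x in \<mu>. \<forall>n. pre x n \<in> lang"
  proof (subst AE_all_countable, rule allI)
    fix n
    have "measure \<mu> {x. pre x n \<in> - lang} = 0"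
      unfolding measure_pre[OF \<mu>(1,2)] using \<mu>(3) freq_notin_lang by (intro sum.neutral) auto
    then have "emeasure \<mu> {x. pre x n \<notin> lang} = 0" by (simp add: emeasure_eq_measure)
    then show "AE x in \<mu>. pre x n \<in> lang"
      using pre_sets[of n "- lang"] \<mu>(2) by (intro AE_I[of _ _ "{x. pre x n \<notin> lang}"]) (auto simp: space)
  qed
  then have "AE x in \<mu>. x \<in> TM" by (simp add: TM_iff)
  then have "supported_on \<mu> TM"
    using TM_sets \<mu>(2) AE_in_set_eq_1[of TM] by (simp add: supported_on_def emeasure_eq_measure)
  moreover have "\<nu> = \<mu>" if \<nu>: "invariant_prob \<nu>" "supported_on \<nu> TM" for \<nu>
  proof -
    interpret N: inv_measure \<nu> using \<nu>(1) by unfold_locales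
    show ?thesis
      using N.prob_space_axioms N.sets_mu \<mu> N.measure_cyl[OF \<nu>(2)] by (intro prob_eqI_cyl) auto
  qed
  ultimately have "{\<nu>. invariant_prob \<nu> \<and> supported_on \<nu> TM} = {\<mu>}" using inv by blast
  then show ?thesis using that by blast
qed

section \<open>Freezing\<close>

lemma (in inv_measure) supported_TM_iff: "supported_on \<mu> TM \<longleftrightarrow> (AE x in \<mu>. x \<in> TM)"
  using TM_sets AE_in_set_eq_1[of TM] by (simp add: supported_on_def emeasure_eq_measure)

lemma (in inv_measure) integrable_continuous:
  fixes f :: "seq \<Rightarrow> real"
  assumes "continuous_on UNIV f"
  shows "integrable \<mu> f"
proof -
  have "bounded (range f)"
    using compact_continuous_image[OF assms compact_seq] by (rule compact_imp_bounded)
  then obtain B where "\<And>x. \<bar>f x\<bar> \<le> B" by (auto simp: bounded_iff)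
  moreover have "f \<in> borel_measurable \<mu>"
    using borel_measurable_continuous_onI[OF assms] by (simp cong: measurable_cong_sets)
  ultimately show ?thesis by (intro integrable_const_bound[of _ B]) auto
qed

lemma free_energy_le:
  assumes "invariant_prob \<nu>" "V = (\<lambda>x. - \<phi> x)" "continuous_on UNIV \<phi>"
    "c > 0" "\<And>x. c * phi0 TM x \<le> \<phi> x"
  shows "free_energy V \<beta> \<nu> \<le> ereal ((16 / c - \<beta>) * (\<integral>x. \<phi> x \<partial>\<nu>))"
proof -
  interpret inv_measure \<nu> using assms(1) by unfold_locales
  have "integrable \<nu> (\<lambda>x. 16 / c * \<phi> x)" using integrable_continuous[OF assms(3)] by simp
  moreover have "16 * phi0 TM x \<le> 16 / c * \<phi> x" for x
    using assms(4) assms(5)[of x] by (simp add: field_simps)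
  ultimately have "kolmogorov_entropy shift \<nu> \<le> ereal (\<integral>x. 16 / c * \<phi> x \<partial>\<nu>)"
    by (rule kolmogorov_entropy_le[OF assms(1)])
  then have "free_energy V \<beta> \<nu> \<le> ereal (\<integral>x. 16 / c * \<phi> x \<partial>\<nu>) + ereal (\<beta> * (\<integral>x. V x \<partial>\<nu>))"
    unfolding free_energy_def by (rule add_right_mono)
  also have "\<dots> = ereal ((16 / c - \<beta>) * (\<integral>x. \<phi> x \<partial>\<nu>))"
    using assms(2) by (simp add: algebra_simps)
  finally show ?thesis .
qed

theorem theorem1:
  fixes V :: "seq \<Rightarrow> real"
  assumes "V \<in> Xi TM"
  shows "\<exists>\<beta>\<^sub>0\<ge>0.
    (\<forall>\<beta>>\<beta>\<^sub>0. pressure V \<beta> = 0 \<and>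
       (\<exists>\<mu>. {\<nu>. invariant_prob \<nu> \<and> supported_on \<nu> TM} = {\<mu>} \<and>
            {\<nu>. equilibrium_measure V \<beta> \<nu>} = {\<mu>})) \<and>
    (V = V0 TM \<longrightarrow> \<beta>\<^sub>0 < 16.6)"
proof -
  obtain \<phi> c0 where \<phi>: "V = (\<lambda>x. - \<phi> x)" "continuous_on UNIV \<phi>" "\<And>x. \<phi> x \<ge> 0"
    "\<And>x. \<phi> x = 0 \<longleftrightarrow> x \<in> TM" and c0: "c0 > 0" "\<And>x. c0 * phi0 TM x \<le> \<phi> x"
    by (rule Xi_TM_lower_bound[OF assms]) (rule that)
  \<comment> \<open>The constant from compactness is not explicit. For \<open>V0\<close> the
    comparison is an equality with constant 1, which makes the threshold 16 / c equal to 16.\<close>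
  define c where "c = (if V = V0 TM then 1 else c0)"
  have "\<phi> x = phi0 TM x" if "V = V0 TM" for x
    using fun_cong[OF that, of x] \<phi>(1) by (simp add: V0_def)
  then have c: "c > 0" "\<And>x. c * phi0 TM x \<le> \<phi> x" using c0 by (auto simp: c_def)
  obtain \<mu> where \<mu>: "{\<nu>. invariant_prob \<nu> \<and> supported_on \<nu> TM} = {\<mu>}"
    using TM_unique_invariant .
  then have inv: "invariant_prob \<mu>" and supp: "supported_on \<mu> TM" by auto
  have I0: "(\<integral>x. \<phi> x \<partial>\<nu>) \<ge> 0" for \<nu> using \<phi>(3) by simp
  have "pressure V \<beta> = 0 \<and> {\<nu>. equilibrium_measure V \<beta> \<nu>} = {\<mu>}" if \<beta>: "\<beta> > 16 / c" for \<beta>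
  proof -
    note upper = free_energy_le[OF _ \<phi>(1,2) c]
    have nonpos: "free_energy V \<beta> \<nu> \<le> 0" if "invariant_prob \<nu>" for \<nu>
    proof -
      have "(16 / c - \<beta>) * (\<integral>x. \<phi> x \<partial>\<nu>) \<le> 0" using \<beta> I0 by (intro mult_nonpos_nonneg) auto
      then show ?thesis using upper[OF that, of \<beta>] by (metis ereal_less_eq(3) order_trans zero_ereal_def)
    qed
    have zero: "free_energy V \<beta> \<mu> = 0"
    proof (rule antisym[OF nonpos[OF inv]])
      interpret inv_measure \<mu> using inv by unfold_locales
      have "AE x in \<mu>. V x = 0"
        using supp \<phi>(1,4) unfolding supported_TM_iff by (auto elim!: eventually_mono)
      then have "(\<integral>x. V x \<partial>\<mu>) = 0" by (rule integral_eq_zero_AE)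
      then show "0 \<le> free_energy V \<beta> \<mu>"
        using kolmogorov_entropy_nonneg[OF inv] by (simp add: free_energy_def zero_ereal_def[symmetric])
    qed
    have pressure: "pressure V \<beta> = 0"
      unfolding pressure_def
    proof (rule antisym)
      show "(SUP \<nu>\<in>{\<mu>. invariant_prob \<mu>}. free_energy V \<beta> \<nu>) \<le> 0"
        using nonpos by (intro SUP_least) auto
      show "0 \<le> (SUP \<nu>\<in>{\<mu>. invariant_prob \<mu>}. free_energy V \<beta> \<nu>)"
        using inv zero by (intro SUP_upper2[of \<mu>]) auto
    qed
    have "\<nu> = \<mu>" if \<nu>: "equilibrium_measure V \<beta> \<nu>" for \<nu>
    proof -
      have inv\<nu>: "invariant_prob \<nu>" and fe: "free_energy V \<beta> \<nu> = 0"
        using \<nu> pressure by (auto simp: equilibrium_measure_def)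
      interpret inv_measure \<nu> using inv\<nu> by unfold_locales
      \<comment> \<open>The factor in parentheses is strictly negative, so an equilibrium measure
        cannot charge the set where \<phi> is positive.\<close>
      have "0 \<le> (16 / c - \<beta>) * (\<integral>x. \<phi> x \<partial>\<nu>)"
        using upper[OF inv\<nu>, of \<beta>] fe by (simp add: zero_ereal_def)
      then have "(\<integral>x. \<phi> x \<partial>\<nu>) = 0"
        using \<beta> I0[of \<nu>] by (auto simp: zero_le_mult_iff)
      then have "AE x in \<nu>. \<phi> x = 0"
        using integral_nonneg_eq_0_iff_AE[OF integrable_continuous[OF \<phi>(2)]] \<phi>(3) by simp
      then have "supported_on \<nu> TM" unfolding supported_TM_iff using \<phi>(4) by simp
      then show ?thesis using \<mu> inv\<nu> by blast
    qed
    moreover have "equilibrium_measure V \<beta> \<mu>"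
      using pressure zero inv by (simp add: equilibrium_measure_def)
    ultimately have "{\<nu>. equilibrium_measure V \<beta> \<nu>} = {\<mu>}" by blast
    then show ?thesis using pressure by simp
  qed
  moreover have "16 / c \<ge> 0" "V = V0 TM \<longrightarrow> 16 / c < 16.6" using c(1) by (auto simp: c_def)
  ultimately show ?thesis using \<mu> by blast
qed

end
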